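(* Let $\mathbf{w}=(\omega_i)_{i\ge 0}$ be a sequence of non-negative reals with $\omega_0>0$ and $\omega_k>0$ for at least one $k\ge 2$, and suppose that $\Phi(z)=\sum_{k\ge 0}\omega_k z^k$ has positive radius of convergence $\rho_\Phi>0$. For every admissible $n$ let $\mathcal{U}_n$ be the simply generated unrooted plane tree with $n$ vertices, and for every admissible $m$ let $\mathcal{T}_m$ be the simply generated planted plane tree with $m$ vertices (both with respect to $\mathbf{w}$). Then there are constants $C,c>0$ and, for each admissible $n$, a random planted plane tree $\mathcal{V}_n$ that is independent from the family $(\mathcal{T}_m)_m$ and whose number of vertices $K_n:=|\mathcal{V}_n|$ is stochastically bounded, $K_n=O_p(1)$, such that the random unrooted plane tree $\mathcal{S}_n$ constructed by connecting the root of $\mathcal{T}_{n-K_n}$ and the root of $\mathcal{V}_n$ with an edge satisfies \[ d_{\mathrm{TV}}(\mathcal{U}_n,\mathcal{S}_n)\le C\exp(-cn) \] for all admissible $n$. Furthermore, there is a Galton--Watson tree $\mathcal{T}$ that is subcritical or critical such that \[ \mathcal{V}_n \overset{d}{\longrightarrow} \mathcal{T} \] as $n\to\infty$ along $n\equiv 2 \bmod \mathrm{span}(\mathbf{w})$. The offspring distribution of $\mathcal{T}$ may be taken to be the law of the random variable $\xi$ constructed canonically from $\mathbf{w}$ as described in the context.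
   Context: Trees. An unrooted plane tree is an (unlabelled) tree in which each vertex is endowed with a cyclic ordering of its neighbourhood, considered up to isomorphism. A planted plane tree is a finite rooted tree in which each vertex has a linearly ordered (possibly empty) list of children. $|T|$ is the number of vertices of $T$. $\mathscr{U}_n$ and $\mathscr{T}_n$ are the sets of unlabelled unrooted plane trees, respectively planted plane trees, with $n$ vertices. Random trees. $U\in\mathscr{U}_n$ ($n \ge 2$) has weight $\bar\omega(U)=\prod_{v\in U}\omega_{d_U(v)-1}$, where $d_U(v)$ is the degree of $v$; $\mathcal{U}_n$ is sampled from $\mathscr{U}_n$ with probability proportional to $\bar\omega$. $T\in\mathscr{T}_m$ has weight $\omega(T)=\prod_{v\in T}\omega_{d^+_T(v)}$, where $d_T^+(v)$ is the outdegree (number of children) of $v$; $\mathcal{T}_m$ is sampled from $\mathscr{T}_m$ with probability proportional to $\omega$. An integer is called admissible (for $\mathcal{U}_n$, resp. $\mathcal{T}_m$) if there is at least one tree of that size of positive weight. Let $\mathrm{span}(\mathbf{w})$ be the greatest common divisor of all $i\ge0$ with $\omega_i>0$; for large integers, admissibility means $n\equiv 2$ (for $\mathcal{U}_n$), resp. $m\equiv 1$ (for $\mathcal{T}_m$), modulo $\mathrm{span}(\mathbf{w})$. Joining two planted plane trees: the new edge is inserted at each of the two roots before the first (equivalently, cyclically, after the last) child; the roots are then forgotten and the linear orders become cyclic orders. Canonical offspring distribution. Set $\Psi(t)=t\Phi'(t)/\Phi(t)$ and $\nu=\lim_{t\nearrow\rho_\Phi}\Psi(t)\in(0,\infty]$.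 If $\nu\ge 1$ let $\tau$ be the unique finite number with $\Psi(\tau)=1$; if $\nu<1$ let $\tau=\rho_\Phi$. Then $\xi$ is the random non-negative integer with $\mathbb{P}(\xi=k)=\omega_k\tau^k/\Phi(\tau)$, $k\ge 0$; it has mean $\min(\nu,1)\le 1$. Total variation distance of random variables in a countable space $S$: $d_{\mathrm{TV}}(X,Y)=\sup_{\mathcal{E}\subset S}|\mathbb{P}(X\in\mathcal{E})-\mathbb{P}(Y\in\mathcal{E})|$. $X_n=O_p(1)$ means: for each $\epsilon>0$ there is $M>0$ with $\limsup_n\mathbb{P}(|X_n|\ge M)\le\epsilon$. Convergence in distribution of random planted plane trees is in the countable discrete space of finite planted plane trees. *)

theory Defs
  imports
    "HOL-Probability.Probability"
    "HOL-Combinatorics.Cycles"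
    "HOL-Combinatorics.Orbits"
    "HOL-Number_Theory.Cong"
begin

section \<open>Unrooted plane trees\<close>

record 'v rot_graph =
  verts :: "'v set"
  adj :: "('v \<times> 'v) set"
  rot :: "'v \<Rightarrow> 'v \<Rightarrow> 'v"
    \<comment> \<open>\<open>rot G v u\<close> is the successor of \<open>u\<close> in the cyclic ordering of the neighbourhood of \<open>v\<close>;
        its values for \<open>u\<close> outside that neighbourhood are irrelevant.\<close>

definition nbhd :: "'v rot_graph \<Rightarrow> 'v \<Rightarrow> 'v set" where
  "nbhd G v = {u. (v, u) \<in> adj G}"

definition is_plane_tree :: "'v rot_graph \<Rightarrow> bool" where
  "is_plane_tree G \<longleftrightarrow>
     finite (verts G) \<and> verts G \<noteq> {} \<and>
     adj G \<subseteq> verts G \<times> verts G \<and> sym (adj G) \<and> irrefl (adj G) \<and>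
     (\<forall>u\<in>verts G. \<forall>v\<in>verts G. (u, v) \<in> (adj G)\<^sup>*) \<and>
     (\<nexists>p. length p \<ge> 3 \<and> distinct p \<and>
          (\<forall>i<length p. (p ! i, p ! (Suc i mod length p)) \<in> adj G)) \<and>
     (\<forall>v\<in>verts G. nbhd G v \<noteq> {} \<longrightarrow> cyclic_on (rot G v) (nbhd G v))"

definition plane_iso :: "'v rot_graph \<Rightarrow> 'w rot_graph \<Rightarrow> ('v \<Rightarrow> 'w) \<Rightarrow> bool" where
  "plane_iso G H f \<longleftrightarrow>
     bij_betw f (verts G) (verts H) \<and>
     (\<forall>u\<in>verts G. \<forall>v\<in>verts G. (u, v) \<in> adj G \<longleftrightarrow> (f u, f v) \<in> adj H) \<and>
     (\<forall>v\<in>verts G. \<forall>u\<in>nbhd G v. f (rot G v u) = rot H (f v) (f u))"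

definition plane_tree_equiv :: "'v rot_graph \<Rightarrow> 'v rot_graph \<Rightarrow> bool" where
  "plane_tree_equiv G H \<longleftrightarrow> is_plane_tree G \<and> is_plane_tree H \<and> (\<exists>f. plane_iso G H f)"

lemma plane_iso_nbhd:
  assumes G: "adj G \<subseteq> verts G \<times> verts G" and H: "adj H \<subseteq> verts H \<times> verts H"
    and f: "plane_iso G H f" and v: "v \<in> verts G"
  shows "nbhd H (f v) = f ` nbhd G v"
proof
  show "f ` nbhd G v \<subseteq> nbhd H (f v)"
    using f v G unfolding plane_iso_def nbhd_def by auto
  show "nbhd H (f v) \<subseteq> f ` nbhd G v"
  proof
    fix y assume y: "y \<in> nbhd H (f v)"
    then have "y \<in> verts H" using H by (auto simp: nbhd_def)
    then obtain x where x: "x \<in> verts G" "y = f x"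
      using f by (metis bij_betw_imp_surj_on imageE plane_iso_def)
    then have "(v, x) \<in> adj G" using f v y by (auto simp: plane_iso_def nbhd_def)
    then show "y \<in> f ` nbhd G v" using x by (auto simp: nbhd_def)
  qed
qed

lemma plane_tree_equiv_sym:
  assumes "plane_tree_equiv G H" shows "plane_tree_equiv H G"
proof -
  from assms obtain f where G: "is_plane_tree G" and H: "is_plane_tree H" and f: "plane_iso G H f"
    by (auto simp: plane_tree_equiv_def)
  from G H have aG: "adj G \<subseteq> verts G \<times> verts G" and aH: "adj H \<subseteq> verts H \<times> verts H"
    by (auto simp: is_plane_tree_def)
  define g where "g = inv_into (verts G) f"
  have bf: "bij_betw f (verts G) (verts H)" using f by (simp add: plane_iso_def)
  then have bg: "bij_betw g (verts H) (verts G)" unfolding g_def by (rule bij_betw_inv_into)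
  have fg: "f (g y) = y" if "y \<in> verts H" for y
    using bf that unfolding g_def by (simp add: bij_betw_inv_into_right)
  have gf: "g (f x) = x" if "x \<in> verts G" for x
    using bf that unfolding g_def by (simp add: bij_betw_inv_into_left)
  have gin: "g y \<in> verts G" if "y \<in> verts H" for y
    using bg that by (auto simp: bij_betw_def)
  have "plane_iso H G g"
    unfolding plane_iso_def
  proof (intro conjI ballI)
    show "bij_betw g (verts H) (verts G)" by (fact bg)
  next
    fix u v assume "u \<in> verts H" "v \<in> verts H"
    then show "(u, v) \<in> adj H \<longleftrightarrow> (g u, g v) \<in> adj G"
      using f gin fg by (auto simp: plane_iso_def)
  next
    fix v u assume v: "v \<in> verts H" and u: "u \<in> nbhd H v"
    have "nbhd H v = f ` nbhd G (g v)"
      using plane_iso_nbhd[OF aG aH f gin[OF v]] fg[OF v] by simp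
    with u obtain x where x: "x \<in> nbhd G (g v)" "u = f x" by auto
    have xin: "x \<in> verts G" using x aG by (auto simp: nbhd_def)
    have "cyclic_on (rot G (g v)) (nbhd G (g v))"
      using G gin[OF v] x by (auto simp: is_plane_tree_def)
    then have "rot G (g v) x \<in> nbhd G (g v)" using x by (meson cyclic_on_inI)
    then have rin: "rot G (g v) x \<in> verts G" using aG by (auto simp: nbhd_def)
    have "f (rot G (g v) x) = rot H (f (g v)) (f x)"
      using f gin[OF v] x by (auto simp: plane_iso_def)
    then have "rot H v u = f (rot G (g v) x)" using x fg[OF v] by simp
    then show "g (rot H v u) = rot G (g v) (g u)" using gf rin xin x by simp
  qed
  with G H show ?thesis by (auto simp: plane_tree_equiv_def)
qed

lemma plane_tree_equiv_trans:
  assumes "plane_tree_equiv G H" "plane_tree_equiv H K" shows "plane_tree_equiv G K"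
proof -
  from assms obtain f g where G: "is_plane_tree G" and H: "is_plane_tree H"
    and K: "is_plane_tree K" and f: "plane_iso G H f" and g: "plane_iso H K g"
    by (auto simp: plane_tree_equiv_def)
  from G H have aG: "adj G \<subseteq> verts G \<times> verts G" and aH: "adj H \<subseteq> verts H \<times> verts H"
    by (auto simp: is_plane_tree_def)
  have fin: "f v \<in> verts H" if "v \<in> verts G" for v
    using f that by (auto simp: plane_iso_def bij_betw_def)
  have "plane_iso G K (g \<circ> f)"
    unfolding plane_iso_def
  proof (intro conjI ballI)
    show "bij_betw (g \<circ> f) (verts G) (verts K)"
      using f g by (auto simp: plane_iso_def intro: bij_betw_trans)
  next
    fix u v assume "u \<in> verts G" "v \<in> verts G"
    then show "(u, v) \<in> adj G \<longleftrightarrow> ((g \<circ> f) u, (g \<circ> f) v) \<in> adj K"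
      using f g fin by (simp add: plane_iso_def)
  next
    fix v u assume v: "v \<in> verts G" and u: "u \<in> nbhd G v"
    then have "f u \<in> nbhd H (f v)" using plane_iso_nbhd[OF aG aH f v] by auto
    then show "(g \<circ> f) (rot G v u) = rot K ((g \<circ> f) v) ((g \<circ> f) u)"
      using f g fin v u by (simp add: plane_iso_def)
  qed
  with G K show ?thesis by (auto simp: plane_tree_equiv_def)
qed

text \<open>
  Isomorphism classes of finite plane trees. Since vertices are finite in number, every class is
  represented on the infinite vertex supply \<^typ>\<open>nat list\<close>, which is convenient because the
  vertices of a planted plane tree are addressed by such lists below.
\<close>

quotient_type uptree = "nat list rot_graph" / partial: plane_tree_equiv
proof (rule part_equivpI)
  let ?G = "\<lparr>verts = {[]}, adj = {}, rot = (\<lambda>_ _. [])\<rparr> :: nat list rot_graph"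
  have "is_plane_tree ?G"
    by (auto simp: is_plane_tree_def nbhd_def sym_def irrefl_def intro!: exI[of _ 0])
  moreover have "plane_iso ?G ?G id" by (auto simp: plane_iso_def)
  ultimately show "\<exists>x :: nat list rot_graph. plane_tree_equiv x x"
    unfolding plane_tree_equiv_def by blast
  show "symp plane_tree_equiv" by (rule sympI) (rule plane_tree_equiv_sym)
  show "transp plane_tree_equiv" by (rule transpI) (rule plane_tree_equiv_trans)
qed

lemma plane_tree_equiv_refl: "is_plane_tree G \<Longrightarrow> plane_tree_equiv G G"
  unfolding plane_tree_equiv_def plane_iso_def by (auto intro!: exI[of _ id])

lift_definition usize :: "uptree \<Rightarrow> nat" is "\<lambda>G. card (verts G)"
  by (auto simp: plane_tree_equiv_def plane_iso_def intro: bij_betw_same_card)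

text \<open>
  The truncated subtraction only affects the one-vertex tree, which is excluded wherever
  the weight is used.
\<close>

lift_definition uweight :: "(nat \<Rightarrow> real) \<Rightarrow> uptree \<Rightarrow> real" is
  "\<lambda>w G. \<Prod>v\<in>verts G. w (card (nbhd G v) - 1)"
proof -
  fix w :: "nat \<Rightarrow> real" and G H :: "nat list rot_graph"
  assume "plane_tree_equiv G H"
  then obtain f where G: "is_plane_tree G" and H: "is_plane_tree H" and f: "plane_iso G H f"
    by (auto simp: plane_tree_equiv_def)
  have aG: "adj G \<subseteq> verts G \<times> verts G" and aH: "adj H \<subseteq> verts H \<times> verts H"
    using G H by (auto simp: is_plane_tree_def)
  have bf: "bij_betw f (verts G) (verts H)" using f by (simp add: plane_iso_def)
  have "card (nbhd H (f v)) = card (nbhd G v)" if v: "v \<in> verts G" for v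
  proof -
    have "nbhd G v \<subseteq> verts G" using aG by (auto simp: nbhd_def)
    then have "inj_on f (nbhd G v)" using bf by (meson bij_betw_def inj_on_subset)
    then show ?thesis using plane_iso_nbhd[OF aG aH f v] by (simp add: card_image)
  qed
  then show "(\<Prod>v\<in>verts G. w (card (nbhd G v) - 1)) = (\<Prod>v\<in>verts H. w (card (nbhd H v) - 1))"
    using prod.reindex_bij_betw[OF bf, of "\<lambda>v. w (card (nbhd H v) - 1)"] by simp
qed


section \<open>Planted plane trees\<close>

datatype ptree = Node (children: "ptree list")

text \<open>
  Vertices are addressed as in the Ulam--Harris tree: the root is \<open>[]\<close> and \<open>p @ [i]\<close> is
  the \<open>i\<close>-th child (counted from 0) of \<open>p\<close>.
\<close>

fun is_node :: "ptree \<Rightarrow> nat list \<Rightarrow> bool" where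
  "is_node t [] \<longleftrightarrow> True"
| "is_node t (i # p) \<longleftrightarrow> i < length (children t) \<and> is_node (children t ! i) p"

fun subtree_at :: "ptree \<Rightarrow> nat list \<Rightarrow> ptree" where
  "subtree_at t [] = t"
| "subtree_at t (i # p) = subtree_at (children t ! i) p"

definition nodes :: "ptree \<Rightarrow> nat list set" where
  "nodes t = {p. is_node t p}"

definition outdeg :: "ptree \<Rightarrow> nat list \<Rightarrow> nat" where
  "outdeg t p = length (children (subtree_at t p))"

definition psize :: "ptree \<Rightarrow> nat" where
  "psize t = card (nodes t)"

definition pweight :: "(nat \<Rightarrow> real) \<Rightarrow> ptree \<Rightarrow> real" where
  "pweight w t = (\<Prod>p\<in>nodes t. w (outdeg t p))"


section \<open>Forgetting the root and joining\<close>

text \<open>The neighbours of a vertex in order: first the parent (if any), then the children.\<close>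

definition nbr_list :: "ptree \<Rightarrow> nat list \<Rightarrow> nat list list" where
  "nbr_list t p = (if p = [] then [] else [butlast p]) @ map (\<lambda>i. p @ [i]) [0..<outdeg t p]"

definition plane_graph_of :: "ptree \<Rightarrow> nat list rot_graph" where
  "plane_graph_of t =
     \<lparr>verts = nodes t,
      adj = {(p, q). p \<in> nodes t \<and> q \<in> set (nbr_list t p)},
      rot = (\<lambda>p. cycle_of_list (nbr_list t p))\<rparr>"

lemma is_node_snoc: "is_node t (p @ [i]) \<longleftrightarrow> is_node t p \<and> i < outdeg t p"
  by (induction p arbitrary: t) (auto simp: outdeg_def)

lemma nodes_Node: "nodes (Node ts) = insert [] (\<Union>i<length ts. (#) i ` nodes (ts ! i))"
proof (rule set_eqI)
  fix p show "p \<in> nodes (Node ts) \<longleftrightarrow> p \<in> insert [] (\<Union>i<length ts. (#) i ` nodes (ts ! i))"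
    by (cases p) (auto simp: nodes_def)
qed

lemma finite_nodes: "finite (nodes t)"
proof (induction t)
  case (Node ts)
  then show ?case by (auto simp: nodes_Node)
qed

lemma adj_plane_graph_of:
  "(p, q) \<in> adj (plane_graph_of t) \<longleftrightarrow>
     p \<in> nodes t \<and> q \<in> nodes t \<and> ((\<exists>i. p = q @ [i]) \<or> (\<exists>i. q = p @ [i]))"
proof -
  have "p \<noteq> [] \<and> q = butlast p \<longleftrightarrow> (\<exists>i. p = q @ [i])"
    by (metis append_butlast_last_id butlast_snoc snoc_eq_iff_butlast)
  then show ?thesis
    by (auto simp: plane_graph_of_def nbr_list_def nodes_def is_node_snoc outdeg_def split: if_splits)
qed

lemma distinct_nbr_list: "distinct (nbr_list t p)"
proof -
  have "butlast p \<noteq> p @ [i]" for i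
  proof
    assume "butlast p = p @ [i]"
    then have "length (butlast p) = length (p @ [i])" by (rule arg_cong)
    then show False by simp
  qed
  then show ?thesis by (auto simp: nbr_list_def distinct_map inj_on_def)
qed

lemma cyclic_on_cycle_of_list:
  assumes "distinct cs" "cs \<noteq> []"
  shows "cyclic_on (cycle_of_list cs) (set cs)"
proof (rule cyclic_on_singleI)
  let ?f = "cycle_of_list cs"
  show hd: "hd cs \<in> set cs" using assms by simp
  have pow: "(?f ^^ k) (hd cs) = cs ! (k mod length cs)" for k
  proof -
    have "map (?f ^^ k) cs ! 0 = rotate k cs ! 0"
      using cyclic_rotation[OF assms(1), of k] by simp
    then show ?thesis using assms(2) by (simp add: hd_conv_nth nth_rotate)
  qed
  show "set cs = orbit ?f (hd cs)"
  proof
    show "orbit ?f (hd cs) \<subseteq> set cs"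
      using assms(2) by (auto simp: orbit_altdef pow)
    show "set cs \<subseteq> orbit ?f (hd cs)"
    proof
      fix x assume "x \<in> set cs"
      then obtain i where i: "i < length cs" "x = cs ! i" by (auto simp: in_set_conv_nth)
      then have "x = (?f ^^ (i + length cs)) (hd cs)" by (simp add: pow)
      moreover have "0 < i + length cs" using assms(2) by simp
      ultimately show "x \<in> orbit ?f (hd cs)" unfolding orbit_altdef by blast
    qed
  qed
qed

lemma is_plane_tree_plane_graph_of: "is_plane_tree (plane_graph_of t)"
  unfolding is_plane_tree_def
proof (intro conjI ballI impI)
  let ?G = "plane_graph_of t"
  have V: "verts ?G = nodes t" by (simp add: plane_graph_of_def)
  show "finite (verts ?G)" by (simp add: V finite_nodes)
  have "[] \<in> nodes t" by (simp add: nodes_def)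
  then show "verts ?G \<noteq> {}" by (auto simp: V)
  show "adj ?G \<subseteq> verts ?G \<times> verts ?G" by (auto simp: V adj_plane_graph_of)
  show sym: "sym (adj ?G)" by (auto simp: sym_def adj_plane_graph_of)
  show "irrefl (adj ?G)" by (auto simp: irrefl_def adj_plane_graph_of)
  have root: "(p, []) \<in> (adj ?G)\<^sup>*" if "p \<in> nodes t" for p
    using that
  proof (induction p rule: rev_induct)
    case Nil
    show ?case by simp
  next
    case (snoc i p)
    then have "p \<in> nodes t" by (simp add: nodes_def is_node_snoc)
    with snoc have "(p @ [i], p) \<in> adj ?G" by (auto simp: adj_plane_graph_of)
    with snoc.IH[OF \<open>p \<in> nodes t\<close>] show ?case by (rule converse_rtrancl_into_rtrancl[rotated])
  qed
  fix u v assume "u \<in> verts ?G" "v \<in> verts ?G"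
  then have "(u, []) \<in> (adj ?G)\<^sup>*" "(v, []) \<in> (adj ?G)\<^sup>*" using root V by auto
  moreover from this(2) have "([], v) \<in> (adj ?G)\<^sup>*"
    using sym by (meson sym_rtrancl symD)
  ultimately show "(u, v) \<in> (adj ?G)\<^sup>*" by simp
next
  let ?G = "plane_graph_of t"
  show "\<nexists>p. length p \<ge> 3 \<and> distinct p \<and>
          (\<forall>i<length p. (p ! i, p ! (Suc i mod length p)) \<in> adj ?G)"
  proof
    assume "\<exists>p. length p \<ge> 3 \<and> distinct p \<and>
          (\<forall>i<length p. (p ! i, p ! (Suc i mod length p)) \<in> adj ?G)"
    then obtain p where p: "length p \<ge> 3" "distinct p"
      and a: "\<And>i. i < length p \<Longrightarrow> (p ! i, p ! (Suc i mod length p)) \<in> adj ?G" by blast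
    let ?n = "length p"
    have "Max ((\<lambda>i. length (p ! i)) ` {..<?n}) \<in> (\<lambda>i. length (p ! i)) ` {..<?n}"
      by (rule Max_in) (use p in \<open>auto simp: lessThan_empty_iff\<close>)
    then obtain m where m: "m < ?n" and "length (p ! m) = Max ((\<lambda>i. length (p ! i)) ` {..<?n})"
      by auto
    then have mx: "length (p ! i) \<le> length (p ! m)" if "i < ?n" for i
      using that by simp
    define j where "j = (m + ?n - 1) mod ?n"
    have "0 < ?n" using p(1) by linarith
    then have "Suc (m + ?n - 1) = m + ?n" by linarith
    then have sj: "Suc j mod ?n = m" using m by (simp only: j_def mod_Suc_eq) simp
    have jn: "j < ?n" and sn: "Suc m mod ?n < ?n" using \<open>0 < ?n\<close> by (simp_all only: j_def mod_less_divisor)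
    have ne: "j \<noteq> Suc m mod ?n"
    proof
      assume "j = Suc m mod ?n"
      then have "Suc (Suc m mod ?n) mod ?n = m" using sj by simp
      then have "(m + 2) mod ?n = m mod ?n" using m by (simp add: mod_Suc_eq)
      then have "?n dvd 2" using mod_eq_dvd_iff_nat[of m "m + 2" ?n] by simp
      then show False using p(1) by (auto dest: dvd_imp_le)
    qed
    have par: "\<exists>c. p ! m = q @ [c]" if "(p ! m, q) \<in> adj ?G" "length q \<le> length (p ! m)" for q
      using that by (auto simp: adj_plane_graph_of)
    have "(p ! j, p ! m) \<in> adj ?G" using a[OF jn] sj by simp
    then have "(p ! m, p ! j) \<in> adj ?G" by (auto simp: adj_plane_graph_of)
    then obtain c where c: "p ! m = p ! j @ [c]" using par mx jn by blast
    obtain d where d: "p ! m = p ! (Suc m mod ?n) @ [d]" using par a[OF m] mx sn by blast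
    have "p ! j = p ! (Suc m mod ?n)" using c d by simp
    then show False using ne jn sn p(2) by (simp add: nth_eq_iff_index_eq)
  qed
next
  let ?G = "plane_graph_of t"
  fix v assume "v \<in> verts ?G" and ne: "nbhd ?G v \<noteq> {}"
  then have "nbhd ?G v = set (nbr_list t v)" by (auto simp: nbhd_def plane_graph_of_def)
  with ne show "cyclic_on (rot ?G v) (nbhd ?G v)"
    using cyclic_on_cycle_of_list[OF distinct_nbr_list[of t v]] by (auto simp: plane_graph_of_def)
qed

lift_definition forget_root :: "ptree \<Rightarrow> uptree" is plane_graph_of
  by (rule plane_tree_equiv_refl) (rule is_plane_tree_plane_graph_of)

text \<open>
  Joining two planted plane trees by an edge between their roots. Inserting the edge before the
  first child of the root of \<open>T\<close> makes the root of \<open>V\<close> a new first child of the root of \<open>T\<close>;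
  at the root of \<open>V\<close> the new edge then leads to the parent, which precedes the children in
  \<^const>\<open>nbr_list\<close>.
\<close>

definition join_trees :: "ptree \<Rightarrow> ptree \<Rightarrow> uptree" where
  "join_trees T V = forget_root (Node (V # children T))"


section \<open>Simply generated trees\<close>

text \<open>
  The law on the finite set \<open>A\<close> proportional to the non-negative weights \<open>f\<close>; meaningful
  only if some element of \<open>A\<close> has positive weight.
\<close>

definition weighted_pmf :: "'a set \<Rightarrow> ('a \<Rightarrow> real) \<Rightarrow> 'a pmf" where
  "weighted_pmf A f = embed_pmf (\<lambda>x. if x \<in> A then f x / (\<Sum>y\<in>A. f y) else 0)"

definition unrooted_law :: "(nat \<Rightarrow> real) \<Rightarrow> nat \<Rightarrow> uptree pmf" where
  "unrooted_law w n = weighted_pmf {U. usize U = n} (uweight w)"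

definition planted_law :: "(nat \<Rightarrow> real) \<Rightarrow> nat \<Rightarrow> ptree pmf" where
  "planted_law w m = weighted_pmf {T. psize T = m} (pweight w)"

definition admissible_unrooted :: "(nat \<Rightarrow> real) \<Rightarrow> nat \<Rightarrow> bool" where
  "admissible_unrooted w n \<longleftrightarrow> n \<ge> 2 \<and> (\<exists>U. usize U = n \<and> uweight w U > 0)"

definition admissible_planted :: "(nat \<Rightarrow> real) \<Rightarrow> nat \<Rightarrow> bool" where
  "admissible_planted w m \<longleftrightarrow> (\<exists>T. psize T = m \<and> pweight w T > 0)"

definition weight_span :: "(nat \<Rightarrow> real) \<Rightarrow> nat" where
  "weight_span w = Gcd {i. w i > 0}"


section \<open>The canonical offspring distribution and Galton--Watson trees\<close>

definition Phi :: "(nat \<Rightarrow> real) \<Rightarrow> real \<Rightarrow> real" where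
  "Phi w t = (\<Sum>k. w k * t ^ k)"

text \<open>
  The derivative as a power series, so that it makes sense at the end point of the interval of
  convergence as well, provided that the series converges there.
\<close>

definition Phi' :: "(nat \<Rightarrow> real) \<Rightarrow> real \<Rightarrow> real" where
  "Phi' w t = (\<Sum>k. diffs w k * t ^ k)"

definition Psi :: "(nat \<Rightarrow> real) \<Rightarrow> real \<Rightarrow> real" where
  "Psi w t = t * Phi' w t / Phi w t"

text \<open>The filter describes real \<open>t\<close> increasing to the radius of convergence, which may be infinite.\<close>

definition nu :: "(nat \<Rightarrow> real) \<Rightarrow> ereal" where
  "nu w = Lim (filtercomap ereal (at_left (conv_radius w))) (\<lambda>t. ereal (Psi w t))"

definition tau :: "(nat \<Rightarrow> real) \<Rightarrow> real" where
  "tau w =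
     (if nu w \<ge> 1
      then THE t. 0 < t \<and> ereal t \<le> conv_radius w \<and> summable (\<lambda>k. diffs w k * t ^ k) \<and> Psi w t = 1
      else real_of_ereal (conv_radius w))"

definition canonical_offspring :: "(nat \<Rightarrow> real) \<Rightarrow> nat pmf" where
  "canonical_offspring w = embed_pmf (\<lambda>k. w k * tau w ^ k / Phi w (tau w))"

definition sub_or_critical :: "nat pmf \<Rightarrow> bool" where
  "sub_or_critical \<xi> \<longleftrightarrow>
     integrable (measure_pmf \<xi>) real \<and> measure_pmf.expectation \<xi> real \<le> 1"

text \<open>
  Law of an almost surely finite Galton--Watson tree: the number of children of the root follows
  the offspring law \<open>\<xi>\<close> and, given this number, the subtrees at the children are independent
  copies of the whole tree. By structural induction this determines the law uniquely.
\<close>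

definition galton_watson_law :: "nat pmf \<Rightarrow> ptree pmf \<Rightarrow> bool" where
  "galton_watson_law \<xi> G \<longleftrightarrow> G = bind_pmf \<xi> (\<lambda>k. map_pmf Node (replicate_pmf k G))"


section \<open>Probabilistic notions\<close>

text \<open>
  The library's \<^const>\<open>prob_space.indep_var\<close> needs both random variables to take values in the
  same type; this is the same notion for values in different types.
\<close>

definition indep_rvs ::
    "'a measure \<Rightarrow> 'b measure \<Rightarrow> ('a \<Rightarrow> 'b) \<Rightarrow> 'c measure \<Rightarrow> ('a \<Rightarrow> 'c) \<Rightarrow> bool" where
  "indep_rvs N S X S' Y \<longleftrightarrow>
     X \<in> N \<rightarrow>\<^sub>M S \<and> Y \<in> N \<rightarrow>\<^sub>M S' \<and>
     prob_space.indep_set N {X -` A \<inter> space N | A. A \<in> sets S} {Y -` B \<inter> space N | B. B \<in> sets S'}"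

definition tv_dist :: "'s measure \<Rightarrow> 's measure \<Rightarrow> real" where
  "tv_dist P Q = (SUP E\<in>sets P. \<bar>measure P E - measure Q E\<bar>)"

text \<open>\<open>X = O\<^sub>p(1)\<close> along the filter \<open>F\<close>.\<close>

definition stoch_bounded :: "nat filter \<Rightarrow> 'a measure \<Rightarrow> (nat \<Rightarrow> 'a \<Rightarrow> real) \<Rightarrow> bool" where
  "stoch_bounded F N X \<longleftrightarrow>
     (\<forall>\<epsilon>>0. \<exists>B>0. Limsup F (\<lambda>n. ereal (measure N {\<omega>\<in>space N. \<bar>X n \<omega>\<bar> \<ge> B})) \<le> ereal \<epsilon>)"

text \<open>
  Convergence in distribution in a discrete space, where every bounded function is a
  bounded continuous test function.
\<close>

definition conv_in_distr_discrete ::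
    "nat filter \<Rightarrow> 'a measure \<Rightarrow> (nat \<Rightarrow> 'a \<Rightarrow> 's) \<Rightarrow> 's pmf \<Rightarrow> bool" where
  "conv_in_distr_discrete F N X P \<longleftrightarrow>
     (\<forall>f :: 's \<Rightarrow> real. bounded (range f) \<longrightarrow>
        ((\<lambda>n. \<integral>\<omega>. f (X n \<omega>) \<partial>N) \<longlongrightarrow> measure_pmf.expectation P f) F)"

end

theory Submission
  imports Defs
begin

text \<open>
  Why the theorem is true. Cutting an edge of an unrooted plane tree \<open>U\<close> with \<open>n\<close> vertices, with a
  chosen orientation, gives a pair \<open>(T, V)\<close> of planted plane trees with \<open>|T| + |V| = n\<close>, and the weights
  multiply: \<open>uweight U = pweight T * pweight V\<close> (\<open>uweight_join_trees\<close>). An automorphism of \<open>U\<close> fixing a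
  directed edge is trivial (\<open>encoding_unique\<close>), so \<open>U\<close> arises from exactly \<open>2 * (n - 1)\<close> pairs unless it
  has a nontrivial automorphism (\<open>rootings\<close>). Hence joining a pair that is chosen with probability
  proportional to \<open>pweight T * pweight V\<close> gives the law of \<open>unrooted_law\<close> up to the contribution of the
  symmetric trees (\<open>unrooted_join_distance\<close>). A symmetric tree has a vertex around which its branches
  are periodic, or two equal halves (\<open>automorphism_fixes_vertex_or_flips_edge\<close>); at least about half
  of its vertices then lie in copies of other parts of the tree, and each of them costs a factor bounded
  away from 1, so that the symmetric trees have an exponentially small share of the total weight
  (\<open>symmetric_total_negligible\<close>).

  The smaller tree of the pair is the tree \<open>V n\<close> of the theorem, and the larger one is, given the
  size of \<open>V n\<close>, a simply generated planted tree. The law of \<open>V n\<close> gives a tree \<open>V\<close> with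
  \<open>2 * |V| < n\<close> the probability \<open>pweight V * t (n - |V|) / (pair_total n / 2)\<close>, where \<open>t m\<close> is the total
  weight of the planted trees with \<open>m\<close> vertices and \<open>pair_total n\<close> that of the pairs. Everything thus
  follows from the ratio limit \<open>t (n - k) / (pair_total n / 2) \<longlonglongrightarrow> 1\<close> for fixed \<open>k \<equiv> 1\<close> and \<open>n \<equiv> 2\<close>
  modulo the span (\<open>size_ratio_limit\<close>): the probability of \<open>V\<close> tends to the probability \<open>pweight V\<close> that the
  Galton--Watson tree equals \<open>V\<close>, and pointwise convergence of probability mass functions to a
  probability mass function gives convergence of all bounded expectations, including tightness.

  For the ratio limit the weights are first replaced by a probability distribution \<open>p\<close>, the canonical
  offspring law; this does not change the laws of the random trees. The distribution \<open>p\<close> has mean 1, or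
  a smaller mean and no exponential moment (\<open>offspring_tilt\<close>). By the Otter--Dwass formula
  (\<open>planted_fps_power_nth\<close>) both \<open>t n\<close> and \<open>pair_total n\<close> are point probabilities of the random walk with
  step law \<open>p\<close>: \<open>n * t n\<close> is the probability to be at \<open>n - 1\<close> after \<open>n\<close> steps and \<open>n * pair_total n\<close> is
  twice the probability to be at \<open>n - 2\<close>. These probabilities do not decay exponentially
  (\<open>walk_diagonal_lower_bound\<close>), whereas the number of steps of a given size \<open>k\<close> deviates from \<open>n * p k\<close>
  by a positive proportion of \<open>n\<close> with exponentially small probability. So even given the end point,
  about \<open>n * p k\<close> steps have size \<open>k\<close>, and this says that removing one step of size \<open>k\<close> asymptotically
  does not change the point probability (\<open>ratio_limit\<close>). Combining such moves reaches all shifts of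
  the end point by multiples of the span (\<open>shifts_lattice\<close>).
\<close>

section \<open>Total weights of planted plane trees\<close>

lemma psize_Node: "psize (Node ts) = Suc (sum_list (map psize ts))"
proof -
  have "card (\<Union>i<length ts. (#) i ` nodes (ts ! i)) = (\<Sum>i<length ts. card ((#) i ` nodes (ts ! i)))"
    by (rule card_UN_disjoint) (auto simp: finite_nodes)
  also have "\<dots> = (\<Sum>i<length ts. psize (ts ! i))"
    by (simp add: psize_def card_image)
  also have "\<dots> = sum_list (map psize ts)"
    by (simp add: sum_list_sum_nth atLeast0LessThan)
  finally show ?thesis
    unfolding psize_def nodes_Node by (subst card_insert_disjoint) (auto simp: finite_nodes)
qed

lemma pweight_Node: "pweight w (Node ts) = w (length ts) * prod_list (map (pweight w) ts)"
proof -
  have "(\<Prod>p\<in>(\<Union>i<length ts. (#) i ` nodes (ts ! i)). w (outdeg (Node ts) p))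
      = (\<Prod>i<length ts. \<Prod>p\<in>(#) i ` nodes (ts ! i). w (outdeg (Node ts) p))"
    by (rule prod.UNION_disjoint) (auto simp: finite_nodes)
  also have "\<dots> = (\<Prod>i<length ts. pweight w (ts ! i))"
    by (simp add: pweight_def prod.reindex outdeg_def)
  also have "\<dots> = prod_list (map (pweight w) ts)"
    by (simp add: prod.list_conv_set_nth atLeast0LessThan)
  finally show ?thesis
    unfolding pweight_def nodes_Node
    by (subst prod.insert) (auto simp: finite_nodes outdeg_def)
qed

lemma psize_children: "psize t = Suc n \<longleftrightarrow> sum_list (map psize (children t)) = n"
  by (cases t) (simp add: psize_Node)

lemma psize_pos: "psize t > 0"
  by (cases t) (simp add: psize_Node)

lemma psize_neq_0 [simp]: "psize t \<noteq> 0"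
  using psize_pos[of t] by simp

lemma psize_le_sum_list: "t \<in> set ts \<Longrightarrow> psize t \<le> sum_list (map psize ts)"
  by (simp add: member_le_sum_list)

lemma length_le_sum_psize: "length ts \<le> sum_list (map psize ts)"
proof (induction ts)
  case (Cons t ts) then show ?case using psize_pos[of t] by simp
qed simp

lemma finite_psize_le: "finite {t. psize t \<le> n}"
proof (induction n)
  case 0
  show ?case by simp
next
  case (Suc n)
  have "{t. psize t \<le> Suc n} \<subseteq> Node ` {ts. set ts \<subseteq> {t. psize t \<le> n} \<and> length ts \<le> n}"
  proof
    fix t assume t: "t \<in> {t. psize t \<le> Suc n}"
    obtain ts where ts: "t = Node ts" by (cases t)
    with t have "sum_list (map psize ts) \<le> n" by (simp add: psize_Node)
    then show "t \<in> Node ` {ts. set ts \<subseteq> {t. psize t \<le> n} \<and> length ts \<le> n}"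
      using ts psize_le_sum_list[of _ ts] length_le_sum_psize[of ts] by (auto intro: order_trans)
  qed
  then show ?case
    by (rule finite_subset) (intro finite_imageI finite_lists_length_le Suc)
qed

lemma finite_psize_eq: "finite {t. psize t = n}"
  by (rule finite_subset[OF _ finite_psize_le[of n]]) auto

definition forests :: "nat \<Rightarrow> nat \<Rightarrow> ptree list set" where
  "forests k n = {ts. length ts = k \<and> sum_list (map psize ts) = n}"

lemma finite_forests: "finite (forests k n)"
proof (rule finite_subset)
  show "forests k n \<subseteq> {ts. set ts \<subseteq> {t. psize t \<le> n} \<and> length ts = k}"
    using psize_le_sum_list by (auto simp: forests_def)
qed (intro finite_lists_length_eq finite_psize_le)

definition planted_total :: "(nat \<Rightarrow> real) \<Rightarrow> nat \<Rightarrow> real" where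
  "planted_total w n = (\<Sum>t | psize t = n. pweight w t)"

definition planted_fps :: "(nat \<Rightarrow> real) \<Rightarrow> real fps" where
  "planted_fps w = Abs_fps (planted_total w)"

lemma planted_total_0: "planted_total w 0 = 0"
  by (simp add: planted_total_def)

lemma fps_nth_planted_fps: "fps_nth (planted_fps w) n = planted_total w n"
  by (simp add: planted_fps_def)

lemma planted_fps_nth_0: "fps_nth (planted_fps w) 0 = 0"
  by (simp add: fps_nth_planted_fps planted_total_0)

lemma forests_total:
  "(\<Sum>ts\<in>forests k n. prod_list (map (pweight w) ts)) = fps_nth (planted_fps w ^ k) n"
proof (induction k arbitrary: n)
  case 0
  have "forests 0 n = (if n = 0 then {[]} else {})" by (auto simp: forests_def)
  then show ?case by simp
next
  case (Suc k)
  have "bij_betw (\<lambda>(i, t, ts). t # ts)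
          (SIGMA i:{0..n}. {t. psize t = i} \<times> forests k (n - i)) (forests (Suc k) n)"
    by (rule bij_betw_byWitness[where f' = "\<lambda>ts. (psize (hd ts), hd ts, tl ts)"])
       (auto simp: forests_def length_Suc_conv)
  then have "(\<Sum>ts\<in>forests (Suc k) n. prod_list (map (pweight w) ts))
     = (\<Sum>(i, t, ts)\<in>(SIGMA i:{0..n}. {t. psize t = i} \<times> forests k (n - i)).
          pweight w t * prod_list (map (pweight w) ts))"
    by (subst sum.reindex_bij_betw[symmetric, of _ _ _ "\<lambda>ts. prod_list (map (pweight w) ts)"])
       (auto simp: case_prod_unfold)
  also have "\<dots> = (\<Sum>i=0..n. \<Sum>(t, ts)\<in>{t. psize t = i} \<times> forests k (n - i).
          pweight w t * prod_list (map (pweight w) ts))"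
    by (subst sum.Sigma) (auto simp: finite_psize_eq finite_forests case_prod_unfold)
  also have "\<dots> = (\<Sum>i=0..n. planted_total w i * fps_nth (planted_fps w ^ k) (n - i))"
    by (simp add: planted_total_def Suc.IH[symmetric] sum_product sum.cartesian_product)
  finally show ?case by (simp add: fps_mult_nth fps_nth_planted_fps)
qed

lemma planted_fps_power_nth_eq_0:
  "n < k \<Longrightarrow> fps_nth (planted_fps w ^ k) n = 0"
  by (simp add: startsby_zero_power_prefix planted_fps_nth_0)

lemma planted_total_Suc:
  "planted_total w (Suc n) = (\<Sum>k=0..n. w k * fps_nth (planted_fps w ^ k) n)"
proof -
  have "bij_betw (\<lambda>(k, ts). Node ts) (SIGMA k:{0..n}. forests k n) {t. psize t = Suc n}"
    by (rule bij_betw_byWitness[where f' = "\<lambda>t. (length (children t), children t)"])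
       (auto simp: forests_def psize_children length_le_sum_psize psize_Node)
  then have "planted_total w (Suc n)
     = (\<Sum>(k, ts)\<in>(SIGMA k:{0..n}. forests k n). pweight w (Node ts))"
    unfolding planted_total_def
    by (subst sum.reindex_bij_betw[symmetric]) (auto simp: case_prod_unfold)
  also have "\<dots> = (\<Sum>k=0..n. \<Sum>ts\<in>forests k n. pweight w (Node ts))"
    by (subst sum.Sigma) (auto simp: finite_forests)
  also have "\<dots> = (\<Sum>k=0..n. w k * (\<Sum>ts\<in>forests k n. prod_list (map (pweight w) ts)))"
    by (simp add: pweight_Node forests_def sum_distrib_left)
  finally show ?thesis by (simp add: forests_total)
qed

lemma planted_fps_eq: "planted_fps w = fps_X * (Abs_fps w oo planted_fps w)"
proof (rule fps_ext)
  fix n show "fps_nth (planted_fps w) n = fps_nth (fps_X * (Abs_fps w oo planted_fps w)) n"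
    by (cases n) (simp_all add: planted_fps_nth_0 fps_nth_planted_fps planted_total_Suc fps_compose_nth planted_total_0)
qed

text \<open>
  The functional equation of the generating function, multiplied by its \<open>k\<close>-th power: the root of the first
  tree of a forest is removed.
\<close>

lemma planted_fps_power_Suc:
  "fps_nth (planted_fps w ^ Suc k) (Suc n) = (\<Sum>j=0..n. w j * fps_nth (planted_fps w ^ (k + j)) n)"
proof -
  let ?T = "planted_fps w"
  have T: "?T ^ Suc k = fps_X * ((Abs_fps w oo ?T) * ?T ^ k)"
    by (simp only: mult.assoc[symmetric] planted_fps_eq[symmetric] power_Suc)
  have "fps_nth (?T ^ Suc k) (Suc n) = fps_nth ((Abs_fps w oo ?T) * ?T ^ k) n"
    unfolding T by simp
  also have "(Abs_fps w oo ?T) * ?T ^ k = (Abs_fps w * fps_X ^ k) oo ?T"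
    by (simp add: fps_compose_mult_distrib planted_fps_nth_0 fps_compose_power[symmetric])
  also have "fps_nth \<dots> n = (\<Sum>i=0..n. (if i < k then 0 else w (i - k)) * fps_nth (?T ^ i) n)"
    by (auto simp: fps_compose_nth fps_X_power_mult_right_nth intro!: sum.cong)
  also have "\<dots> = (\<Sum>i=k..<k+Suc n. w (i - k) * fps_nth (?T ^ i) n)"
    by (rule sum.mono_neutral_cong) (auto simp: planted_fps_power_nth_eq_0)
  also have "\<dots> = (\<Sum>j=0..<Suc n. w j * fps_nth (?T ^ (k + j)) n)"
    using sum.shift_bounds_nat_ivl[of "\<lambda>i. w (i - k) * fps_nth (?T ^ i) n" 0 k "Suc n"]
    by (simp add: add.commute)
  finally show ?thesis by (simp add: atLeastLessThanSuc_atLeastAtMost)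
qed

text \<open>
  The mean of one of \<open>n\<close> exchangeable steps with sum \<open>m\<close> is \<open>m / n\<close>; as an identity of power series this
  is the product rule for \<open>X * (F ^ n)'\<close>.
\<close>

lemma fps_power_index_nth:
  fixes F :: "real fps"
  shows "real n * (\<Sum>j=0..m. real j * fps_nth F j * fps_nth (F ^ (n - 1)) (m - j))
     = real m * fps_nth (F ^ n) m"
proof -
  have index: "fps_nth (fps_X * fps_deriv G) m = real m * fps_nth G m" for G :: "real fps" and m
    by (cases m) simp_all
  have "fps_X * fps_deriv (F ^ n) = fps_const (real n) * ((fps_X * fps_deriv F) * F ^ (n - 1))"
    by (simp add: fps_deriv_power mult_ac)
  then have "fps_nth (fps_X * fps_deriv (F ^ n)) m
     = real n * fps_nth ((fps_X * fps_deriv F) * F ^ (n - 1)) m"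
    by (simp only: fps_mult_left_const_nth)
  also have "fps_nth ((fps_X * fps_deriv F) * F ^ (n - 1)) m
     = (\<Sum>j=0..m. real j * fps_nth F j * fps_nth (F ^ (n - 1)) (m - j))"
    by (simp only: fps_mult_nth[of "fps_X * fps_deriv F"] index)
  finally show ?thesis by (simp only: index)
qed

text \<open>
  The Otter--Dwass formula. Removing the root of the first tree turns a forest of \<open>k\<close> trees with
  \<open>n + 1\<close> vertices into one of \<open>k - 1 + j\<close> trees with \<open>n\<close> vertices; the right-hand side satisfies the
  same recursion because the first step of a walk from 0 to \<open>m\<close> in \<open>n\<close> steps has mean \<open>m / n\<close>.
\<close>

theorem planted_fps_power_nth:
  assumes "n > 0" "k \<le> n"
  shows "real n * fps_nth (planted_fps w ^ k) n = real k * fps_nth (Abs_fps w ^ n) (n - k)"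
  using assms
proof (induction n arbitrary: k)
  case 0 then show ?case by simp
next
  case (Suc n)
  let ?F = "Abs_fps w"
  show ?case
  proof (cases k)
    case 0 then show ?thesis by simp
  next
    case (Suc l)
    with Suc.prems have l: "l \<le> n" by simp
    show ?thesis
    proof (cases "n = 0")
      case True
      then show ?thesis using l Suc
        by (simp add: fps_nth_planted_fps planted_total_Suc)
    next
      case False
      define s where "s = fps_nth (?F ^ Suc n) (n - l)"
      have conv: "(\<Sum>j=0..n-l. w j * fps_nth (?F ^ n) (n - l - j)) = s"
        by (simp add: s_def fps_mult_nth)
      have ind: "(\<Sum>j=0..n-l. real j * w j * fps_nth (?F ^ n) (n - l - j)) = real (n - l) * s / Suc n"
        using fps_power_index_nth[where n = "Suc n" and m = "n - l" and F = ?F] by (simp add: s_def field_simps)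
      have "real n * fps_nth (planted_fps w ^ k) (Suc n)
          = (\<Sum>j=0..n. w j * (real n * fps_nth (planted_fps w ^ (l + j)) n))"
        using Suc by (simp add: planted_fps_power_Suc sum_distrib_left mult_ac del: power_Suc)
      also have "\<dots> = (\<Sum>j=0..n-l. w j * (real n * fps_nth (planted_fps w ^ (l + j)) n))"
        by (rule sum.mono_neutral_right) (auto simp: planted_fps_power_nth_eq_0)
      also have "\<dots> = (\<Sum>j=0..n-l. w j * (real (l + j) * fps_nth (?F ^ n) (n - l - j)))"
      proof (rule sum.cong)
        fix j assume "j \<in> {0..n-l}"
        then have "l + j \<le> n" using l by auto
        then show "w j * (real n * fps_nth (planted_fps w ^ (l + j)) n)
           = w j * (real (l + j) * fps_nth (?F ^ n) (n - l - j))"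
          using Suc.IH[of "l + j"] False by (simp add: diff_diff_eq)
      qed simp
      also have "\<dots> = real l * (\<Sum>j=0..n-l. w j * fps_nth (?F ^ n) (n - l - j))
          + (\<Sum>j=0..n-l. real j * w j * fps_nth (?F ^ n) (n - l - j))"
        by (simp add: sum_distrib_left sum.distrib[symmetric] algebra_simps)
      also have "\<dots> = real l * s + real (n - l) * s / Suc n" by (simp only: conv ind)
      finally have "real n * fps_nth (planted_fps w ^ k) (Suc n) = real l * s + real (n - l) * s / Suc n" .
      then have "real n * (real (Suc n) * fps_nth (planted_fps w ^ k) (Suc n)) = real n * (real k * s)"
        using l Suc by (simp add: field_simps of_nat_diff)
      with False Suc show ?thesis by (simp add: s_def)
    qed
  qed
qed

section \<open>Critical and heavy-tailed subcritical offspring sequences\<close>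

text \<open>
  These are the offspring laws that the canonical tilt produces. In terms of trees, the last assumption
  means that no exponential tilt brings the mean closer to 1, and it is what rules out an exponential decay
  of the tree size probabilities.
\<close>

locale offspring =
  fixes p :: "nat \<Rightarrow> real"
  assumes nonneg: "p k \<ge> 0"
    and sums_1: "p sums 1"
    and p0: "p 0 > 0"
    and branching: "\<exists>k\<ge>2. p k > 0"
    and mean_summable: "summable (\<lambda>k. real k * p k)"
    and mean_le_1: "(\<Sum>k. real k * p k) \<le> 1"
    and critical_or_heavy: "(\<Sum>k. real k * p k) = 1 \<or> (\<forall>s>1. \<not> summable (\<lambda>k. p k * s ^ k))"

lemma pweight_nonneg:
  assumes "\<And>k. w k \<ge> (0::real)" shows "pweight w t \<ge> 0"
  unfolding pweight_def by (rule prod_nonneg) (use assms in auto)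

lemma planted_total_nonneg:
  assumes "\<And>k. w k \<ge> (0::real)" shows "planted_total w n \<ge> 0"
  unfolding planted_total_def by (rule sum_nonneg) (use pweight_nonneg assms in auto)

lemma fps_power_nonneg:
  fixes F :: "real fps"
  assumes "\<And>k. fps_nth F k \<ge> 0" shows "fps_nth (F ^ n) m \<ge> 0"
proof (induction n arbitrary: m)
  case (Suc n) then show ?case
    by (auto simp: fps_mult_nth intro!: sum_nonneg mult_nonneg_nonneg assms)
qed (simp add: fps_one_nth)

lemma fps_mult_partial_sum_le:
  fixes F G :: "real fps"
  assumes "\<And>k. fps_nth F k \<ge> 0" "\<And>k. fps_nth G k \<ge> 0"
  shows "(\<Sum>m\<le>M. fps_nth (F * G) m) \<le> (\<Sum>m\<le>M. fps_nth F m) * (\<Sum>m\<le>M. fps_nth G m)"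
proof -
  have "(\<Sum>m\<le>M. fps_nth (F * G) m) = (\<Sum>m\<le>M. \<Sum>i\<le>m. fps_nth F i * fps_nth G (m - i))"
    by (simp add: fps_mult_nth atLeast0AtMost)
  also have "\<dots> = (\<Sum>(i, j)\<in>{(i, j). i + j \<le> M}. fps_nth F i * fps_nth G j)"
    by (rule sum.triangle_reindex_eq[symmetric])
  also have "\<dots> \<le> (\<Sum>(i, j)\<in>{..M} \<times> {..M}. fps_nth F i * fps_nth G j)"
    by (rule sum_mono2) (auto intro!: mult_nonneg_nonneg assms)
  also have "\<dots> = (\<Sum>m\<le>M. fps_nth F m) * (\<Sum>m\<le>M. fps_nth G m)"
    by (simp add: sum_product sum.cartesian_product)
  finally show ?thesis .
qed

lemma fps_power_partial_sum_le:
  fixes F :: "real fps"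
  assumes nn: "\<And>k. fps_nth F k \<ge> 0" and le: "(\<Sum>m\<le>M. fps_nth F m) \<le> c"
  shows "(\<Sum>m\<le>M. fps_nth (F ^ n) m) \<le> c ^ n"
proof -
  have c: "c \<ge> 0" using le by (rule order_trans[rotated]) (auto intro!: sum_nonneg nn)
  show ?thesis
  proof (induction n)
    case 0 then show ?case by (simp add: fps_one_nth)
  next
    case (Suc n)
    have "(\<Sum>m\<le>M. fps_nth (F * F ^ n) m) \<le> (\<Sum>m\<le>M. fps_nth F m) * (\<Sum>m\<le>M. fps_nth (F ^ n) m)"
      by (rule fps_mult_partial_sum_le) (auto intro: nn fps_power_nonneg)
    also have "\<dots> \<le> c * c ^ n"
      by (rule mult_mono) (auto intro!: le Suc.IH c sum_nonneg fps_power_nonneg nn)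
    finally show ?case by simp
  qed
qed

lemma fps_power_sums:
  fixes F :: "real fps"
  assumes nn: "\<And>k. fps_nth F k \<ge> 0" and s: "s \<ge> 0" and y: "(\<lambda>n. fps_nth F n * s ^ n) sums y"
  shows "(\<lambda>n. fps_nth (F ^ j) n * s ^ n) sums (y ^ j)"
proof (induction j)
  case 0
  have "(\<lambda>n. fps_nth 1 n * s ^ n) = (\<lambda>n. if n = 0 then 1 else 0)" by (auto simp: fps_one_nth)
  then show ?case using sums_If_finite_set[of "{0}" "\<lambda>_. 1::real"] by (simp add: sums_single[of 0 "\<lambda>_. 1::real", simplified])
next
  case (Suc j)
  let ?a = "\<lambda>n. fps_nth F n * s ^ n" and ?b = "\<lambda>n. fps_nth (F ^ j) n * s ^ n"
  have "(\<lambda>k. \<Sum>i\<le>k. ?a i * ?b (k - i)) sums ((\<Sum>k. ?a k) * (\<Sum>k. ?b k))"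
    by (rule Cauchy_product_sums)
       (use y Suc s in \<open>auto simp: abs_mult nn fps_power_nonneg sums_iff\<close>)
  also have "(\<lambda>k. \<Sum>i\<le>k. ?a i * ?b (k - i)) = (\<lambda>n. fps_nth (F ^ Suc j) n * s ^ n)"
  proof
    fix k
    have "?a i * ?b (k - i) = fps_nth F i * fps_nth (F ^ j) (k - i) * s ^ k" if "i \<le> k" for i
    proof -
      have "s ^ k = s ^ i * s ^ (k - i)" using that by (simp flip: power_add)
      then show ?thesis by simp
    qed
    then have "(\<Sum>i\<le>k. ?a i * ?b (k - i)) = (\<Sum>i\<le>k. fps_nth F i * fps_nth (F ^ j) (k - i) * s ^ k)"
      by (intro sum.cong) auto
    then show "(\<Sum>i\<le>k. ?a i * ?b (k - i)) = fps_nth (F ^ Suc j) k * s ^ k"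
      by (simp add: fps_mult_nth atLeast0AtMost sum_distrib_right)
  qed
  finally show ?case using y Suc by (simp add: sums_iff)
qed

text \<open>
  The strictness comes from the quadratic term \<open>(k - 1) * (y - 1)\<^sup>2\<close> that is lost when the inequality
  for \<open>k - 1\<close> is multiplied by \<open>y\<close>.
\<close>

lemma Bernoulli_strict:
  fixes y :: real
  assumes "y \<ge> 0" "y \<noteq> 1" "k \<ge> 2"
  shows "1 + real k * (y - 1) < y ^ k"
proof -
  obtain j where j: "k = Suc j" "j \<ge> 1" using assms by (cases k) auto
  have b: "1 + real j * (y - 1) \<le> y ^ j" using Bernoulli_inequality[of "y - 1" j] assms by simp
  have "1 + real k * (y - 1) = y * (1 + real j * (y - 1)) - real j * (y - 1)\<^sup>2"
    using j by (simp add: algebra_simps power2_eq_square)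
  also have "\<dots> < y * (1 + real j * (y - 1))" using j assms by simp
  also have "\<dots> \<le> y * y ^ j" using b assms by (intro mult_left_mono) auto
  finally show ?thesis using j by simp
qed

context offspring
begin

text \<open>The probability that the Galton--Watson tree with offspring law \<open>p\<close> has \<open>n\<close> vertices.\<close>

abbreviation t :: "nat \<Rightarrow> real" where "t \<equiv> planted_total p"

text \<open>The probability that the random walk with step law \<open>p\<close>, started at 0, is at \<open>m\<close> after \<open>n\<close> steps.\<close>

definition walk :: "nat \<Rightarrow> nat \<Rightarrow> real" where
  "walk n m = fps_nth (Abs_fps p ^ n) m"

lemma t_nonneg: "t n \<ge> 0" by (rule planted_total_nonneg) (rule nonneg)

lemma walk_nonneg: "walk n m \<ge> 0"
  unfolding walk_def by (rule fps_power_nonneg) (simp add: nonneg)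

lemma walk_1: "walk 1 k = p k" by (simp add: walk_def)

lemma walk_0: "walk n 0 = p 0 ^ n" by (simp add: walk_def fps_nth_power_0)

lemma walk_add: "walk n m * walk n' m' \<le> walk (n + n') (m + m')"
proof -
  have "walk n m * walk n' m' = (\<Sum>i\<in>{m}. walk n i * walk n' (m + m' - i))" by simp
  also have "\<dots> \<le> (\<Sum>i\<in>{0..m+m'}. walk n i * walk n' (m + m' - i))"
    by (rule sum_mono2) (auto intro!: mult_nonneg_nonneg walk_nonneg)
  finally show ?thesis by (simp add: walk_def power_add fps_mult_nth)
qed

lemma walk_mult: "walk n m ^ q \<le> walk (n * q) (m * q)"
proof (induction q)
  case 0 then show ?case by (simp add: walk_def)
next
  case (Suc q)
  have "walk n m ^ Suc q \<le> walk n m * walk (n * q) (m * q)"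
    using Suc by (simp add: mult_left_mono walk_nonneg)
  also have "\<dots> \<le> walk (n * Suc q) (m * Suc q)" using walk_add[of n m "n * q" "m * q"] by simp
  finally show ?case .
qed

lemma t_walk: "n > 0 \<Longrightarrow> real n * t n = walk n (n - 1)"
  using planted_fps_power_nth[of n 1 p] by (simp add: walk_def fps_nth_planted_fps)

lemma p_partial_sum_le: "finite A \<Longrightarrow> sum p A \<le> 1"
  using sum_le_suminf[of p A] sums_1 nonneg by (auto simp: sums_iff)

text \<open>
  By induction on the bound for the size: the subtrees at the children of the root are smaller, and
  truncating the sizes in a forest is at least as generous as truncating its total size.
\<close>

lemma t_partial_sum_le: "(\<Sum>n\<le>N. t n) \<le> 1"
proof (induction N)
  case 0 then show ?case by (simp add: planted_total_0)
next
  case (Suc N)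
  have "(\<Sum>n\<le>Suc N. t n) = (\<Sum>n\<le>N. t (Suc n))"
    by (simp only: sum.atMost_Suc_shift planted_total_0 add_0)
  also have "\<dots> = (\<Sum>n\<le>N. \<Sum>k\<le>N. p k * fps_nth (planted_fps p ^ k) n)"
    unfolding planted_total_Suc
    by (intro sum.cong refl sum.mono_neutral_left) (auto simp: planted_fps_power_nth_eq_0)
  also have "\<dots> = (\<Sum>k\<le>N. p k * (\<Sum>n\<le>N. fps_nth (planted_fps p ^ k) n))"
    by (subst sum.swap) (simp add: sum_distrib_left)
  also have "\<dots> \<le> (\<Sum>k\<le>N. p k * 1 ^ k)"
    by (intro sum_mono mult_left_mono nonneg fps_power_partial_sum_le)
       (use Suc t_nonneg in \<open>auto simp: fps_nth_planted_fps\<close>)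
  also have "\<dots> \<le> 1" using p_partial_sum_le by simp
  finally show ?case .
qed

lemma t_summable: "summable t"
  by (rule bounded_imp_summable[OF t_nonneg t_partial_sum_le])

text \<open>
  One half of the functional equation \<open>y = s * \<Phi>(y)\<close> of the generating function of the tree sizes, with
  \<open>\<Phi>\<close> truncated: trees whose root has at most \<open>J\<close> children contribute at most \<open>y\<close>. In this form it makes
  sense at every point where the generating function converges.
\<close>

lemma generating_function_le:
  assumes s: "s \<ge> 0" and y: "(\<lambda>n. t n * s ^ n) sums y"
  shows "s * (\<Sum>j\<le>J. p j * y ^ j) \<le> y"
proof -
  have "(\<lambda>n. fps_nth (planted_fps p ^ j) n * s ^ n) sums (y ^ j)" for j
    by (rule fps_power_sums) (use t_nonneg s y in \<open>auto simp: fps_nth_planted_fps\<close>)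
  then have "(\<lambda>n. s * (\<Sum>j\<le>J. p j * (fps_nth (planted_fps p ^ j) n * s ^ n))) sums (s * (\<Sum>j\<le>J. p j * y ^ j))"
    by (intro sums_mult sums_sum)
  moreover have "(\<lambda>n. t (Suc n) * s ^ Suc n) sums y"
    using y sums_Suc_iff[of "\<lambda>n. t n * s ^ n" y] by (simp add: planted_total_0)
  moreover have "s * (\<Sum>j\<le>J. p j * (fps_nth (planted_fps p ^ j) n * s ^ n)) \<le> t (Suc n) * s ^ Suc n" for n
  proof -
    have "(\<Sum>j\<le>J. p j * fps_nth (planted_fps p ^ j) n) \<le> (\<Sum>j\<le>max J n. p j * fps_nth (planted_fps p ^ j) n)"
      by (rule sum_mono2)
         (auto intro!: mult_nonneg_nonneg nonneg fps_power_nonneg simp: fps_nth_planted_fps t_nonneg)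
    also have "\<dots> = (\<Sum>j=0..n. p j * fps_nth (planted_fps p ^ j) n)"
      by (rule sum.mono_neutral_right) (auto simp: planted_fps_power_nth_eq_0)
    finally have "(\<Sum>j\<le>J. p j * fps_nth (planted_fps p ^ j) n) \<le> t (Suc n)"
      by (simp add: planted_total_Suc)
    then have "(\<Sum>j\<le>J. p j * fps_nth (planted_fps p ^ j) n) * s ^ Suc n \<le> t (Suc n) * s ^ Suc n"
      by (rule mult_right_mono) (use s in simp)
    then show ?thesis by (simp add: sum_distrib_left sum_distrib_right mult_ac)
  qed
  ultimately show ?thesis by (rule sums_le[rotated])
qed

text \<open>
  The probability generating function lies strictly above its tangent at 1, whose slope is the mean. For
  \<open>y < 1\<close> a mean of at most 1 suffices to stay above the diagonal, for \<open>y > 1\<close> the mean has to be 1.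
\<close>

lemma pgf_gt:
  assumes y: "y \<ge> 0" "y \<noteq> 1" "y < 1 \<or> (\<Sum>k. real k * p k) = 1" and s: "summable (\<lambda>j. p j * y ^ j)"
  shows "(\<Sum>j. p j * y ^ j) > y"
proof -
  let ?\<mu> = "\<Sum>k. real k * p k"
  have lin: "(\<lambda>j. p j * (1 + real j * (y - 1))) sums (1 + ?\<mu> * (y - 1))"
  proof -
    have "(\<lambda>j. p j + (real j * p j) * (y - 1)) sums (1 + ?\<mu> * (y - 1))"
      by (intro sums_add sums_mult2 sums_1 summable_sums mean_summable)
    then show ?thesis by (simp add: algebra_simps)
  qed
  obtain k where k: "k \<ge> 2" "p k > 0" using branching by auto
  have "(\<lambda>j. p j * y ^ j - p j * (1 + real j * (y - 1))) sums ((\<Sum>j. p j * y ^ j) - (1 + ?\<mu> * (y - 1)))"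
    by (intro sums_diff lin summable_sums s)
  moreover have "0 < (\<Sum>j. p j * y ^ j - p j * (1 + real j * (y - 1)))"
  proof (rule suminf_pos2[where i = k])
    show "summable (\<lambda>j. p j * y ^ j - p j * (1 + real j * (y - 1)))"
      using calculation by (simp add: sums_iff)
    show "0 \<le> p j * y ^ j - p j * (1 + real j * (y - 1))" for j
      using mult_left_mono[OF Bernoulli_inequality[of "y - 1" j] nonneg[of j]] y by simp
    show "0 < p k * y ^ k - p k * (1 + real k * (y - 1))"
      using Bernoulli_strict[of y k] y k by simp
  qed
  ultimately have "(\<Sum>j. p j * y ^ j) > 1 + ?\<mu> * (y - 1)" by (simp add: sums_iff)
  moreover have "1 + ?\<mu> * (y - 1) \<ge> y"
  proof (cases "?\<mu> = 1")
    case False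
    then have "(1 - ?\<mu>) * (1 - y) \<ge> 0" using y mean_le_1 by (intro mult_nonneg_nonneg) auto
    then show ?thesis by (simp add: algebra_simps)
  qed simp
  ultimately show ?thesis by linarith
qed

lemma generating_function_pgf:
  assumes s: "s \<ge> 1" and y: "(\<lambda>n. t n * s ^ n) sums y"
  shows "y > 0" "summable (\<lambda>j. p j * y ^ j)" "s * (\<Sum>j. p j * y ^ j) \<le> y"
proof -
  have "t 1 = p 0" using t_walk[of 1] by (simp add: walk_0)
  then have "0 < (\<Sum>n. t n * s ^ n)"
    by (intro suminf_pos2[where i = 1]) (use y s p0 t_nonneg in \<open>auto simp: sums_iff\<close>)
  then show y0: "y > 0" using y by (simp add: sums_iff)
  have le: "s * (\<Sum>j\<le>J. p j * y ^ j) \<le> y" for J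
    by (rule generating_function_le[OF _ y]) (use s in simp)
  have b: "(\<Sum>j\<le>J. p j * y ^ j) \<le> y / s" for J
    using le[of J] s by (simp add: field_simps)
  show sm: "summable (\<lambda>j. p j * y ^ j)"
    by (rule bounded_imp_summable[OF _ b]) (use y0 nonneg in auto)
  have "(\<Sum>j. p j * y ^ j) \<le> y / s"
  proof (rule suminf_le_const[OF sm])
    fix n show "(\<Sum>j<n. p j * y ^ j) \<le> y / s"
      by (rule order_trans[OF _ b[of n]], rule sum_mono2) (use y0 nonneg in auto)
  qed
  then show "s * (\<Sum>j. p j * y ^ j) \<le> y" using s by (simp add: field_simps)
qed

text \<open>
  A Galton--Watson tree with mean at most 1 is almost surely finite: the probability \<open>y\<close> of being finite
  satisfies \<open>\<Phi>(y) \<le> y \<le> 1\<close>, which excludes \<open>y < 1\<close>.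
\<close>

theorem t_sums_1: "t sums 1"
proof -
  define y where "y = suminf t"
  have y: "(\<lambda>n. t n * 1 ^ n) sums y" using t_summable by (simp add: y_def summable_sums)
  note g = generating_function_pgf[OF order_refl y]
  have "y \<le> 1" unfolding y_def
  proof (rule suminf_le_const[OF t_summable])
    fix n show "sum t {..<n} \<le> 1"
      by (rule order_trans[OF _ t_partial_sum_le[of n]], rule sum_mono2) (use t_nonneg in auto)
  qed
  moreover have "\<not> y < 1" using pgf_gt[of y] g by auto
  ultimately show ?thesis using y by simp
qed

text \<open>
  The generating function of the sizes has radius of convergence 1. A finite value \<open>y\<close> at some \<open>s > 1\<close> would
  satisfy \<open>\<Phi>(y) \<le> y / s < y\<close>. But \<open>\<Phi>(y) \<ge> y\<close> for \<open>y \<le> 1\<close>, and beyond 1 this either remains true, if the mean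
  is 1, or \<open>\<Phi>\<close> is infinite.
\<close>

theorem not_summable_t:
  assumes s: "s > 1" shows "\<not> summable (\<lambda>n. t n * s ^ n)"
proof
  assume "summable (\<lambda>n. t n * s ^ n)"
  then obtain y where y: "(\<lambda>n. t n * s ^ n) sums y" by (auto simp: summable_def)
  note g = generating_function_pgf[OF _ y]
  have "(\<Sum>j. p j * y ^ j) \<le> y / s" using g s by (simp add: field_simps)
  also have "\<dots> < y" using g s by (simp add: field_simps)
  finally have less: "(\<Sum>j. p j * y ^ j) < y" .
  consider "y < 1" | "y = 1" | "y > 1" by linarith
  then show False
  proof cases
    case 1 then show False using pgf_gt[of y] g s less by auto
  next
    case 2 then show False using less sums_1 by (simp add: sums_iff)
  next
    case 3
    with critical_or_heavy g s have "(\<Sum>k. real k * p k) = 1" by auto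
    then show False using pgf_gt[of y] g s less 3 by auto
  qed
qed

end

section \<open>Exponential lower bounds for the walk\<close>

text \<open>
  A subgroup of the integers is generated by its least positive element, which here divides all
  elements of \<open>A\<close> and hence their greatest common divisor.
\<close>

lemma Gcd_in_additive_subgroup:
  fixes G :: "int set"
  assumes diff: "\<And>x y. x \<in> G \<Longrightarrow> y \<in> G \<Longrightarrow> x - y \<in> G" and A: "int ` A \<subseteq> G" and a: "\<exists>a\<in>A. a \<noteq> 0"
  shows "int (Gcd A) \<in> G"
proof -
  from a A obtain a where a: "int a \<in> G" "a \<noteq> 0" by auto
  have zero: "0 \<in> G" using diff[OF a(1) a(1)] by simp
  have add: "x + y \<in> G" if "x \<in> G" "y \<in> G" for x y
    using diff[OF that(1) diff[OF zero that(2)]] by simp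
  have mult: "int n * x \<in> G" if "x \<in> G" for n x
    by (induction n) (auto simp: zero algebra_simps intro: add that)
  define g where "g = (LEAST n. n > 0 \<and> int n \<in> G)"
  have g: "g > 0 \<and> int g \<in> G"
    unfolding g_def by (rule LeastI[of _ a]) (use a in auto)
  have least: "g \<le> n" if "n > 0" "int n \<in> G" for n
    unfolding g_def by (rule Least_le) (use that in auto)
  have "g dvd k" if "k \<in> A" for k
  proof (rule ccontr)
    assume "\<not> g dvd k"
    then have pos: "k mod g > 0" by (simp add: mod_greater_zero_iff_not_dvd)
    have "int k = int (k div g) * int g + int (k mod g)"
      by (metis div_mult_mod_eq of_nat_add of_nat_mult)
    then have "int (k mod g) = int k - int (k div g) * int g" by simp
    also have "\<dots> \<in> G" using that A g by (intro diff mult) auto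
    finally have "g \<le> k mod g" using least pos by blast
    then show False using g mod_less_divisor[of g k] by linarith
  qed
  then have "g dvd Gcd A" by (rule Gcd_greatest)
  then obtain m where "Gcd A = m * g" by (metis dvd_def mult.commute)
  then show ?thesis using mult g by simp
qed

text \<open>
  The greatest common divisor is a difference \<open>x - y\<close> of two elements of the semigroup. With \<open>y = Gcd A * b\<close>
  and \<open>i = q * b + r\<close> one has \<open>Gcd A * i = (q - r) * y + r * x\<close>, which lies in the semigroup as soon as
  \<open>r \<le> q\<close>.
\<close>

lemma Gcd_multiples_in_semigroup:
  fixes S :: "nat set"
  assumes add: "\<And>x y. x \<in> S \<Longrightarrow> y \<in> S \<Longrightarrow> x + y \<in> S" and zero: "0 \<in> S"
    and A: "A \<subseteq> S" and a: "\<exists>a\<in>A. a \<noteq> 0" and dvd: "\<And>x. x \<in> S \<Longrightarrow> Gcd A dvd x"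
  shows "\<exists>h. \<forall>i\<ge>h. Gcd A * i \<in> S"
proof -
  let ?d = "Gcd A"
  have mult: "n * x \<in> S" if "x \<in> S" for n x
    by (induction n) (auto simp: zero intro: add that)
  define G where "G = {x. \<exists>a\<in>S. \<exists>b\<in>S. x = int a - int b}"
  have "int ?d \<in> G"
  proof (rule Gcd_in_additive_subgroup[OF _ _ a])
    show "int ` A \<subseteq> G" using A zero by (force simp: G_def)
    fix x y assume "x \<in> G" "y \<in> G"
    then obtain a b c e where "a \<in> S" "b \<in> S" "c \<in> S" "e \<in> S" "x = int a - int b" "y = int c - int e"
      by (auto simp: G_def)
    then have "a + e \<in> S" "b + c \<in> S" "x - y = int (a + e) - int (b + c)" using add by auto
    then show "x - y \<in> G" unfolding G_def by blast
  qed
  then obtain x y where xy: "x \<in> S" "y \<in> S" "int ?d = int x - int y" by (auto simp: G_def)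
  then have x: "x = y + ?d" by linarith
  obtain b where b: "y = ?d * b" using dvd[OF xy(2)] by (auto simp: dvd_def)
  have "?d * i \<in> S" if "i \<ge> b * b" for i
  proof (cases "b = 0")
    case True
    then show ?thesis using x b mult[OF xy(1), of i] by (simp add: mult.commute)
  next
    case False
    let ?q = "i div b" and ?r = "i mod b"
    have "b \<le> ?q" using that False by (simp add: less_eq_div_iff_mult_less_eq)
    then have rq: "?r \<le> ?q" using mod_less_divisor[of b i] False by linarith
    have "(?q - ?r) * y + ?r * x \<in> S" by (intro add mult xy)
    also have "(?q - ?r) * y + ?r * x = (?q - ?r + ?r) * y + ?r * ?d"
      by (simp only: x algebra_simps)
    also have "\<dots> = ?q * y + ?r * ?d" using rq by simp
    also have "\<dots> = ?d * (?q * b + ?r)"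
      by (simp only: b distrib_left mult.commute mult.left_commute)
    also have "?q * b + ?r = i" by simp
    finally show ?thesis .
  qed
  then show ?thesis by blast
qed

context offspring
begin

abbreviation d :: nat where "d \<equiv> weight_span p"

lemma weight_span_pos: "d > 0"
proof -
  obtain k where "k \<ge> 2" "p k > 0" using branching by auto
  then have "\<not> {i. p i > 0} \<subseteq> {0}" by auto
  then show ?thesis unfolding weight_span_def by (simp add: Gcd_0_iff zero_less_iff_neq_zero)
qed

lemma weight_span_dvd: "p k > 0 \<Longrightarrow> d dvd k"
  unfolding weight_span_def by (rule Gcd_dvd) simp

lemma walk_pos_dvd: "walk n m > 0 \<Longrightarrow> d dvd m"
proof (induction n arbitrary: m)
  case 0 then show ?case by (auto simp: walk_def fps_one_nth split: if_splits)
next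
  case (Suc n)
  then have "(\<Sum>i=0..m. p i * walk n (m - i)) \<noteq> 0" by (simp add: walk_def fps_mult_nth)
  then obtain i where i: "i \<le> m" "p i * walk n (m - i) \<noteq> 0"
    by (meson atLeastAtMost_iff sum.neutral)
  then have "p i > 0" "walk n (m - i) > 0" using nonneg[of i] walk_nonneg[of n "m - i"] by auto
  then have "d dvd i" "d dvd m - i" using weight_span_dvd Suc.IH by auto
  then show ?case using i(1) by (metis dvd_add le_add_diff_inverse)
qed

lemma walk_diagonal_pos: "\<exists>h. \<forall>i\<ge>h. walk (d * i) (d * i) > 0"
proof -
  have "\<exists>h. \<forall>i\<ge>h. Gcd {i. p i > 0} * i \<in> {h. walk h h > 0}"
  proof (rule Gcd_multiples_in_semigroup)
    fix x y assume "x \<in> {h. walk h h > 0}" "y \<in> {h. walk h h > 0}"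
    then have "0 < walk x x * walk y y" by simp
    also have "\<dots> \<le> walk (x + y) (x + y)" by (rule walk_add)
    finally show "x + y \<in> {h. walk h h > 0}" by simp
  next
    show "0 \<in> {h. walk h h > 0}" by (simp add: walk_0)
  next
    show "{i. p i > 0} \<subseteq> {h. walk h h > 0}"
    proof
      fix k assume "k \<in> {i. p i > 0}"
      then have k: "p k > 0" by simp
      show "k \<in> {h. walk h h > 0}"
      proof (cases k)
        case (Suc j)
        have "0 < walk 1 k * walk j 0" using k p0 by (simp add: walk_1 walk_0 del: One_nat_def)
        also have "\<dots> \<le> walk k k" using walk_add[of 1 k j 0] Suc by simp
        finally show ?thesis by simp
      qed (simp add: walk_0)
    qed
  next
    show "\<exists>a\<in>{i. p i > 0}. a \<noteq> 0" using branching by force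
  next
    fix x assume "x \<in> {h. walk h h > 0}"
    then show "Gcd {i. p i > 0} dvd x" using walk_pos_dvd[of x x] by (simp add: weight_span_def)
  qed
  then show ?thesis by (simp add: weight_span_def)
qed

text \<open>
  If \<open>walk N N\<close> decayed exponentially, then so would \<open>t n\<close>, because the diagonal can be reached from
  \<open>(n, n - 1)\<close> at the cost of a constant factor; this contradicts the radius of convergence of the generating
  function of \<open>t\<close>.
\<close>

lemma walk_diagonal_large:
  assumes c: "c > 0" shows "\<exists>N>0. walk N N \<ge> exp (- c * real N)"
proof (rule ccontr)
  assume none: "\<not> (\<exists>N>0. walk N N \<ge> exp (- c * real N))"
  have small: "walk N N \<le> exp (- c * real N)" if "N > 0" for N
    using none that by (meson linear)
  obtain k where k: "k \<ge> 2" "p k > 0" using branching by auto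
  \<comment> \<open>One step of size \<open>k\<close> and \<open>k - 2\<close> steps of size 0 lead from \<open>(n, n - 1)\<close> to the diagonal.\<close>
  define \<kappa> where "\<kappa> = p k * p 0 ^ (k - 2)"
  have \<kappa>: "\<kappa> > 0" using k p0 by (simp add: \<kappa>_def)
  have t_le: "t n \<le> exp (- c * real n) / \<kappa>" for n
  proof (cases "n = 0")
    case True then show ?thesis using \<kappa> by (simp add: planted_total_0)
  next
    case False
    have "t n \<le> real n * t n" using False t_nonneg[of n] mult_right_mono[of 1 "real n" "t n"] by simp
    then have "t n * \<kappa> \<le> walk n (n - 1) * \<kappa>"
      using False \<kappa> t_walk[of n] by simp
    also have "\<dots> = walk n (n - 1) * walk 1 k * walk (k - 2) 0" by (simp only: \<kappa>_def walk_1 walk_0 mult.assoc)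
    also have "\<dots> \<le> walk (n + 1) (n - 1 + k) * walk (k - 2) 0"
      by (intro mult_right_mono walk_add walk_nonneg)
    also have "\<dots> \<le> walk (n + 1 + (k - 2)) (n - 1 + k + 0)" by (rule walk_add)
    also have "\<dots> = walk (n - 1 + k) (n - 1 + k)" using k False
      by (intro arg_cong2[of _ _ _ _ walk]) simp_all
    also have "\<dots> \<le> exp (- c * real (n - 1 + k))" using False k by (intro small) auto
    also have "\<dots> \<le> exp (- c * real n)" using k c by simp
    finally show ?thesis using \<kappa> by (simp add: field_simps)
  qed
  have "summable (\<lambda>n. t n * exp (c / 2) ^ n)"
  proof (rule summable_comparison_test')
    show "summable (\<lambda>n. exp (- c / 2) ^ n / \<kappa>)"
      by (intro summable_divide summable_geometric) (use c in simp)
    fix n :: nat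
    have "norm (t n * exp (c / 2) ^ n) = t n * exp (c / 2) ^ n" using t_nonneg[of n] by simp
    also have "\<dots> \<le> exp (- c * real n) / \<kappa> * exp (c / 2) ^ n" by (intro mult_right_mono t_le) simp
    also have "\<dots> = exp (- c / 2) ^ n / \<kappa>"
      by (simp add: exp_of_nat_mult[symmetric] exp_add[symmetric] field_simps)
    finally show "norm (t n * exp (c / 2) ^ n) \<le> exp (- c / 2) ^ n / \<kappa>" .
  qed
  then show False using not_summable_t[of "exp (c / 2)"] c by simp
qed

text \<open>
  Fekete's argument: the diagonal probabilities are supermultiplicative, and one value \<open>N\<close> with
  \<open>walk N N \<ge> exp (- c / 2 * N)\<close> gives a bound along \<open>N, 2 * N, 3 * N, \<dots>\<close>. The remaining residues are
  covered by finitely many fixed positive values \<open>walk (d * r) (d * r)\<close>.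
\<close>

theorem walk_diagonal_lower_bound:
  assumes c: "c > 0"
  shows "eventually (\<lambda>i. walk (d * i) (d * i) \<ge> exp (- c * real (d * i))) sequentially"
proof -
  obtain N where N: "N > 0" "walk N N \<ge> exp (- (c / 2) * real N)" using walk_diagonal_large[of "c / 2"] c by auto
  have "walk N N > 0" using N(2) by (rule less_le_trans[rotated]) simp
  then obtain b where b: "N = d * b" using walk_pos_dvd by (auto simp: dvd_def)
  with N have b0: "b > 0" by simp
  obtain h where h: "\<And>i. i \<ge> h \<Longrightarrow> walk (d * i) (d * i) > 0" using walk_diagonal_pos by auto
  define \<kappa> where "\<kappa> = Min ((\<lambda>r. walk (d * r) (d * r)) ` {h..<h + b})"
  have \<kappa>: "\<kappa> > 0" unfolding \<kappa>_def using b0 h by (subst Min_gr_iff) auto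
  have \<kappa>_le: "\<kappa> \<le> walk (d * r) (d * r)" if "r \<in> {h..<h + b}" for r
    unfolding \<kappa>_def using that by (intro Min_le) auto
  have bound: "exp (- (c / 2) * real (d * i)) * \<kappa> \<le> walk (d * i) (d * i)" if "i \<ge> h" for i
  proof -
    \<comment> \<open>The remainder is shifted into \<open>{h..<h + b}\<close>, where the diagonal probabilities are positive.\<close>
    let ?q = "(i - h) div b" and ?r = "h + (i - h) mod b"
    have i: "i = b * ?q + ?r" using that by simp
    have "exp (- (c / 2) * real (d * i)) \<le> exp (- (c / 2) * real (N * ?q))"
    proof -
      have "b * ?q \<le> i - h" by (rule times_div_less_eq_dividend)
      then have "b * ?q \<le> i" by linarith
      then have "N * ?q \<le> d * i" unfolding b mult.assoc by (rule mult_le_mono2)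
      then have "real (N * ?q) \<le> real (d * i)" by (simp only: of_nat_le_iff)
      then show ?thesis using c by simp
    qed
    also have "\<dots> = exp (- (c / 2) * real N) ^ ?q" by (simp add: exp_of_nat_mult[symmetric] algebra_simps)
    also have "\<dots> \<le> walk N N ^ ?q" by (rule power_mono) (use N in auto)
    also have "\<dots> \<le> walk (N * ?q) (N * ?q)" by (rule walk_mult)
    finally have "exp (- (c / 2) * real (d * i)) * \<kappa> \<le> walk (N * ?q) (N * ?q) * walk (d * ?r) (d * ?r)"
      by (rule mult_mono) (use b0 \<kappa> \<kappa>_le[of ?r] in \<open>auto simp: walk_nonneg\<close>)
    also have "\<dots> \<le> walk (N * ?q + d * ?r) (N * ?q + d * ?r)" by (rule walk_add)
    also have "N * ?q + d * ?r = d * (b * ?q + ?r)" by (simp only: b distrib_left mult.assoc)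
    also have "\<dots> = d * i" by (simp only: i[symmetric])
    finally show ?thesis .
  qed
  have "filterlim (\<lambda>i. (c / 2 * real d) * real i) at_top sequentially"
    using c weight_span_pos by (intro filterlim_tendsto_pos_mult_at_top[OF tendsto_const] filterlim_real_sequentially) auto
  then have "eventually (\<lambda>i. (c / 2 * real d) * real i \<ge> - ln \<kappa>) sequentially"
    unfolding filterlim_at_top by blast
  then show ?thesis using eventually_ge_at_top[of h]
  proof eventually_elim
    case (elim i)
    then have "- (c / 2) * real (d * i) \<le> ln \<kappa>" by (simp add: mult_ac)
    then have "exp (- (c / 2) * real (d * i)) \<le> \<kappa>"
      using \<kappa> by (metis exp_le_cancel_iff exp_ln)
    then have "exp (- (c / 2) * real (d * i)) * exp (- (c / 2) * real (d * i))
        \<le> exp (- (c / 2) * real (d * i)) * \<kappa>" by (intro mult_left_mono) auto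
    also have "\<dots> \<le> walk (d * i) (d * i)" by (rule bound) (fact elim)
    finally show ?case by (simp add: exp_add[symmetric] mult_ac)
  qed
qed

end

section \<open>Ratio limits\<close>

text \<open>For \<open>b = 1 - a\<close> this is the mean \<open>n * a\<close> of the binomial distribution.\<close>

lemma binomial_ring_mean:
  fixes a b :: "'a :: comm_ring_1"
  shows "(\<Sum>j\<le>n. of_nat j * (of_nat (n choose j) * a ^ j * b ^ (n - j))) = of_nat n * (a * (a + b) ^ (n - 1))"
proof (cases n)
  case (Suc m)
  have "(\<Sum>j\<le>n. of_nat j * (of_nat (n choose j) * a ^ j * b ^ (n - j)))
     = (\<Sum>j\<le>m. of_nat (Suc j) * (of_nat (Suc m choose Suc j) * a ^ Suc j * b ^ (m - j)))"
    unfolding Suc by (subst sum.atMost_Suc_shift) simp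
  also have "\<dots> = (\<Sum>j\<le>m. of_nat n * (a * (of_nat (m choose j) * a ^ j * b ^ (m - j))))"
  proof (rule sum.cong)
    fix j
    have "of_nat (Suc j) * of_nat (Suc m choose Suc j) = (of_nat n * of_nat (m choose j) :: 'a)"
      unfolding Suc of_nat_mult[symmetric] Suc_times_binomial ..
    then have "of_nat (Suc j) * of_nat (Suc m choose Suc j) * (a ^ Suc j * b ^ (m - j))
        = of_nat n * of_nat (m choose j) * (a ^ Suc j * b ^ (m - j))" by (simp only:)
    then show "of_nat (Suc j) * (of_nat (Suc m choose Suc j) * a ^ Suc j * b ^ (m - j))
        = of_nat n * (a * (of_nat (m choose j) * a ^ j * b ^ (m - j)))"
      by (simp only: power_Suc ac_simps)
  qed simp
  finally show ?thesis by (simp add: Suc binomial_ring sum_distrib_left)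
qed simp

context offspring
begin

text \<open>
  The number of steps equal to \<open>k\<close> among the \<open>n\<close> steps of the walk is concentrated around
  \<open>n * p k\<close> with exponentially small deviation probability; conditioning on the end point costs
  at most a factor \<open>1 / walk n m\<close>. The conditional mean of this number is
  \<open>n * p k * walk (n - 1) (m - k) / walk n m\<close>.
\<close>

lemma walk_step_concentration:
  assumes k: "p k > 0" and n: "n > 0" and e: "e > 0"
  shows "\<bar>real n * (p k * fps_nth (fps_X ^ k * Abs_fps p ^ (n - 1)) m) - real n * p k * walk n m\<bar>
     \<le> e * real n * walk n m + 2 * real n * exp (- 2 * real n * e\<^sup>2)"
proof -
  define q where "q = p k"
  have q: "0 < q" "q \<le> 1" using k p_partial_sum_le[of "{k}"] by (auto simp: q_def)
  define a :: "real fps" where "a = fps_const q * fps_X ^ k"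
  define b where "b = Abs_fps (\<lambda>i. if i = k then 0 else p i)"
  have a_nth: "fps_nth a i = (if i = k then q else 0)" for i by (simp add: a_def)
  have b_nth: "fps_nth b i = (if i = k then 0 else p i)" for i by (simp add: b_def)
  have ab: "a + b = Abs_fps p" by (rule fps_ext) (simp add: a_nth b_nth q_def)
  \<comment> \<open>\<open>B j\<close> is the probability to be at \<open>m\<close> after \<open>n\<close> steps of which exactly \<open>j\<close> are equal to \<open>k\<close>.\<close>
  define B where "B = (\<lambda>j. fps_nth (of_nat (n choose j) * a ^ j * b ^ (n - j)) m)"
  have B_eq: "B j = real (n choose j) * fps_nth (a ^ j * b ^ (n - j)) m" for j
    by (simp add: B_def fps_of_nat[symmetric] mult.assoc)
  have walk: "walk n m = (\<Sum>j\<le>n. B j)"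
    by (simp add: walk_def ab[symmetric] binomial_ring B_def fps_sum_nth)
  have mean: "real n * (q * fps_nth (fps_X ^ k * Abs_fps p ^ (n - 1)) m) = (\<Sum>j\<le>n. real j * B j)"
  proof -
    have "(\<Sum>j\<le>n. real j * B j) = fps_nth (\<Sum>j\<le>n. of_nat j * (of_nat (n choose j) * a ^ j * b ^ (n - j))) m"
      by (simp add: B_def fps_sum_nth fps_of_nat[symmetric] mult.assoc)
    also have "\<dots> = fps_nth (of_nat n * (a * Abs_fps p ^ (n - 1))) m"
      by (simp only: binomial_ring_mean ab)
    finally show ?thesis by (simp add: a_def fps_of_nat[symmetric] mult.assoc)
  qed
  have B_nonneg: "B j \<ge> 0" for j
    unfolding B_eq
    by (auto simp: fps_mult_nth a_nth b_nth nonneg q intro!: mult_nonneg_nonneg sum_nonneg fps_power_nonneg less_imp_le[OF q(1)])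
  have B_le: "B j \<le> pmf (binomial_pmf n q) j" for j
  proof -
    have "fps_nth (a ^ j * b ^ (n - j)) m \<le> (\<Sum>i\<le>m. fps_nth (a ^ j * b ^ (n - j)) i)"
      by (rule member_le_sum)
         (auto simp: fps_mult_nth a_nth b_nth nonneg intro!: mult_nonneg_nonneg sum_nonneg fps_power_nonneg less_imp_le[OF q(1)])
    also have "\<dots> \<le> (\<Sum>i\<le>m. fps_nth (a ^ j) i) * (\<Sum>i\<le>m. fps_nth (b ^ (n - j)) i)"
      by (rule fps_mult_partial_sum_le) (auto intro!: fps_power_nonneg simp: a_nth b_nth nonneg less_imp_le[OF q(1)])
    also have "\<dots> \<le> q ^ j * (1 - q) ^ (n - j)"
    proof (intro mult_mono fps_power_partial_sum_le sum_nonneg fps_power_nonneg)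
      show "(\<Sum>i\<le>m. fps_nth a i) \<le> q" using q by (simp add: a_nth)
      have "p k + sum p ({..m} - {k}) = sum p (insert k {..m})" by (simp add: sum.insert_remove)
      then have "sum p ({..m} - {k}) \<le> 1 - q" using p_partial_sum_le[of "insert k {..m}"] by (simp add: q_def)
      moreover have "(\<Sum>i\<le>m. fps_nth b i) = sum p ({..m} - {k})"
        by (rule sum.mono_neutral_cong_right) (auto simp: b_nth split: if_splits)
      ultimately show "(\<Sum>i\<le>m. fps_nth b i) \<le> 1 - q" by simp
    qed (use q in \<open>auto simp: a_nth b_nth nonneg\<close>)
    finally have "B j \<le> real (n choose j) * (q ^ j * (1 - q) ^ (n - j))"
      unfolding B_eq by (rule mult_left_mono) simp
    then show ?thesis using q by (simp add: mult.assoc)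
  qed
  have bad: "(\<Sum>j | j \<le> n \<and> \<bar>real j / real n - q\<bar> \<ge> e. B j) \<le> 2 * exp (- 2 * real n * e\<^sup>2)"
  proof -
    interpret binomial_distribution n q by standard (use q in simp)
    have "(\<Sum>j | j \<le> n \<and> \<bar>real j / real n - q\<bar> \<ge> e. B j)
        \<le> (\<Sum>j | j \<le> n \<and> \<bar>real j / real n - q\<bar> \<ge> e. pmf (binomial_pmf n q) j)"
      by (rule sum_mono) (rule B_le)
    also have "\<dots> = measure_pmf.prob (binomial_pmf n q) {j. j \<le> n \<and> \<bar>real j / real n - q\<bar> \<ge> e}"
      by (subst measure_measure_pmf_finite) auto
    also have "\<dots> \<le> measure_pmf.prob (binomial_pmf n q) {x. \<bar>real x / real n - q\<bar> \<ge> e}"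
      by (rule measure_pmf.finite_measure_mono) auto
    also have "\<dots> \<le> 2 * exp (- 2 * real n * e\<^sup>2)" using prob_abs_ge'[OF n, of e] e by (simp add: mult_ac)
    finally show ?thesis .
  qed
  have "\<bar>(\<Sum>j\<le>n. real j * B j) - real n * q * (\<Sum>j\<le>n. B j)\<bar> = \<bar>\<Sum>j\<le>n. (real j - real n * q) * B j\<bar>"
    by (simp add: sum_distrib_left sum_subtractf[symmetric] algebra_simps)
  also have "\<dots> \<le> (\<Sum>j\<le>n. \<bar>(real j - real n * q) * B j\<bar>)" by (rule sum_abs)
  also have "\<dots> \<le> (\<Sum>j\<le>n. e * real n * B j + (if \<bar>real j / real n - q\<bar> \<ge> e then real n * B j else 0))"
  proof (rule sum_mono)
    fix j assume "j \<in> {..n}"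
    then have j: "j \<le> n" by simp
    have dev: "\<bar>real j - real n * q\<bar> = real n * \<bar>real j / real n - q\<bar>"
      using n by (simp add: abs_mult[symmetric] field_simps del: abs_of_nat)
    show "\<bar>(real j - real n * q) * B j\<bar> \<le> e * real n * B j + (if \<bar>real j / real n - q\<bar> \<ge> e then real n * B j else 0)"
    proof (cases "\<bar>real j / real n - q\<bar> \<ge> e")
      case True
      have "0 \<le> real n * q" "real n * q \<le> real n" using q by (auto simp: mult_left_le)
      then have "\<bar>real j - real n * q\<bar> \<le> real n" using j by auto
      then have "\<bar>real j - real n * q\<bar> * B j \<le> real n * B j" by (rule mult_right_mono) (rule B_nonneg)
      also have "\<dots> \<le> e * real n * B j + real n * B j" using e B_nonneg[of j] by simp
      finally show ?thesis using True B_nonneg[of j] by (simp add: abs_mult)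
    next
      case False
      then have "\<bar>real j - real n * q\<bar> \<le> real n * e" unfolding dev by (intro mult_left_mono) auto
      then have "\<bar>real j - real n * q\<bar> * B j \<le> real n * e * B j" by (rule mult_right_mono) (rule B_nonneg)
      then show ?thesis using False B_nonneg[of j] by (simp add: abs_mult mult_ac)
    qed
  qed
  also have "\<dots> = e * real n * walk n m + real n * (\<Sum>j | j \<le> n \<and> \<bar>real j / real n - q\<bar> \<ge> e. B j)"
  proof -
    have "(\<Sum>j\<le>n. if \<bar>real j / real n - q\<bar> \<ge> e then real n * B j else 0)
       = (\<Sum>j | j \<le> n \<and> \<bar>real j / real n - q\<bar> \<ge> e. real n * B j)"
      by (rule sum.mono_neutral_cong_right) auto
    then show ?thesis by (simp add: sum.distrib walk sum_distrib_left)
  qed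
  also have "\<dots> \<le> e * real n * walk n m + real n * (2 * exp (- 2 * real n * e\<^sup>2))"
    by (intro add_left_mono mult_left_mono bad) auto
  finally show ?thesis unfolding mean[symmetric] walk[symmetric] by (simp add: q_def mult_ac)
qed

definition subexponential :: "(nat \<Rightarrow> nat) \<Rightarrow> (nat \<Rightarrow> nat) \<Rightarrow> bool" where
  "subexponential n m \<longleftrightarrow> filterlim n at_top sequentially \<and>
     (\<forall>c>0. eventually (\<lambda>i. walk (n i) (m i) \<ge> exp (- c * real (n i))) sequentially)"

lemma subexponential_eventually_pos:
  assumes "subexponential n m" shows "eventually (\<lambda>i. walk (n i) (m i) > 0) sequentially"
proof -
  have "eventually (\<lambda>i. walk (n i) (m i) \<ge> exp (- 1 * real (n i))) sequentially"
    using assms zero_less_one unfolding subexponential_def by blast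
  then show ?thesis by eventually_elim (rule less_le_trans[OF exp_gt_zero])
qed

text \<open>
  The concentration with exponentially small error beats the subexponential lower bound for the point
  probability, for every deviation \<open>e\<close>. The product with \<open>fps_X ^ k\<close> stands for \<open>walk (n - 1) (m - k)\<close> and
  vanishes for \<open>m < k\<close>, where the truncated difference would be wrong.
\<close>

lemma ratio_limit:
  assumes k: "p k > 0" and s: "subexponential n m"
  shows "(\<lambda>i. fps_nth (fps_X ^ k * Abs_fps p ^ (n i - 1)) (m i) / walk (n i) (m i)) \<longlonglongrightarrow> 1"
proof (rule tendstoI)
  fix r :: real assume r: "r > 0"
  define e where "e = p k * r / 4"
  have e: "e > 0" using r k by (simp add: e_def)
  have lim: "filterlim n at_top sequentially" using s by (simp add: subexponential_def)
  have low: "eventually (\<lambda>i. walk (n i) (m i) \<ge> exp (- e\<^sup>2 * real (n i))) sequentially"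
    using s e unfolding subexponential_def by simp
  have "((\<lambda>x. 2 * exp (- (e\<^sup>2) * x)) \<longlongrightarrow> 0) at_top"
    by (rule tendsto_eq_intros filterlim_compose[OF exp_at_bot] filterlim_tendsto_neg_mult_at_bot[OF tendsto_const] filterlim_ident | use e in simp)+
  then have "((\<lambda>i. 2 * exp (- (e\<^sup>2) * real (n i))) \<longlongrightarrow> 0) sequentially"
    by (rule filterlim_compose) (rule filterlim_compose[OF filterlim_real_sequentially lim])
  then have small: "eventually (\<lambda>i. 2 * exp (- (e\<^sup>2) * real (n i)) < e) sequentially"
    using e by (rule order_tendstoD)
  have "eventually (\<lambda>i. n i \<ge> 1) sequentially" using lim by (auto simp: filterlim_at_top)
  with low small show "eventually (\<lambda>i. dist (fps_nth (fps_X ^ k * Abs_fps p ^ (n i - 1)) (m i) / walk (n i) (m i)) 1 < r) sequentially"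
  proof eventually_elim
    case (elim i)
    let ?W = "fps_nth (fps_X ^ k * Abs_fps p ^ (n i - 1)) (m i)" and ?w = "walk (n i) (m i)"
    have w: "?w > 0" using elim(1) by (rule less_le_trans[rotated]) simp
    have n: "real (n i) > 0" using elim by simp
    have "real (n i) * (p k * \<bar>?W - ?w\<bar>) = \<bar>real (n i) * (p k * ?W) - real (n i) * p k * ?w\<bar>"
    proof -
      have "real (n i) * (p k * ?W) - real (n i) * p k * ?w = (real (n i) * p k) * (?W - ?w)"
        by (simp add: algebra_simps)
      then show ?thesis using k by (simp add: abs_mult)
    qed
    also have "\<dots> \<le> e * real (n i) * ?w + 2 * real (n i) * exp (- 2 * real (n i) * e\<^sup>2)"
      by (rule walk_step_concentration) (use k elim e in auto)
    also have "\<dots> = real (n i) * (e * ?w + 2 * exp (- (e\<^sup>2) * real (n i)) * exp (- (e\<^sup>2) * real (n i)))"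
      by (simp add: algebra_simps exp_add[symmetric])
    finally have "p k * \<bar>?W - ?w\<bar> \<le> e * ?w + 2 * exp (- (e\<^sup>2) * real (n i)) * exp (- (e\<^sup>2) * real (n i))"
      using n by (simp only: mult_le_cancel_left_pos)
    also have "\<dots> \<le> e * ?w + e * ?w" using elim e by (intro add_left_mono mult_mono) auto
    finally have "p k * \<bar>?W - ?w\<bar> \<le> p k * (r / 2 * ?w)" by (simp add: e_def algebra_simps)
    then have "\<bar>?W - ?w\<bar> \<le> r / 2 * ?w" using k by simp
    also have "\<dots> < r * ?w" using w r by simp
    finally have "\<bar>?W - ?w\<bar> / ?w < r" using w by (simp add: field_simps)
    moreover have "?W / ?w - 1 = (?W - ?w) / ?w" using w by (simp add: field_simps)
    ultimately show ?case using w by (simp add: dist_real_def abs_divide)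
  qed
qed

lemma subexponential_transfer:
  assumes s: "subexponential n m" and lim: "(\<lambda>i. walk (n' i) (m' i) / walk (n i) (m i)) \<longlonglongrightarrow> 1"
    and n': "eventually (\<lambda>i. n i \<le> n' i + a) sequentially"
  shows "subexponential n' m'"
  unfolding subexponential_def
proof (intro conjI allI impI)
  have nlim: "filterlim n at_top sequentially" using s by (simp add: subexponential_def)
  show nlim': "filterlim n' at_top sequentially"
    unfolding filterlim_at_top
  proof
    fix Z
    have "eventually (\<lambda>i. n i \<ge> Z + a) sequentially" using nlim unfolding filterlim_at_top by blast
    with n' show "eventually (\<lambda>i. n' i \<ge> Z) sequentially" by eventually_elim linarith
  qed
  fix c :: real assume c: "c > 0"
  have low: "eventually (\<lambda>i. walk (n i) (m i) \<ge> exp (- (c / 2) * real (n i))) sequentially"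
    using s half_gt_zero[OF c] unfolding subexponential_def by blast
  have half: "eventually (\<lambda>i. walk (n' i) (m' i) / walk (n i) (m i) > 1 / 2) sequentially"
    using lim by (rule order_tendstoD) simp
  define Z where "Z = nat \<lceil>real a + ln 2 * 2 / c\<rceil>"
  have "eventually (\<lambda>i. n' i \<ge> Z) sequentially" using nlim' unfolding filterlim_at_top by blast
  with low half n' subexponential_eventually_pos[OF s]
  show "eventually (\<lambda>i. walk (n' i) (m' i) \<ge> exp (- c * real (n' i))) sequentially"
  proof eventually_elim
    case (elim i)
    have "real a + ln 2 * 2 / c \<le> real Z" unfolding Z_def by linarith
    also have "\<dots> \<le> real (n' i)" using elim by simp
    finally have "c / 2 * (real a + ln 2 * 2 / c) \<le> c / 2 * real (n' i)" using c by (intro mult_left_mono) auto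
    moreover have "c / 2 * (real a + ln 2 * 2 / c) = c / 2 * real a + ln 2" using c by (simp add: field_simps)
    ultimately have 1: "c / 2 * real a + ln 2 \<le> c / 2 * real (n' i)" by simp
    have "real (n i) \<le> real (n' i) + real a" using elim by linarith
    then have "c / 2 * real (n i) \<le> c / 2 * (real (n' i) + real a)" using c by (intro mult_left_mono) auto
    with 1 have "- c * real (n' i) \<le> - (c / 2) * real (n i) - ln 2" by (simp add: algebra_simps)
    then have "exp (- c * real (n' i)) \<le> exp (- (c / 2) * real (n i) - ln 2)" by simp
    also have "\<dots> = exp (- (c / 2) * real (n i)) / 2" by (simp add: exp_diff)
    also have "\<dots> \<le> walk (n i) (m i) / 2" using elim by simp
    also have "\<dots> \<le> walk (n' i) (m' i)" using elim by (simp add: field_simps)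
    finally show ?case .
  qed
qed

text \<open>
  The ratio can only tend to 1 if it is eventually nonzero, so the limit itself shows that the walk
  eventually is far enough to remove a step of size \<open>k\<close>.
\<close>

lemma subexponential_remove:
  assumes k: "p k > 0" and s: "subexponential n m"
  shows "eventually (\<lambda>i. n i \<ge> 1 \<and> k \<le> m i) sequentially"
    and "(\<lambda>i. walk (n i - 1) (m i - k) / walk (n i) (m i)) \<longlonglongrightarrow> 1"
proof -
  have "eventually (\<lambda>i. fps_nth (fps_X ^ k * Abs_fps p ^ (n i - 1)) (m i) / walk (n i) (m i) > 0) sequentially"
    by (rule order_tendstoD(1)[OF ratio_limit[OF k s]]) simp
  moreover have "eventually (\<lambda>i. n i \<ge> 1) sequentially"
    using s unfolding subexponential_def filterlim_at_top by blast
  ultimately show ev: "eventually (\<lambda>i. n i \<ge> 1 \<and> k \<le> m i) sequentially"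
    by eventually_elim (auto simp: fps_X_power_mult_nth split: if_splits)
  show "(\<lambda>i. walk (n i - 1) (m i - k) / walk (n i) (m i)) \<longlonglongrightarrow> 1"
    by (rule Lim_transform_eventually[OF ratio_limit[OF k s]])
       (use ev in eventually_elim, auto simp: fps_X_power_mult_nth walk_def)
qed

text \<open>
  Adding a step loses at most the factor \<open>p k\<close>, so the longer walk satisfies a subexponential lower bound as
  well, and removing the step again gives the limit.
\<close>

lemma subexponential_add:
  assumes k: "p k > 0" and s: "subexponential n m"
  shows "(\<lambda>i. walk (n i + 1) (m i + k) / walk (n i) (m i)) \<longlonglongrightarrow> 1"
proof -
  have s': "subexponential (\<lambda>i. n i + 1) (\<lambda>i. m i + k)"
    unfolding subexponential_def
  proof (intro conjI allI impI)
    have nlim: "filterlim n at_top sequentially" using s by (simp add: subexponential_def)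
    then show "filterlim (\<lambda>i. n i + 1) at_top sequentially"
      by (rule filterlim_at_top_mono) simp
    fix c :: real assume c: "c > 0"
    have low: "eventually (\<lambda>i. walk (n i) (m i) \<ge> exp (- (c / 2) * real (n i))) sequentially"
      using s half_gt_zero[OF c] unfolding subexponential_def by blast
    have "eventually (\<lambda>i. n i \<ge> nat \<lceil>- ln (p k) * 2 / c\<rceil>) sequentially"
      using nlim unfolding filterlim_at_top by blast
    with low show "eventually (\<lambda>i. walk (n i + 1) (m i + k) \<ge> exp (- c * real (n i + 1))) sequentially"
    proof eventually_elim
      case (elim i)
      have "- ln (p k) * 2 / c \<le> real (n i)" using elim by linarith
      then have "- ln (p k) \<le> c / 2 * real (n i)" using c by (simp add: field_simps)
      then have "- c * real (n i + 1) \<le> - (c / 2) * real (n i) + ln (p k)" using c by (simp add: algebra_simps)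
      then have "exp (- c * real (n i + 1)) \<le> exp (- (c / 2) * real (n i) + ln (p k))" by simp
      also have "\<dots> = exp (- (c / 2) * real (n i)) * p k" by (simp only: exp_add exp_ln[OF k])
      also have "\<dots> \<le> walk (n i) (m i) * walk 1 k"
        unfolding walk_1 by (rule mult_right_mono) (use elim k in auto)
      also have "\<dots> \<le> walk (n i + 1) (m i + k)" by (rule walk_add)
      finally show ?case .
    qed
  qed
  have "(\<lambda>i. walk (n i) (m i) / walk (n i + 1) (m i + k)) \<longlonglongrightarrow> 1"
    using subexponential_remove(2)[OF k s'] by simp
  then have "(\<lambda>i. inverse (walk (n i) (m i) / walk (n i + 1) (m i + k))) \<longlonglongrightarrow> inverse 1"
    by (rule tendsto_inverse) simp
  then show ?thesis by simp
qed

text \<open>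
  The changes of the number of steps and of the end point which asymptotically do not change the
  probability. The subexponential lower bound is part of the definition because it allows further moves.
\<close>

definition shifts :: "(int \<times> int) set" where
  "shifts = {(a, b). eventually (\<lambda>i. 0 \<le> int (d * i) + a \<and> 0 \<le> int (d * i) + b) sequentially \<and>
     subexponential (\<lambda>i. nat (int (d * i) + a)) (\<lambda>i. nat (int (d * i) + b)) \<and>
     (\<lambda>i. walk (nat (int (d * i) + a)) (nat (int (d * i) + b)) / walk (d * i) (d * i)) \<longlonglongrightarrow> 1}"

lemma subexponential_diagonal: "subexponential (\<lambda>i. d * i) (\<lambda>i. d * i)"
  unfolding subexponential_def
proof (intro conjI allI impI walk_diagonal_lower_bound)
  show "filterlim (\<lambda>i. d * i) at_top sequentially"
    using weight_span_pos by (intro filterlim_at_top_mono[OF filterlim_ident]) auto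
qed

lemma shifts_0: "(0, 0) \<in> shifts"
proof -
  have "(\<lambda>i. walk (d * i) (d * i) / walk (d * i) (d * i)) \<longlonglongrightarrow> 1"
    by (rule Lim_transform_eventually[OF tendsto_const])
       (use subexponential_eventually_pos[OF subexponential_diagonal] in eventually_elim, auto)
  then show ?thesis using subexponential_diagonal by (simp add: shifts_def flip: of_nat_mult)
qed

lemma shiftsI:
  assumes x: "(a, b) \<in> shifts"
    and pos: "eventually (\<lambda>i. 0 \<le> int (d * i) + a' \<and> 0 \<le> int (d * i) + b') sequentially"
    and lim: "(\<lambda>i. walk (nat (int (d * i) + a')) (nat (int (d * i) + b'))
                / walk (nat (int (d * i) + a)) (nat (int (d * i) + b))) \<longlonglongrightarrow> 1"
  shows "(a', b') \<in> shifts"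
proof -
  have s: "subexponential (\<lambda>i. nat (int (d * i) + a)) (\<lambda>i. nat (int (d * i) + b))"
    and l: "(\<lambda>i. walk (nat (int (d * i) + a)) (nat (int (d * i) + b)) / walk (d * i) (d * i)) \<longlonglongrightarrow> 1"
    using x by (auto simp: shifts_def)
  have "subexponential (\<lambda>i. nat (int (d * i) + a')) (\<lambda>i. nat (int (d * i) + b'))"
    by (rule subexponential_transfer[OF s lim, where a = "nat \<bar>a - a'\<bar>"]) (rule always_eventually, intro allI, linarith)
  moreover have "(\<lambda>i. walk (nat (int (d * i) + a')) (nat (int (d * i) + b')) / walk (d * i) (d * i)) \<longlonglongrightarrow> 1"
  proof (rule Lim_transform_eventually)
    show "(\<lambda>i. (walk (nat (int (d * i) + a')) (nat (int (d * i) + b'))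
          / walk (nat (int (d * i) + a)) (nat (int (d * i) + b)))
        * (walk (nat (int (d * i) + a)) (nat (int (d * i) + b)) / walk (d * i) (d * i))) \<longlonglongrightarrow> 1"
      using tendsto_mult[OF lim l] by simp
  qed (use subexponential_eventually_pos[OF s] in eventually_elim, simp)
  ultimately show ?thesis using pos by (simp add: shifts_def)
qed

lemma shifts_add:
  assumes "p k > 0" "(a, b) \<in> shifts" shows "(a + 1, b + int k) \<in> shifts"
proof (rule shiftsI[OF assms(2)])
  from assms(2) have pos: "eventually (\<lambda>i. 0 \<le> int (d * i) + a \<and> 0 \<le> int (d * i) + b) sequentially"
    and s: "subexponential (\<lambda>i. nat (int (d * i) + a)) (\<lambda>i. nat (int (d * i) + b))"
    by (auto simp: shifts_def)
  from pos show "eventually (\<lambda>i. 0 \<le> int (d * i) + (a + 1) \<and> 0 \<le> int (d * i) + (b + int k)) sequentially"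
    by eventually_elim auto
  show "(\<lambda>i. walk (nat (int (d * i) + (a + 1))) (nat (int (d * i) + (b + int k)))
      / walk (nat (int (d * i) + a)) (nat (int (d * i) + b))) \<longlonglongrightarrow> 1"
  proof (rule Lim_transform_eventually[OF subexponential_add[OF assms(1) s]], use pos in eventually_elim)
    case (elim i)
    then have "nat (int (d * i) + (a + 1)) = nat (int (d * i) + a) + 1"
      "nat (int (d * i) + (b + int k)) = nat (int (d * i) + b) + k" by linarith+
    then show ?case by (simp only:)
  qed
qed

lemma shifts_remove:
  assumes "p k > 0" "(a, b) \<in> shifts" shows "(a - 1, b - int k) \<in> shifts"
proof (rule shiftsI[OF assms(2)])
  from assms(2) have pos: "eventually (\<lambda>i. 0 \<le> int (d * i) + a \<and> 0 \<le> int (d * i) + b) sequentially"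
    and s: "subexponential (\<lambda>i. nat (int (d * i) + a)) (\<lambda>i. nat (int (d * i) + b))"
    by (auto simp: shifts_def)
  note r = subexponential_remove[OF assms(1) s]
  from pos r(1) show "eventually (\<lambda>i. 0 \<le> int (d * i) + (a - 1) \<and> 0 \<le> int (d * i) + (b - int k)) sequentially"
    by eventually_elim linarith
  show "(\<lambda>i. walk (nat (int (d * i) + (a - 1))) (nat (int (d * i) + (b - int k)))
      / walk (nat (int (d * i) + a)) (nat (int (d * i) + b))) \<longlonglongrightarrow> 1"
  proof (rule Lim_transform_eventually[OF r(2)], use pos r(1) in eventually_elim)
    case (elim i)
    then have "nat (int (d * i) + (a - 1)) = nat (int (d * i) + a) - 1"
      "nat (int (d * i) + (b - int k)) = nat (int (d * i) + b) - k" by linarith+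
    then show ?case by (simp only:)
  qed
qed

text \<open>
  The moves that can always be made in both directions form a subgroup of the plane lattice. It contains
  \<open>(1, k)\<close> for every possible step \<open>k\<close>, in particular \<open>(1, 0)\<close>, hence all \<open>(0, k)\<close> and therefore \<open>(0, d)\<close>.
\<close>

theorem shifts_lattice: "(a, int d * b) \<in> shifts"
proof -
  \<comment> \<open>The admissible moves form a group, which is not clear for the set of shifts itself.\<close>
  define D where "D = {(u, v). \<forall>(a, b)\<in>shifts. (a + u, b + v) \<in> shifts \<and> (a - u, b - v) \<in> shifts}"
  have D_diff: "(u - u', v - v') \<in> D" if uv: "(u, v) \<in> D" and uv': "(u', v') \<in> D" for u v u' v'
    unfolding D_def
  proof (clarify, intro conjI)
    fix a b assume ab: "(a, b) \<in> shifts"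
    have "(a + u - u', b + v - v') \<in> shifts" using ab uv uv' by (auto simp: D_def)
    then show "(a + (u - u'), b + (v - v')) \<in> shifts" by (simp add: algebra_simps)
    have "(a - u + u', b - v + v') \<in> shifts" using ab uv uv' by (auto simp: D_def)
    then show "(a - (u - u'), b - (v - v')) \<in> shifts" by (simp add: algebra_simps)
  qed
  have step: "(1, int k) \<in> D" if "p k > 0" for k
    using shifts_add[OF that] shifts_remove[OF that] by (auto simp: D_def)
  have vert: "(0, int d) \<in> D"
  proof -
    have "int (Gcd {i. p i > 0}) \<in> {v. (0, v) \<in> D}"
    proof (rule Gcd_in_additive_subgroup)
      show "int ` {i. 0 < p i} \<subseteq> {v. (0, v) \<in> D}"
        using D_diff[OF step step[OF p0]] by auto
      show "\<exists>a\<in>{i. 0 < p i}. a \<noteq> 0" using branching by force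
    qed (use D_diff[of 0 _ 0] in auto)
    then show ?thesis by (simp add: weight_span_def)
  qed
  have hor: "(1, 0) \<in> D" using step[OF p0] by simp
  have add_nat: "(a + int n * u, b + int n * v) \<in> shifts \<and> (a - int n * u, b - int n * v) \<in> shifts"
    if "(u, v) \<in> D" "(a, b) \<in> shifts" for u v a b n
  proof (induction n)
    case (Suc n)
    then have "(a + int n * u + u, b + int n * v + v) \<in> shifts \<and> (a - int n * u - u, b - int n * v - v) \<in> shifts"
      using that(1) by (auto simp: D_def)
    then show ?case by (simp add: algebra_simps)
  qed (use that in auto)
  have add_int: "(a + n * u, b + n * v) \<in> shifts" if "(u, v) \<in> D" "(a, b) \<in> shifts" for u v a b n
    using add_nat[OF that, of "nat n"] add_nat[OF that, of "nat (- n)"] by (cases "n \<ge> 0") auto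
  have "(0 + a * 1, 0 + a * 0) \<in> shifts" by (rule add_int[OF hor shifts_0])
  then have "(0 + a * 1 + b * 0, 0 + a * 0 + b * int d) \<in> shifts" by (rule add_int[OF vert])
  then show ?thesis by (simp add: mult.commute)
qed

end

section \<open>Branches of an unrooted plane tree\<close>

text \<open>
  A list that starts anywhere and follows the cyclic order once around. It translates between the
  rotation of a graph and the linear order of children.
\<close>

definition enumerates_nbhd :: "'v rot_graph \<Rightarrow> 'v \<Rightarrow> 'v list \<Rightarrow> bool" where
  "enumerates_nbhd G v xs \<longleftrightarrow> distinct xs \<and> set xs = nbhd G v \<and>
     (\<forall>i<length xs. rot G v (xs ! i) = xs ! (Suc i mod length xs))"

lemma enumerates_nbhd_unique:
  assumes "enumerates_nbhd G v xs" "enumerates_nbhd G v ys" "xs \<noteq> [] \<Longrightarrow> hd xs = hd ys"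
  shows "xs = ys"
proof (rule nth_equalityI)
  show len: "length xs = length ys" using assms unfolding enumerates_nbhd_def by (metis distinct_card)
  show "xs ! i = ys ! i" if "i < length xs" for i
    using that
  proof (induction i)
    case 0 then show ?case using assms(3) len by (cases xs; cases ys) auto
  next
    case (Suc i)
    then have i: "i < length xs" "i < length ys" "Suc i mod length xs = Suc i" "Suc i mod length ys = Suc i"
      using len by auto
    then have "rot G v (xs ! i) = xs ! Suc i" "rot G v (ys ! i) = ys ! Suc i"
      using assms(1,2) unfolding enumerates_nbhd_def by metis+
    with Suc.IH Suc.prems show ?case by (metis Suc_lessD)
  qed
qed

lemma enumerates_nbhd_rotate:
  assumes "enumerates_nbhd G v xs" shows "enumerates_nbhd G v (rotate j xs)"
  unfolding enumerates_nbhd_def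
proof (intro conjI allI impI)
  show "distinct (rotate j xs)" "set (rotate j xs) = nbhd G v" using assms by (auto simp: enumerates_nbhd_def)
  fix i assume i: "i < length (rotate j xs)"
  then have l: "length xs > 0" by auto
  have "rot G v (rotate j xs ! i) = rot G v (xs ! ((j + i) mod length xs))" using i by (simp add: nth_rotate)
  also have "\<dots> = xs ! (Suc ((j + i) mod length xs) mod length xs)"
    using assms l by (auto simp: enumerates_nbhd_def)
  also have "\<dots> = xs ! ((j + Suc i mod length xs) mod length xs)" by (simp add: mod_simps)
  also have "\<dots> = rotate j xs ! (Suc i mod length (rotate j xs))" using l by (simp add: nth_rotate)
  finally show "rot G v (rotate j xs ! i) = rotate j xs ! (Suc i mod length (rotate j xs))" .
qed

lemma enumerates_nbhd_exists:
  assumes c: "cyclic_on (rot G v) (nbhd G v)" and x: "x \<in> nbhd G v"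
  shows "\<exists>xs. enumerates_nbhd G v (x # xs)"
proof -
  let ?r = "rot G v" and ?n = "funpow_dist1 (rot G v) x x"
  have o: "nbhd G v = orbit ?r x" using c x unfolding cyclic_on_alldef by blast
  with x have xo: "x \<in> orbit ?r x" by simp
  define ys where "ys = map (\<lambda>i. (?r ^^ i) x) [0..<?n]"
  have len: "length ys = ?n" by (simp add: ys_def)
  have "enumerates_nbhd G v ys" unfolding enumerates_nbhd_def
  proof (intro conjI allI impI)
    show "distinct ys" unfolding ys_def using inj_on_funpow_dist1[OF xo] by (simp add: distinct_map del: upt_Suc)
    show "set ys = nbhd G v" unfolding ys_def o orbit_conv_funpow_dist1[OF xo] by (simp del: upt_Suc)
    fix i assume i: "i < length ys"
    have "(?r ^^ Suc i) x = ys ! (Suc i mod ?n)"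
    proof (cases "Suc i = ?n")
      case True
      then have "(?r ^^ Suc i) x = x" using funpow_dist1_prop[OF xo] by metis
      moreover have "ys ! (Suc i mod ?n) = x" unfolding True by (simp add: ys_def del: upt_Suc)
      ultimately show ?thesis by simp
    next
      case False
      then have "Suc i < ?n" using i len by simp
      then show ?thesis by (simp add: ys_def del: upt_Suc funpow.simps)
    qed
    then show "?r (ys ! i) = ys ! (Suc i mod length ys)"
      using i unfolding len by (simp add: ys_def del: upt_Suc)
  qed
  moreover have "ys = x # tl ys" by (simp add: ys_def upt_rec[of 0] del: upt_Suc)
  ultimately show ?thesis by metis
qed

lemma enumerates_nbhd_map:
  assumes f: "plane_iso G H f" and v: "v \<in> verts G" and G: "adj G \<subseteq> verts G \<times> verts G"
    and H: "adj H \<subseteq> verts H \<times> verts H" and e: "enumerates_nbhd G v xs"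
  shows "enumerates_nbhd H (f v) (map f xs)"
proof -
  have xs: "set xs = nbhd G v" using e by (simp add: enumerates_nbhd_def)
  have sub: "set xs \<subseteq> verts G" using xs G by (auto simp: nbhd_def)
  have "inj_on f (verts G)" using f by (auto simp: plane_iso_def bij_betw_def)
  then have "inj_on f (set xs)" using sub by (rule inj_on_subset)
  moreover have "rot H (f v) (f (xs ! i)) = f (rot G v (xs ! i))" if "i < length xs" for i
    using f v xs nth_mem[OF that] by (auto simp: plane_iso_def)
  moreover have "Suc i mod length xs < length xs" if "i < length xs" for i
    using that by (intro mod_less_divisor) linarith
  ultimately show ?thesis
    using e plane_iso_nbhd[OF G H f v] by (auto simp: enumerates_nbhd_def distinct_map)
qed

lemma rtrancl_distinct_path:
  assumes "(a, b) \<in> r\<^sup>*"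
  shows "\<exists>p. p \<noteq> [] \<and> hd p = a \<and> last p = b \<and> distinct p \<and> successively (\<lambda>u v. (u, v) \<in> r) p"
  using assms
proof (induction rule: converse_rtrancl_induct)
  case base
  show ?case by (rule exI[of _ "[b]"]) simp
next
  case (step a c)
  then obtain p where p: "p \<noteq> []" "hd p = c" "last p = b" "distinct p" "successively (\<lambda>u v. (u, v) \<in> r) p" by blast
  show ?case
  proof (cases "a \<in> set p")
    case True
    then obtain ys zs where "p = ys @ a # zs" by (meson split_list)
    with p show ?thesis by (intro exI[of _ "a # zs"]) (auto simp: successively_append_iff)
  next
    case False
    with p step(1) show ?thesis by (intro exI[of _ "a # p"]) (auto simp: successively_Cons)
  qed
qed

locale plane_tree =
  fixes G :: "'v rot_graph"
  assumes tree: "is_plane_tree G"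
begin

lemma finite_verts: "finite (verts G)" and adj_verts: "adj G \<subseteq> verts G \<times> verts G"
  and adj_sym: "(x, y) \<in> adj G \<Longrightarrow> (y, x) \<in> adj G" and adj_irrefl: "(x, x) \<notin> adj G"
  and connected: "x \<in> verts G \<Longrightarrow> y \<in> verts G \<Longrightarrow> (x, y) \<in> (adj G)\<^sup>*"
  using tree by (auto simp: is_plane_tree_def dest: symD irreflD)

lemma nbhd_enumeration: "(v, x) \<in> adj G \<Longrightarrow> \<exists>xs. enumerates_nbhd G v (x # xs)"
proof (rule enumerates_nbhd_exists)
  assume a: "(v, x) \<in> adj G"
  then show "x \<in> nbhd G v" by (simp add: nbhd_def)
  then show "cyclic_on (rot G v) (nbhd G v)" using a adj_verts tree by (auto simp: is_plane_tree_def)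
qed

definition avoid :: "'v \<Rightarrow> ('v \<times> 'v) set" where
  "avoid x = {(u, v) \<in> adj G. u \<noteq> x \<and> v \<noteq> x}"

text \<open>For an edge between \<open>x\<close> and \<open>y\<close>, these are the vertices on the side of \<open>y\<close>.\<close>

definition branch :: "'v \<Rightarrow> 'v \<Rightarrow> 'v set" where
  "branch x y = {w. (y, w) \<in> (avoid x)\<^sup>*}"

lemma avoid_sym: "(u, v) \<in> avoid x \<Longrightarrow> (v, u) \<in> avoid x"
  by (auto simp: avoid_def adj_sym)

lemma avoid_rtrancl_sym: "(u, v) \<in> (avoid x)\<^sup>* \<Longrightarrow> (v, u) \<in> (avoid x)\<^sup>*"
  by (meson avoid_sym sym_rtrancl symD symI)

text \<open>
  A path from \<open>a\<close> to \<open>b\<close> avoiding \<open>y\<close> would close up through \<open>y\<close> to a cycle.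
\<close>

lemma no_detour:
  assumes "(y, a) \<in> adj G" "(y, b) \<in> adj G" "a \<noteq> b" shows "(a, b) \<notin> (avoid y)\<^sup>*"
proof
  assume "(a, b) \<in> (avoid y)\<^sup>*"
  then obtain p where p: "p \<noteq> []" "hd p = a" "last p = b" "distinct p"
    and s: "successively (\<lambda>u v. (u, v) \<in> avoid y) p" using rtrancl_distinct_path by metis
  have len: "length p \<ge> 2"
    using p assms(3) by (cases p; cases "tl p") auto
  have step: "(p ! i, p ! Suc i) \<in> avoid y" if "Suc i < length p" for i
    using successively_nth[OF s that] .
  have "y \<notin> set p"
  proof
    assume "y \<in> set p"
    then obtain i where i: "i < length p" "p ! i = y" by (auto simp: in_set_conv_nth)
    show False
    proof (cases i)
      case 0 then show ?thesis using step[of 0] i len by (auto simp: avoid_def)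
    next
      case (Suc j) then show ?thesis using step[of j] i by (auto simp: avoid_def)
    qed
  qed
  then have "distinct (y # p)" using p by simp
  moreover have "((y # p) ! i, (y # p) ! (Suc i mod length (y # p))) \<in> adj G" if i: "i < length (y # p)" for i
  proof -
    consider "i = 0" | "i = length p" | j where "i = Suc j" "Suc j < length p"
      using i by (cases i) (simp, metis length_Cons less_antisym Suc_less_eq)
    then show ?thesis
    proof cases
      case 1 then show ?thesis using assms(1) p by (simp add: hd_conv_nth)
    next
      case 2
      then have "i = Suc (length p - 1)" using len by simp
      then have "(y # p) ! i = b" using p by (simp add: last_conv_nth)
      then show ?thesis using 2 assms(2) adj_sym by simp
    next
      case 3 then show ?thesis using step[of j] by (auto simp: avoid_def)
    qed
  qed
  ultimately show False
    using tree len unfolding is_plane_tree_def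
    by (metis One_nat_def Suc_le_mono length_Cons numeral_2_eq_2 numeral_3_eq_3)
qed

lemma branch_self: "y \<in> branch x y" by (simp add: branch_def)

lemma branch_avoids: "x \<noteq> y \<Longrightarrow> x \<notin> branch x y"
proof
  assume "x \<noteq> y" "x \<in> branch x y"
  then show False unfolding branch_def by (auto elim: rtranclE simp: avoid_def)
qed

lemma adj_neq: "(x, y) \<in> adj G \<Longrightarrow> x \<noteq> y" using adj_irrefl by auto

lemma branch_verts: "(x, y) \<in> adj G \<Longrightarrow> branch x y \<subseteq> verts G"
proof
  fix w assume "(x, y) \<in> adj G" "w \<in> branch x y"
  then have "(y, w) \<in> (avoid x)\<^sup>*" by (simp add: branch_def)
  then show "w \<in> verts G"
    by (cases rule: rtranclE) (use \<open>(x, y) \<in> adj G\<close> adj_verts in \<open>auto simp: avoid_def\<close>)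
qed

lemma finite_branch: "(x, y) \<in> adj G \<Longrightarrow> finite (branch x y)"
  using branch_verts finite_verts by (meson finite_subset)

lemma branch_step: "u \<in> branch x y \<Longrightarrow> (u, v) \<in> adj G \<Longrightarrow> x \<noteq> y \<Longrightarrow> v \<noteq> x \<Longrightarrow> v \<in> branch x y"
  unfolding branch_def
  using branch_avoids[of x y] by (auto simp: branch_def avoid_def intro: rtrancl_into_rtrancl)

lemma branch_disjoint:
  assumes "(y, a) \<in> adj G" "(y, b) \<in> adj G" "a \<noteq> b" shows "branch y a \<inter> branch y b = {}"
  using no_detour[OF assms] unfolding branch_def by (auto dest: avoid_rtrancl_sym intro: rtrancl_trans)

text \<open>An edge leaving \<open>branch x y\<close> can only lead to \<open>x\<close>, and \<open>no_detour\<close> leaves one such edge.\<close>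

lemma branch_exit:
  assumes xy: "(x, y) \<in> adj G" and u: "u \<in> branch x y" and v: "v \<notin> branch x y" and uv: "(u, v) \<in> adj G"
  shows "u = y \<and> v = x"
proof
  show vx: "v = x" using branch_step[OF u uv adj_neq[OF xy]] v by blast
  show "u = y"
    using no_detour[OF xy, of u] u uv adj_sym vx by (auto simp: branch_def)
qed

lemma branch_sub:
  assumes xy: "(x, y) \<in> adj G" and yz: "(y, z) \<in> adj G" and "z \<noteq> x"
  shows "branch y z \<subseteq> branch x y"
proof
  fix w assume "w \<in> branch y z"
  then have "(z, w) \<in> (avoid y)\<^sup>*" by (simp add: branch_def)
  then show "w \<in> branch x y"
  proof (induction rule: rtrancl_induct)
    case base
    show ?case by (rule branch_step[OF branch_self yz adj_neq[OF xy] \<open>z \<noteq> x\<close>])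
  next
    case (step u v)
    have "v \<noteq> x"
      using no_detour[OF yz adj_sym[OF xy] \<open>z \<noteq> x\<close>] rtrancl_into_rtrancl[OF step(1,2)] by auto
    then show ?case using branch_step[OF step(3) _ adj_neq[OF xy]] step(2) by (auto simp: avoid_def)
  qed
qed

text \<open>
  The recursive structure that turns a branch into a planted plane tree.
\<close>

lemma branch_decompose:
  assumes xy: "(x, y) \<in> adj G"
  shows "branch x y = insert y (\<Union>z\<in>nbhd G y - {x}. branch y z)"
proof
  show "insert y (\<Union>z\<in>nbhd G y - {x}. branch y z) \<subseteq> branch x y"
    using branch_sub[OF xy] branch_self by (auto simp: nbhd_def)
  show "branch x y \<subseteq> insert y (\<Union>z\<in>nbhd G y - {x}. branch y z)"
  proof
    fix w assume "w \<in> branch x y"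
    then have "(y, w) \<in> (avoid x)\<^sup>*" by (simp add: branch_def)
    then show "w \<in> insert y (\<Union>z\<in>nbhd G y - {x}. branch y z)"
    proof (induction rule: rtrancl_induct)
      case (step u v)
      then have uv: "(u, v) \<in> adj G" "v \<noteq> x" by (auto simp: avoid_def)
      show ?case
      proof (cases "u = y")
        case True
        then show ?thesis using uv branch_self[of v y] by (auto simp: nbhd_def)
      next
        case False
        with step.IH obtain z where z: "z \<in> nbhd G y - {x}" "u \<in> branch y z" by auto
        then have "v = y \<or> v \<in> branch y z"
          using branch_step[OF z(2) uv(1)] adj_neq[of y z] by (auto simp: nbhd_def)
        with z show ?thesis by auto
      qed
    qed simp
  qed
qed

lemma verts_decompose:
  assumes y: "y \<in> verts G" shows "verts G = insert y (\<Union>z\<in>nbhd G y. branch y z)"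
proof
  show "insert y (\<Union>z\<in>nbhd G y. branch y z) \<subseteq> verts G"
    using branch_verts y by (fastforce simp: nbhd_def)
  show "verts G \<subseteq> insert y (\<Union>z\<in>nbhd G y. branch y z)"
  proof
    fix w assume "w \<in> verts G"
    then have "(y, w) \<in> (adj G)\<^sup>*" using connected y by blast
    then show "w \<in> insert y (\<Union>z\<in>nbhd G y. branch y z)"
    proof (induction rule: rtrancl_induct)
      case (step u v)
      show ?case
      proof (cases "u = y")
        case True
        then show ?thesis using step branch_self[of v y] by (auto simp: nbhd_def)
      next
        case False
        with step.IH obtain z where z: "z \<in> nbhd G y" "u \<in> branch y z" by auto
        then have "v = y \<or> v \<in> branch y z"
          using branch_step[OF z(2) step(2)] adj_neq[of y z] by (auto simp: nbhd_def)
        with z show ?thesis by auto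
      qed
    qed simp
  qed
qed

lemma branch_opposite:
  assumes xy: "(x, y) \<in> adj G"
  shows "branch x y \<inter> branch y x = {}" "branch x y \<union> branch y x = verts G"
proof -
  have "w \<notin> branch x y" if "w \<in> branch y x" for w
  proof -
    from that have "(x, w) \<in> (avoid y)\<^sup>*" by (simp add: branch_def)
    then show ?thesis
    proof (induction rule: rtrancl_induct)
      case base show ?case by (rule branch_avoids[OF adj_neq[OF xy]])
    next
      case (step u v)
      then have uv: "(v, u) \<in> adj G" "v \<noteq> y" by (auto simp: avoid_def adj_sym)
      show ?case using branch_exit[OF xy _ step(3) uv(1)] uv(2) by blast
    qed
  qed
  then show "branch x y \<inter> branch y x = {}" by auto
  have y: "y \<in> verts G" using xy adj_verts by auto
  have "verts G = insert y (\<Union>z\<in>nbhd G y. branch y z)" by (rule verts_decompose[OF y])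
  also have "\<dots> = insert y (\<Union>z\<in>nbhd G y - {x}. branch y z) \<union> branch y x"
    using adj_sym[OF xy] by (auto simp: nbhd_def)
  finally show "branch x y \<union> branch y x = verts G" by (simp only: branch_decompose[OF xy])
qed

lemma card_branch_opposite:
  assumes xy: "(x, y) \<in> adj G"
  shows "card (branch x y) + card (branch y x) = card (verts G)"
  using card_Un_disjoint[OF finite_branch[OF xy] finite_branch[OF adj_sym[OF xy]]] branch_opposite[OF xy] by simp

end

section \<open>Rooted encodings of an unrooted plane tree\<close>

text \<open>
  The planted plane tree \<open>t\<close>, placed into the graph \<open>G\<close> by \<open>f\<close> with its root at \<open>y\<close>, follows the rotation
  system. At the root the neighbours in the list \<open>prev\<close> are not children: there are none of them for a
  tree that fills \<open>G\<close>, and one for a branch, namely the vertex through which the branch is attached.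
\<close>

definition rooted_encoding :: "'v rot_graph \<Rightarrow> 'v list \<Rightarrow> 'v \<Rightarrow> ptree \<Rightarrow> (nat list \<Rightarrow> 'v) \<Rightarrow> bool" where
  "rooted_encoding G prev y t f \<longleftrightarrow> f [] = y \<and> inj_on f (nodes t) \<and>
     enumerates_nbhd G y (prev @ map (\<lambda>i. f [i]) [0..<outdeg t []]) \<and>
     (\<forall>q\<in>nodes t. q \<noteq> [] \<longrightarrow> enumerates_nbhd G (f q) (map f (nbr_list t q)))"

lemma nodes_Nil [simp]: "[] \<in> nodes t" by (simp add: nodes_def)

lemma outdeg_Nil: "outdeg t [] = length (children t)" by (simp add: outdeg_def)

lemma outdeg_Cons: "outdeg (Node ts) (i # q) = outdeg (ts ! i) q" by (simp add: outdeg_def)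

lemma Cons_in_nodes: "i # q \<in> nodes (Node ts) \<longleftrightarrow> i < length ts \<and> q \<in> nodes (ts ! i)"
  by (simp add: nodes_def)

text \<open>
  Encodings \<open>fz z\<close> of disjoint branches at the neighbours \<open>z\<close> of \<open>y\<close> are put together below a common root: the
  address \<open>i # q\<close> is sent to the place of \<open>q\<close> in the branch at the \<open>i\<close>-th listed neighbour.
\<close>

lemma rooted_encoding_glue:
  assumes e: "enumerates_nbhd G y (prev @ zs)"
    and enc: "\<And>z. z \<in> set zs \<Longrightarrow> rooted_encoding G [y] z (tz z) (fz z) \<and> fz z ` nodes (tz z) = B z"
    and y: "\<And>z. z \<in> set zs \<Longrightarrow> y \<notin> B z"
    and disj: "\<And>z z'. z \<in> set zs \<Longrightarrow> z' \<in> set zs \<Longrightarrow> z \<noteq> z' \<Longrightarrow> B z \<inter> B z' = {}"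
  shows "\<exists>f. rooted_encoding G prev y (Node (map tz zs)) f \<and>
     f ` nodes (Node (map tz zs)) = insert y (\<Union>z\<in>set zs. B z) \<and> (\<forall>i<length zs. f [i] = zs ! i)"
proof -
  define f where "f = (\<lambda>q. case q of [] \<Rightarrow> y | i # q \<Rightarrow> fz (zs ! i) q)"
  let ?t = "Node (map tz zs)"
  have f_Nil: "f [] = y" and f_Cons: "f (i # q) = fz (zs ! i) q" for i q by (auto simp: f_def)
  have dz: "distinct zs" using e by (auto simp: enumerates_nbhd_def)
  have fz_Nil: "fz z [] = z" if "z \<in> set zs" for z using enc[OF that] by (simp add: rooted_encoding_def)
  have in_B: "f (i # q) \<in> B (zs ! i)" if "i < length zs" "q \<in> nodes (tz (zs ! i))" for i q
    using enc[OF nth_mem[OF that(1)]] that by (auto simp: f_Cons)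
  have f_i: "f [i] = zs ! i" if "i < length zs" for i using that fz_Nil by (simp add: f_Cons)
  have "inj_on f (nodes ?t)"
  proof (rule inj_onI)
    fix q q' assume q: "q \<in> nodes ?t" "q' \<in> nodes ?t" and eq: "f q = f q'"
    show "q = q'"
    proof (cases q; cases q')
      fix i r j s assume [simp]: "q = i # r" "q' = j # s"
      have i: "i < length zs" "r \<in> nodes (tz (zs ! i))" and j: "j < length zs" "s \<in> nodes (tz (zs ! j))"
        using q by (auto simp: Cons_in_nodes)
      have "zs ! i = zs ! j"
        using disj[OF nth_mem[OF i(1)] nth_mem[OF j(1)]] in_B[OF i] in_B[OF j] eq by auto
      then have ij: "i = j" using dz i j by (simp add: nth_eq_iff_index_eq)
      have "inj_on (fz (zs ! i)) (nodes (tz (zs ! i)))"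
        using enc[OF nth_mem[OF i(1)]] by (simp add: rooted_encoding_def)
      then have "r = s" using eq i j ij by (auto simp: f_Cons inj_on_def)
      with ij show ?thesis by simp
    next
      fix j s assume [simp]: "q = []" "q' = j # s"
      then have "j < length zs" "s \<in> nodes (tz (zs ! j))" using q by (auto simp: Cons_in_nodes)
      then show ?thesis using in_B y[OF nth_mem] eq by (fastforce simp: f_Nil)
    next
      fix j s assume [simp]: "q' = []" "q = j # s"
      then have "j < length zs" "s \<in> nodes (tz (zs ! j))" using q by (auto simp: Cons_in_nodes)
      then show ?thesis using in_B y[OF nth_mem] eq by (fastforce simp: f_Nil)
    qed simp
  qed
  moreover have "map (\<lambda>i. f [i]) [0..<outdeg ?t []] = zs"
    by (rule nth_equalityI) (auto simp: outdeg_Nil f_i)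
  moreover have "enumerates_nbhd G (f q) (map f (nbr_list ?t q))" if q: "q \<in> nodes ?t" "q \<noteq> []" for q
  proof -
    obtain i r where [simp]: "q = i # r" using q by (cases q) auto
    have i: "i < length zs" "r \<in> nodes (tz (zs ! i))" using q by (auto simp: Cons_in_nodes)
    let ?s = "tz (zs ! i)"
    have od: "outdeg ?t q = outdeg ?s r" using i by (simp add: outdeg_Cons)
    note E = enc[OF nth_mem[OF i(1)]]
    show ?thesis
    proof (cases "r = []")
      case True
      have "map f (nbr_list ?t q) = [y] @ map (\<lambda>j. fz (zs ! i) [j]) [0..<outdeg ?s []]"
        using True od by (simp add: nbr_list_def f_Nil f_Cons)
      then show ?thesis using E True i by (simp add: rooted_encoding_def f_Cons)
    next
      case False
      have "map f (nbr_list ?t q) = map (fz (zs ! i)) (nbr_list ?s r)"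
        using False od by (simp add: nbr_list_def f_Cons)
      then show ?thesis using E False i by (simp add: rooted_encoding_def f_Cons)
    qed
  qed
  ultimately have "rooted_encoding G prev y ?t f" using e by (simp add: rooted_encoding_def f_Nil)
  moreover have "f ` nodes ?t = insert y (\<Union>z\<in>set zs. B z)"
  proof -
    have "f ` nodes ?t = insert y (\<Union>i<length zs. fz (zs ! i) ` nodes (tz (zs ! i)))"
      by (simp add: nodes_Node image_UN image_image f_Nil f_Cons)
    also have "(\<Union>i<length zs. fz (zs ! i) ` nodes (tz (zs ! i))) = (\<Union>i<length zs. B (zs ! i))"
      using enc by (intro SUP_cong) auto
    also have "\<dots> = (\<Union>z\<in>set zs. B z)" by (auto simp: set_conv_nth)
    finally show ?thesis .
  qed
  ultimately show ?thesis using f_i by blast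
qed

context plane_tree
begin

lemma branch_encoding:
  "(x, y) \<in> adj G \<Longrightarrow> \<exists>t f. rooted_encoding G [x] y t f \<and> f ` nodes t = branch x y"
proof (induction "card (branch x y)" arbitrary: x y rule: less_induct)
  case less
  note xy = less.prems
  obtain zs where zs: "enumerates_nbhd G y (x # zs)" using nbhd_enumeration[OF adj_sym[OF xy]] by blast
  then have set_zs: "set zs = nbhd G y - {x}" by (auto simp: enumerates_nbhd_def)
  have "\<exists>t f. rooted_encoding G [y] z t f \<and> f ` nodes t = branch y z" if z: "z \<in> set zs" for z
  proof (rule less.hyps)
    show yz: "(y, z) \<in> adj G" using z set_zs by (auto simp: nbhd_def)
    have "branch y z \<subset> branch x y"
      using branch_sub[OF xy yz] branch_avoids[OF adj_neq[OF yz]] branch_self[of y x] z set_zs by auto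
    then show "card (branch y z) < card (branch x y)" by (rule psubset_card_mono[OF finite_branch[OF xy]])
  qed
  then obtain tz fz where "\<And>z. z \<in> set zs \<Longrightarrow> rooted_encoding G [y] z (tz z) (fz z) \<and> fz z ` nodes (tz z) = branch y z"
    by metis
  moreover have "y \<notin> branch y z" if "z \<in> set zs" for z
    using that set_zs adj_neq by (intro branch_avoids) (auto simp: nbhd_def)
  moreover have "branch y z \<inter> branch y z' = {}" if "z \<in> set zs" "z' \<in> set zs" "z \<noteq> z'" for z z'
    using that set_zs by (intro branch_disjoint) (auto simp: nbhd_def)
  ultimately have "\<exists>f. rooted_encoding G [x] y (Node (map tz zs)) f \<and>
     f ` nodes (Node (map tz zs)) = insert y (\<Union>z\<in>set zs. branch y z) \<and> (\<forall>i<length zs. f [i] = zs ! i)"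
    using zs by (intro rooted_encoding_glue) auto
  then show ?case unfolding branch_decompose[OF xy] set_zs by blast
qed

end

text \<open>
  The vertices of \<open>t\<close> are identified with those of \<open>G\<close> such that the neighbours, read off in \<open>t\<close> as parent
  followed by children, are in the cyclic order of \<open>G\<close>. This is the same as an isomorphism from
  \<open>plane_graph_of t\<close> to \<open>G\<close>, but convenient for comparing different rootings.
\<close>

definition encoding :: "'v rot_graph \<Rightarrow> ptree \<Rightarrow> (nat list \<Rightarrow> 'v) \<Rightarrow> bool" where
  "encoding G t f \<longleftrightarrow> bij_betw f (nodes t) (verts G) \<and>
     (\<forall>q\<in>nodes t. enumerates_nbhd G (f q) (map f (nbr_list t q)))"

text \<open>
  The branches at the start of the edge are glued in the cyclic order that begins with the end of the edge.
\<close>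

lemma (in plane_tree) encoding_exists:
  assumes ab: "(a, b) \<in> adj G"
  shows "\<exists>t f. encoding G t f \<and> f [] = a \<and> f [0] = b \<and> children t \<noteq> []"
proof -
  obtain zs where zs: "enumerates_nbhd G a (b # zs)" using nbhd_enumeration[OF ab] by blast
  let ?zs = "b # zs"
  have set_zs: "set ?zs = nbhd G a" using zs by (auto simp: enumerates_nbhd_def)
  have "\<exists>t f. rooted_encoding G [a] z t f \<and> f ` nodes t = branch a z" if z: "z \<in> set ?zs" for z
    using that unfolding set_zs by (intro branch_encoding) (auto simp: nbhd_def)
  then obtain tz fz where "\<And>z. z \<in> set ?zs \<Longrightarrow> rooted_encoding G [a] z (tz z) (fz z) \<and> fz z ` nodes (tz z) = branch a z"
    by metis
  moreover have "a \<notin> branch a z" if "z \<in> set ?zs" for z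
    using that adj_neq unfolding set_zs by (intro branch_avoids) (auto simp: nbhd_def)
  moreover have "branch a z \<inter> branch a z' = {}" if "z \<in> set ?zs" "z' \<in> set ?zs" "z \<noteq> z'" for z z'
    using that unfolding set_zs by (intro branch_disjoint) (auto simp: nbhd_def)
  ultimately have "\<exists>f. rooted_encoding G [] a (Node (map tz ?zs)) f \<and>
     f ` nodes (Node (map tz ?zs)) = insert a (\<Union>z\<in>set ?zs. branch a z) \<and> (\<forall>i<length ?zs. f [i] = ?zs ! i)"
    using zs by (intro rooted_encoding_glue) auto
  then obtain f where f: "rooted_encoding G [] a (Node (map tz ?zs)) f"
     "f ` nodes (Node (map tz ?zs)) = insert a (\<Union>z\<in>set ?zs. branch a z)" "f [0] = b" by fastforce
  have "a \<in> verts G" using ab adj_verts by auto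
  then have "verts G = f ` nodes (Node (map tz ?zs))" using f(2) verts_decompose[of a] unfolding set_zs by simp
  then have "bij_betw f (nodes (Node (map tz ?zs))) (verts G)"
    using f(1) by (simp add: bij_betw_def rooted_encoding_def)
  moreover have "enumerates_nbhd G (f q) (map f (nbr_list (Node (map tz ?zs)) q))"
    if "q \<in> nodes (Node (map tz ?zs))" for q
    using f(1) that by (cases "q = []") (auto simp: rooted_encoding_def nbr_list_def o_def)
  ultimately show ?thesis using f unfolding encoding_def rooted_encoding_def by fastforce
qed

lemma adj_plane_graph_of_nbr_list:
  "(p, q) \<in> adj (plane_graph_of t) \<longleftrightarrow> p \<in> nodes t \<and> q \<in> set (nbr_list t p)"
  by (simp add: plane_graph_of_def)

lemma verts_plane_graph_of [simp]: "verts (plane_graph_of t) = nodes t"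
  by (simp add: plane_graph_of_def)

lemma nbr_list_nodes: "p \<in> nodes t \<Longrightarrow> set (nbr_list t p) \<subseteq> nodes t"
  using adj_plane_graph_of_nbr_list adj_plane_graph_of by blast

lemma plane_tree_plane_graph_of: "plane_tree (plane_graph_of t)"
  by (simp add: plane_tree_def is_plane_tree_plane_graph_of)

lemma enumerates_nbr_list:
  assumes p: "p \<in> nodes t" shows "enumerates_nbhd (plane_graph_of t) p (nbr_list t p)"
  unfolding enumerates_nbhd_def
proof (intro conjI allI impI)
  show "distinct (nbr_list t p)" by (rule distinct_nbr_list)
  show "set (nbr_list t p) = nbhd (plane_graph_of t) p"
    using p by (auto simp: nbhd_def adj_plane_graph_of_nbr_list)
  fix i assume i: "i < length (nbr_list t p)"
  have "map (cycle_of_list (nbr_list t p) ^^ 1) (nbr_list t p) = rotate 1 (nbr_list t p)"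
    by (rule cyclic_rotation[OF distinct_nbr_list])
  then have "map (cycle_of_list (nbr_list t p)) (nbr_list t p) ! i = rotate 1 (nbr_list t p) ! i" by simp
  then show "rot (plane_graph_of t) p (nbr_list t p ! i) = nbr_list t p ! (Suc i mod length (nbr_list t p))"
    using i by (simp add: nth_rotate plane_graph_of_def plus_1_eq_Suc del: One_nat_def rotate_Suc)
qed

lemma encoding_imp_iso:
  assumes G: "plane_tree G" and e: "encoding G t f" shows "plane_iso (plane_graph_of t) G f"
  unfolding plane_iso_def
proof (intro conjI ballI)
  have bij: "bij_betw f (nodes t) (verts G)"
    and en: "\<And>q. q \<in> nodes t \<Longrightarrow> enumerates_nbhd G (f q) (map f (nbr_list t q))"
    using e by (auto simp: encoding_def)
  then have inj: "inj_on f (nodes t)" by (simp add: bij_betw_def)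
  show "bij_betw f (verts (plane_graph_of t)) (verts G)" using bij by simp
  fix u v assume u: "u \<in> verts (plane_graph_of t)"
  { assume v: "v \<in> verts (plane_graph_of t)"
    have "(f u, f v) \<in> adj G \<longleftrightarrow> f v \<in> f ` set (nbr_list t u)"
      using en[of u] u by (auto simp: enumerates_nbhd_def nbhd_def)
    also have "\<dots> \<longleftrightarrow> v \<in> set (nbr_list t u)"
      using inj_on_image_mem_iff[OF inj, of v "set (nbr_list t u)"] u v nbr_list_nodes by auto
    finally show "(u, v) \<in> adj (plane_graph_of t) \<longleftrightarrow> (f u, f v) \<in> adj G"
      using u by (simp add: adj_plane_graph_of_nbr_list) }
  assume "v \<in> nbhd (plane_graph_of t) u"
  then obtain i where i: "i < length (nbr_list t u)" "v = nbr_list t u ! i"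
    by (auto simp: nbhd_def adj_plane_graph_of_nbr_list in_set_conv_nth)
  then have "rot (plane_graph_of t) u v = nbr_list t u ! (Suc i mod length (nbr_list t u))"
    using enumerates_nbr_list[of u t] u by (auto simp: enumerates_nbhd_def)
  moreover have "Suc i mod length (nbr_list t u) < length (nbr_list t u)"
    using i by (intro mod_less_divisor) linarith
  ultimately show "f (rot (plane_graph_of t) u v) = rot G (f u) (f v)"
    using en[of u] u i by (auto simp: enumerates_nbhd_def)
qed

lemma iso_imp_encoding:
  assumes G: "plane_tree G" and f: "plane_iso (plane_graph_of t) G f" shows "encoding G t f"
  unfolding encoding_def
proof (intro conjI ballI)
  show "bij_betw f (nodes t) (verts G)" using f by (simp add: plane_iso_def)
  fix q assume q: "q \<in> nodes t"
  show "enumerates_nbhd G (f q) (map f (nbr_list t q))"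
    by (rule enumerates_nbhd_map[OF f _ _ _ enumerates_nbr_list[OF q]])
       (use q plane_tree.adj_verts[OF G] plane_tree.adj_verts[OF plane_tree_plane_graph_of] in auto)
qed

lemma encoding_id: "encoding (plane_graph_of t) t id"
  by (rule iso_imp_encoding[OF plane_tree_plane_graph_of]) (simp add: plane_iso_def)

lemma encoding_comp:
  assumes G: "plane_tree G" and f: "encoding G t f" and h: "encoding (plane_graph_of t) s h"
  shows "encoding G s (f \<circ> h)"
  unfolding encoding_def
proof (intro conjI ballI)
  show "bij_betw (f \<circ> h) (nodes s) (verts G)"
    using f h by (auto simp: encoding_def intro: bij_betw_trans)
  fix q assume q: "q \<in> nodes s"
  have "h q \<in> nodes t" using h q by (auto simp: encoding_def bij_betw_def)
  then have "enumerates_nbhd G (f (h q)) (map f (map h (nbr_list s q)))"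
    by (intro enumerates_nbhd_map[OF encoding_imp_iso[OF G f]])
       (use h q plane_tree.adj_verts[OF G] plane_tree.adj_verts[OF plane_tree_plane_graph_of] in \<open>auto simp: encoding_def\<close>)
  then show "enumerates_nbhd G ((f \<circ> h) q) (map (f \<circ> h) (nbr_list s q))" by simp
qed

text \<open>
  A relabelling between two planted trees that preserves all neighbour lists up to rotation does not
  change the plane graph. It suffices that \<open>\<phi>\<close> is injective, since both trees have the same size.
\<close>

lemma encoding_reindex:
  assumes f: "encoding G t f" and \<phi>: "inj_on \<phi> (nodes s)" "\<phi> ` nodes s \<subseteq> nodes t" "psize s = psize t"
    and nbr: "\<And>q. q \<in> nodes s \<Longrightarrow> \<exists>j. map \<phi> (nbr_list s q) = rotate j (nbr_list t (\<phi> q))"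
  shows "encoding G s (f \<circ> \<phi>)"
  unfolding encoding_def
proof (intro conjI ballI)
  have "\<phi> ` nodes s = nodes t"
    by (rule card_subset_eq) (use \<phi> in \<open>auto simp: finite_nodes card_image psize_def\<close>)
  then have "bij_betw \<phi> (nodes s) (nodes t)" using \<phi>(1) by (simp add: bij_betw_def)
  then show "bij_betw (f \<circ> \<phi>) (nodes s) (verts G)"
    using f by (auto simp: encoding_def intro: bij_betw_trans)
  fix q assume q: "q \<in> nodes s"
  obtain j where j: "map \<phi> (nbr_list s q) = rotate j (nbr_list t (\<phi> q))" using nbr[OF q] by blast
  have "map (f \<circ> \<phi>) (nbr_list s q) = map f (map \<phi> (nbr_list s q))" by simp
  also have "\<dots> = rotate j (map f (nbr_list t (\<phi> q)))" unfolding j by (rule rotate_map[symmetric])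
  finally have eq: "map (f \<circ> \<phi>) (nbr_list s q) = rotate j (map f (nbr_list t (\<phi> q)))" .
  have "\<phi> q \<in> nodes t" using q \<phi>(2) by auto
  then have "enumerates_nbhd G (f (\<phi> q)) (rotate j (map f (nbr_list t (\<phi> q))))"
    using f by (intro enumerates_nbhd_rotate) (simp add: encoding_def)
  then show "enumerates_nbhd G ((f \<circ> \<phi>) q) (map (f \<circ> \<phi>) (nbr_list s q))"
    by (simp only: eq o_apply)
qed

lemma ptree_eqI:
  assumes "nodes s \<subseteq> nodes t" "\<And>q. q \<in> nodes s \<Longrightarrow> outdeg s q = outdeg t q"
  shows "s = t"
  using assms
proof (induction s arbitrary: t)
  case (Node ss)
  obtain ts where t: "t = Node ts" by (cases t)
  have len: "length ss = length ts" using Node.prems(2)[of "[]"] t by (simp add: outdeg_Nil)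
  have "ss ! i = ts ! i" if i: "i < length ss" for i
  proof (rule Node.IH)
    show "ss ! i \<in> set ss" using i by simp
    show "nodes (ss ! i) \<subseteq> nodes (ts ! i)"
      using Node.prems(1) i len unfolding t by (auto simp: Cons_in_nodes dest: subsetD[of _ _ "i # _"])
    show "outdeg (ss ! i) q = outdeg (ts ! i) q" if "q \<in> nodes (ss ! i)" for q
      using Node.prems(2)[of "i # q"] that i by (simp add: Cons_in_nodes outdeg_Cons t)
  qed
  then show ?case using len t by (auto intro: nth_equalityI)
qed

lemma snoc_in_nodes: "q @ [i] \<in> nodes t \<longleftrightarrow> q \<in> nodes t \<and> i < outdeg t q"
  by (simp add: nodes_def is_node_snoc)

text \<open>
  A plane tree has no nontrivial automorphism fixing a directed edge: the rotation at a vertex determines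
  the images of all its neighbours from the image of one of them, so that the position of the root and
  of its first child propagates through the whole tree.
\<close>

lemma encoding_unique:
  assumes f: "encoding G s f" and g: "encoding G t g" and root: "f [] = g []"
    and first: "children s \<noteq> [] \<Longrightarrow> f [0] = g [0]"
  shows "s = t" "\<And>q. q \<in> nodes s \<Longrightarrow> f q = g q"
proof -
  have step: "map f (nbr_list s q) = map g (nbr_list t q)"
    if q: "q \<in> nodes s" "q \<in> nodes t" "f q = g q" "q \<noteq> [] \<Longrightarrow> f (butlast q) = g (butlast q)" for q
  proof (rule enumerates_nbhd_unique)
    show "enumerates_nbhd G (f q) (map f (nbr_list s q))" using f q(1) unfolding encoding_def by blast
    show e: "enumerates_nbhd G (f q) (map g (nbr_list t q))" using g q(2) unfolding encoding_def q(3) by blast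
    assume ne: "map f (nbr_list s q) \<noteq> []"
    show "hd (map f (nbr_list s q)) = hd (map g (nbr_list t q))"
    proof (cases "q = []")
      case True
      have "length (map g (nbr_list t q)) = length (map f (nbr_list s q))"
        using f q e unfolding encoding_def enumerates_nbhd_def by (metis distinct_card)
      then have "outdeg t [] = outdeg s []" "outdeg s [] > 0" using True ne by (auto simp: nbr_list_def)
      then show ?thesis using first True by (simp add: nbr_list_def outdeg_Nil upt_rec)
    next
      case False then show ?thesis using q by (simp add: nbr_list_def)
    qed
  qed
  have od: "outdeg s q = outdeg t q \<and> (\<forall>i<outdeg s q. f (q @ [i]) = g (q @ [i]))"
    if "map f (nbr_list s q) = map g (nbr_list t q)" for q
  proof -
    have "map f (map (\<lambda>i. q @ [i]) [0..<outdeg s q]) = map g (map (\<lambda>i. q @ [i]) [0..<outdeg t q])"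
      using that by (auto simp: nbr_list_def split: if_splits)
    then show ?thesis by (auto simp: list_eq_iff_nth_eq)
  qed
  have main: "q \<in> nodes s \<Longrightarrow> q \<in> nodes t \<and> f q = g q \<and> (q \<noteq> [] \<longrightarrow> f (butlast q) = g (butlast q))" for q
  proof (induction q rule: rev_induct)
    case Nil then show ?case using root by simp
  next
    case (snoc i q)
    then have q: "q \<in> nodes s" "i < outdeg s q" by (auto simp: snoc_in_nodes)
    then have "outdeg s q = outdeg t q \<and> (\<forall>i<outdeg s q. f (q @ [i]) = g (q @ [i]))"
      using snoc.IH by (intro od step) auto
    then show ?case using q snoc.IH by (auto simp: snoc_in_nodes)
  qed
  then show "\<And>q. q \<in> nodes s \<Longrightarrow> f q = g q" by blast
  show "s = t"
    by (rule ptree_eqI) (use main od step in auto)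
qed

lemma encoding_rotate:
  assumes f: "encoding G (Node ts) f" and ts: "ts \<noteq> []"
  shows "\<exists>g. encoding G (Node (rotate j ts)) g \<and> g [] = f [] \<and> g [0] = f [j mod length ts]"
proof -
  let ?n = "length ts" and ?s = "Node (rotate j ts)"
  have n: "?n > 0" using ts by simp
  define \<phi> where "\<phi> = (\<lambda>q. case q of [] \<Rightarrow> [] | i # r \<Rightarrow> ((j + i) mod ?n) # r)"
  have \<phi>_Nil: "\<phi> [] = []" and \<phi>_Cons: "\<phi> (i # r) = ((j + i) mod ?n) # r" for i r by (auto simp: \<phi>_def)
  have "encoding G ?s (f \<circ> \<phi>)"
  proof (rule encoding_reindex[OF f])
    have pi: "i = i'" if "(j + i) mod ?n = (j + i') mod ?n" "i < ?n" "i' < ?n" for i i'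
      using that cong_add_lcancel_nat[of j i i' ?n] by (simp add: cong_def)
    show "inj_on \<phi> (nodes ?s)"
    proof (rule inj_onI)
      fix q q' assume "q \<in> nodes ?s" "q' \<in> nodes ?s" "\<phi> q = \<phi> q'"
      then show "q = q'" by (cases q; cases q') (auto simp: \<phi>_Nil \<phi>_Cons Cons_in_nodes intro: pi)
    qed
    show "\<phi> ` nodes ?s \<subseteq> nodes (Node ts)"
    proof
      fix q' assume "q' \<in> \<phi> ` nodes ?s"
      then obtain q where "q \<in> nodes ?s" "q' = \<phi> q" by auto
      then show "q' \<in> nodes (Node ts)" using n
        by (cases q) (auto simp: \<phi>_Nil \<phi>_Cons Cons_in_nodes nth_rotate)
    qed
    have "sum_list (map psize (rotate j ts)) = sum_list (map psize ts)"
    proof -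
      let ?m = "j mod length ts"
      have "sum_list (map psize (rotate j ts)) = sum_list (map psize (take ?m ts @ drop ?m ts))"
        by (simp only: rotate_drop_take map_append sum_list_append add.commute)
      then show ?thesis by simp
    qed
    then show "psize ?s = psize (Node ts)" by (simp add: psize_Node)
    fix q assume q: "q \<in> nodes ?s"
    show "\<exists>k. map \<phi> (nbr_list ?s q) = rotate k (nbr_list (Node ts) (\<phi> q))"
    proof (cases q)
      case Nil
      have "map \<phi> (nbr_list ?s q) = rotate j (nbr_list (Node ts) (\<phi> q))"
        using Nil n by (intro nth_equalityI) (auto simp: nbr_list_def \<phi>_Nil \<phi>_Cons outdeg_Nil nth_rotate)
      then show ?thesis by blast
    next
      case (Cons i r)
      then have i: "i < ?n" using q by (simp add: Cons_in_nodes)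
      have "outdeg ?s (i # r) = outdeg (Node ts) (((j + i) mod ?n) # r)"
        using i by (simp add: outdeg_Cons nth_rotate)
      then have "map \<phi> (nbr_list ?s q) = rotate 0 (nbr_list (Node ts) (\<phi> q))"
        using Cons by (auto simp: nbr_list_def \<phi>_Nil \<phi>_Cons)
      then show ?thesis by blast
    qed
  qed
  then show ?thesis using n by (intro exI[of _ "f \<circ> \<phi>"]) (simp add: \<phi>_Nil \<phi>_Cons)
qed

text \<open>
  The root moves along the edge to its first child. At both ends this edge is the first one in
  \<open>nbr_list\<close>, before and after the move, so all lists of neighbours are preserved without any rotation.
\<close>

lemma encoding_flip:
  assumes f: "encoding G (Node (Node vs # us)) f"
  shows "\<exists>g. encoding G (Node (Node us # vs)) g \<and> g [] = f [0] \<and> g [0] = f []"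
proof -
  let ?t = "Node (Node vs # us)" and ?s = "Node (Node us # vs)"
  define \<phi> :: "nat list \<Rightarrow> nat list" where "\<phi> = (\<lambda>q. case q of [] \<Rightarrow> [0]
    | i # r \<Rightarrow> (case i of 0 \<Rightarrow> (case r of [] \<Rightarrow> [] | k # r \<Rightarrow> Suc k # r) | Suc k \<Rightarrow> 0 # k # r))"
  have \<phi>: "\<phi> [] = [0]" "\<phi> [0] = []" "\<phi> (0 # k # r) = Suc k # r" "\<phi> (Suc k # r) = 0 # k # r" for k r
    by (auto simp: \<phi>_def)
  have od: "outdeg (Node (a # as)) (0 # q) = outdeg a q" "outdeg (Node (a # as)) (Suc k # q) = outdeg (as ! k) q"
    for a as q k by (simp_all add: outdeg_def)
  have nd: "0 # q \<in> nodes (Node (a # as)) \<longleftrightarrow> q \<in> nodes a"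
     "Suc k # q \<in> nodes (Node (a # as)) \<longleftrightarrow> k < length as \<and> q \<in> nodes (as ! k)" for a as q k
    by (auto simp: nodes_def)
  have cases: "q = [] \<or> q = [0] \<or> (\<exists>k r. q = 0 # k # r) \<or> (\<exists>k r. q = Suc k # r)" for q :: "nat list"
    by (cases q; cases "hd q"; cases "tl q") auto
  have "encoding G ?s (f \<circ> \<phi>)"
  proof (rule encoding_reindex[OF f])
    have "\<phi> q = \<phi> q' \<Longrightarrow> q = q'" for q q' using cases[of q] cases[of q'] by (auto simp: \<phi>)
    then show "inj_on \<phi> (nodes ?s)" by (auto intro: inj_onI)
    show "\<phi> ` nodes ?s \<subseteq> nodes ?t"
    proof
      fix q' assume "q' \<in> \<phi> ` nodes ?s"
      then obtain q where "q \<in> nodes ?s" "q' = \<phi> q" by auto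
      then show "q' \<in> nodes ?t" using cases[of q] by (auto simp: \<phi> nd Cons_in_nodes[of _ _ us] Cons_in_nodes[of _ _ vs])
    qed
    show "psize ?s = psize ?t" by (simp add: psize_Node)
    fix q assume "q \<in> nodes ?s"
    have up: "map (\<lambda>i. [i]) [Suc 0..<Suc n] = map (\<lambda>i. [Suc i]) [0..<n]" for n
      by (rule nth_equalityI) (auto simp del: upt_Suc)
    from cases[of q] have "map \<phi> (nbr_list ?s q) = nbr_list ?t (\<phi> q)"
    proof (elim disjE exE)
      assume q: "q = []"
      have "nbr_list ?s q = [0] # map (\<lambda>i. [Suc i]) [0..<length vs]"
        using q by (simp add: nbr_list_def outdeg_Nil upt_conv_Cons up del: upt_Suc)
      moreover have "nbr_list ?t [0] = [] # map (\<lambda>i. [0, i]) [0..<length vs]"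
        by (simp add: nbr_list_def od outdeg_Nil)
      ultimately show ?thesis using q by (simp add: \<phi>)
    next
      assume q: "q = [0]"
      have "nbr_list ?t [] = [0] # map (\<lambda>i. [Suc i]) [0..<length us]"
        by (simp add: nbr_list_def outdeg_Nil upt_conv_Cons up del: upt_Suc)
      moreover have "nbr_list ?s [0] = [] # map (\<lambda>i. [0, i]) [0..<length us]"
        by (simp add: nbr_list_def od outdeg_Nil)
      ultimately show ?thesis using q by (simp add: \<phi>)
    next
      fix k r assume q: "q = 0 # k # r"
      then show ?thesis by (cases "r = []") (simp_all add: nbr_list_def od outdeg_Cons \<phi>)
    next
      fix k r assume q: "q = Suc k # r"
      then show ?thesis by (cases "r = []") (simp_all add: nbr_list_def od outdeg_Cons \<phi>)
    qed
    then show "\<exists>k. map \<phi> (nbr_list ?s q) = rotate k (nbr_list ?t (\<phi> q))" by (intro exI[of _ 0]) simp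
  qed
  then show ?thesis by (intro exI[of _ "f \<circ> \<phi>"]) (simp add: \<phi>)
qed

section \<open>Automorphisms fix a vertex or flip an edge\<close>

context plane_tree
begin

text \<open>
  A vertex none of whose branches contains more than half of all vertices. Automorphisms permute such
  vertices, and there are few of them.
\<close>

definition centroid :: "'v \<Rightarrow> bool" where
  "centroid y \<longleftrightarrow> y \<in> verts G \<and> (\<forall>z\<in>nbhd G y. 2 * card (branch y z) \<le> card (verts G))"

lemma edge_exists:
  assumes "card (verts G) \<ge> 2" "y \<in> verts G" shows "\<exists>x. (y, x) \<in> adj G"
proof -
  have "verts G \<noteq> {y}" using assms by auto
  then obtain w where w: "w \<in> verts G" "w \<noteq> y" using assms by auto
  then have "(y, w) \<in> (adj G)\<^sup>*" using connected assms by blast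
  then show ?thesis using w by (auto elim: converse_rtranclE)
qed

lemma centroid_exists:
  assumes n: "card (verts G) \<ge> 2" shows "\<exists>y. centroid y"
proof -
  let ?n = "card (verts G)"
  \<comment> \<open>Among the directed edges pointing to at least half of the vertices, take one pointing to as few as possible.\<close>
  define P where "P = (\<lambda>(x, y). (x, y) \<in> adj G \<and> ?n \<le> 2 * card (branch x y))"
  have "verts G \<noteq> {}" using n by auto
  then obtain x y where xy: "(x, y) \<in> adj G" using edge_exists[OF n] by blast
  have "P (x, y) \<or> P (y, x)"
    unfolding P_def using xy adj_sym card_branch_opposite[OF xy] by auto
  then obtain e where "P e" by blast
  then obtain e where e: "P e" and min: "\<And>e'. P e' \<Longrightarrow> card (branch (fst e) (snd e)) \<le> card (branch (fst e') (snd e'))"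
    using arg_min_natI[of P e "\<lambda>e. card (branch (fst e) (snd e))"] arg_min_nat_le[of P _ "\<lambda>e. card (branch (fst e) (snd e))"] by blast
  obtain x y where [simp]: "e = (x, y)" by (cases e)
  have xy: "(x, y) \<in> adj G" "?n \<le> 2 * card (branch x y)" using e by (auto simp: P_def)
  have "2 * card (branch y z) \<le> ?n" if yz: "(y, z) \<in> adj G" for z
  proof (cases "z = x")
    case True
    then show ?thesis using card_branch_opposite[OF xy(1)] xy(2) by simp
  next
    case False
    have "branch y z \<subset> branch x y"
      using branch_sub[OF xy(1) yz False] branch_avoids[OF adj_neq[OF yz]] branch_self[of y x] by auto
    then have "card (branch y z) < card (branch x y)" by (rule psubset_card_mono[OF finite_branch[OF xy(1)]])
    then have "\<not> P (y, z)" using min[of "(y, z)"] by auto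
    then show ?thesis using yz by (auto simp: P_def)
  qed
  then show ?thesis using xy adj_verts by (auto simp: centroid_def nbhd_def intro!: exI[of _ y])
qed

text \<open>
  The branch at \<open>y'\<close> containing \<open>y\<close> includes everything that is not in the branch at \<open>y\<close> containing \<open>y'\<close>. As
  neither has more than \<open>n / 2\<close> vertices, they are complementary halves and are joined by one edge.
\<close>

lemma two_centroids:
  assumes c: "centroid y" "centroid y'" and ne: "y \<noteq> y'"
  shows "(y, y') \<in> adj G" "2 * card (branch y y') = card (verts G)"
proof -
  let ?n = "card (verts G)"
  have v: "y \<in> verts G" "y' \<in> verts G" using c by (auto simp: centroid_def)
  obtain z where z: "(y, z) \<in> adj G" "y' \<in> branch y z"
    using verts_decompose[OF v(1)] v ne by (auto simp: nbhd_def)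
  obtain z' where z': "(y', z') \<in> adj G" "y \<in> branch y' z'"
    using verts_decompose[OF v(2)] v ne by (auto simp: nbhd_def)
  have sub: "branch z y \<subseteq> branch y' z'"
  proof
    fix w assume "w \<in> branch z y"
    then have "(y, w) \<in> (avoid z)\<^sup>*" by (simp add: branch_def)
    then show "w \<in> branch y' z'"
    proof (induction rule: rtrancl_induct)
      case base show ?case by (fact z')
    next
      case (step u v)
      have "v \<in> branch z y" using rtrancl_into_rtrancl[OF step(1,2)] by (simp add: branch_def)
      then have "v \<noteq> y'" using branch_opposite(1)[OF z(1)] z(2) by auto
      then show ?case using branch_step[OF step(3) _ adj_neq[OF z'(1)]] step(2) by (auto simp: avoid_def)
    qed
  qed
  have le: "card (branch z y) \<le> card (branch y' z')" by (rule card_mono[OF finite_branch[OF z'(1)] sub])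
  have half: "2 * card (branch y z) \<le> ?n" "2 * card (branch y' z') \<le> ?n"
    using c z z' by (auto simp: centroid_def nbhd_def)
  have sum: "card (branch y z) + card (branch z y) = ?n" by (rule card_branch_opposite[OF z(1)])
  have eq: "2 * card (branch y z) = ?n" "card (branch z y) = card (branch y' z')" using half sum le by linarith+
  have same: "branch z y = branch y' z'" by (rule card_subset_eq[OF finite_branch[OF z'(1)] sub eq(2)])
  have "z' = y \<and> y' = z"
    by (rule branch_exit[OF adj_sym[OF z(1)]])
       (use same branch_self[of z' y'] branch_avoids[OF adj_neq[OF z'(1)]] adj_sym[OF z'(1)] in auto)
  then show "(y, y') \<in> adj G" "2 * card (branch y y') = card (verts G)" using z eq by auto
qed

text \<open>
  If an automorphism moves a centroid \<open>y\<close>, then \<open>y\<close> and its image are the two ends of an edge splitting the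
  tree into halves. The image of this edge splits the tree in the same way and also contains \<open>\<sigma> y\<close>; there
  is no room for two such edges at one vertex, so the edge is mapped to itself.
\<close>

theorem automorphism_fixes_vertex_or_flips_edge:
  assumes n: "card (verts G) \<ge> 2" and \<sigma>: "bij_betw \<sigma> (verts G) (verts G)"
    and pres: "\<And>u v. (u, v) \<in> adj G \<Longrightarrow> (\<sigma> u, \<sigma> v) \<in> adj G"
    and pres': "\<And>u v. u \<in> verts G \<Longrightarrow> v \<in> verts G \<Longrightarrow> (\<sigma> u, \<sigma> v) \<in> adj G \<Longrightarrow> (u, v) \<in> adj G"
  shows "(\<exists>y\<in>verts G. \<sigma> y = y) \<or> (\<exists>x y. (x, y) \<in> adj G \<and> \<sigma> x = y \<and> \<sigma> y = x)"
proof -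
  let ?n = "card (verts G)"
  have inj: "inj_on \<sigma> (verts G)" and surj: "\<sigma> ` verts G = verts G" using \<sigma> by (auto simp: bij_betw_def)
  have le: "card (branch x y) \<le> card (branch (\<sigma> x) (\<sigma> y))" if xy: "(x, y) \<in> adj G" for x y
  proof -
    have "\<sigma> w \<in> branch (\<sigma> x) (\<sigma> y)" if "w \<in> branch x y" for w
    proof -
      from that have "(y, w) \<in> (avoid x)\<^sup>*" by (simp add: branch_def)
      then show ?thesis
      proof (induction rule: rtrancl_induct)
        case base show ?case by (rule branch_self)
      next
        case (step u v)
        then have uv: "(u, v) \<in> adj G" "v \<noteq> x" by (auto simp: avoid_def)
        then have "\<sigma> v \<noteq> \<sigma> x" using inj xy adj_verts by (auto dest: inj_onD)
        then show ?case using branch_step[OF step(3) pres[OF uv(1)]] adj_neq[OF pres[OF xy]] by blast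
      qed
    qed
    then have "\<sigma> ` branch x y \<subseteq> branch (\<sigma> x) (\<sigma> y)" by auto
    then have "card (\<sigma> ` branch x y) \<le> card (branch (\<sigma> x) (\<sigma> y))"
      by (rule card_mono[OF finite_branch[OF pres[OF xy]]])
    then show ?thesis using card_image[OF inj_on_subset[OF inj branch_verts[OF xy]]] by simp
  qed
  have eq: "card (branch (\<sigma> x) (\<sigma> y)) = card (branch x y)" if xy: "(x, y) \<in> adj G" for x y
    using le[OF xy] le[OF adj_sym[OF xy]] card_branch_opposite[OF xy] card_branch_opposite[OF pres[OF xy]] by linarith
  obtain y where y: "centroid y" using centroid_exists[OF n] by blast
  then have yv: "y \<in> verts G" by (simp add: centroid_def)
  have y': "centroid (\<sigma> y)"
    unfolding centroid_def
  proof (intro conjI ballI)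
    show "\<sigma> y \<in> verts G" using surj yv by auto
    fix z assume "z \<in> nbhd G (\<sigma> y)"
    then have z: "(\<sigma> y, z) \<in> adj G" by (simp add: nbhd_def)
    then obtain u where u: "u \<in> verts G" "z = \<sigma> u" using surj adj_verts by blast
    then have "(y, u) \<in> adj G" using pres' z yv by blast
    then show "2 * card (branch (\<sigma> y) z) \<le> ?n" using eq u y by (auto simp: centroid_def nbhd_def)
  qed
  show ?thesis
  proof (cases "\<sigma> y = y")
    case True then show ?thesis using yv by blast
  next
    case False
    note t = two_centroids[OF y y' False[symmetric]]
    have "\<sigma> (\<sigma> y) = y"
    proof (rule ccontr)
      assume ne: "\<sigma> (\<sigma> y) \<noteq> y"
      have a: "(\<sigma> y, \<sigma> (\<sigma> y)) \<in> adj G" by (rule pres[OF t(1)])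
      have b: "(\<sigma> y, y) \<in> adj G" by (rule adj_sym[OF t(1)])
      have "2 * card (branch (\<sigma> y) (\<sigma> (\<sigma> y))) = ?n" using eq[OF t(1)] t(2) by simp
      moreover have "2 * card (branch (\<sigma> y) y) = ?n" using card_branch_opposite[OF t(1)] t(2) by simp
      moreover have "card (branch (\<sigma> y) (\<sigma> (\<sigma> y)) \<union> branch (\<sigma> y) y)
          = card (branch (\<sigma> y) (\<sigma> (\<sigma> y))) + card (branch (\<sigma> y) y)"
        by (rule card_Un_disjoint[OF finite_branch[OF a] finite_branch[OF b] branch_disjoint[OF a b ne]])
      moreover have "card (branch (\<sigma> y) (\<sigma> (\<sigma> y)) \<union> branch (\<sigma> y) y) < ?n"
      proof (rule psubset_card_mono[OF finite_verts])
        have "\<sigma> y \<notin> branch (\<sigma> y) (\<sigma> (\<sigma> y)) \<union> branch (\<sigma> y) y"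
          using branch_avoids[OF adj_neq[OF a]] branch_avoids[OF adj_neq[OF b]] by blast
        moreover have "\<sigma> y \<in> verts G" using b adj_verts by auto
        ultimately show "branch (\<sigma> y) (\<sigma> (\<sigma> y)) \<union> branch (\<sigma> y) y \<subset> verts G"
          using branch_verts[OF a] branch_verts[OF b] by blast
      qed
      ultimately show False by linarith
    qed
    then show ?thesis using t(1) by blast
  qed
qed

end

section \<open>Rootings of an unrooted plane tree\<close>

lemma usize_forget_root: "usize (forget_root t) = psize t"
  by transfer (simp add: psize_def)

lemma forget_root_eq_iff: "forget_root s = forget_root t \<longleftrightarrow> (\<exists>f. encoding (plane_graph_of t) s f)"
proof -
  have "forget_root s = forget_root t \<longleftrightarrow> plane_tree_equiv (plane_graph_of s) (plane_graph_of t)"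
    by transfer simp
  then show ?thesis
    using encoding_imp_iso[OF plane_tree_plane_graph_of, of t s]
      iso_imp_encoding[OF plane_tree_plane_graph_of, of s t]
    unfolding plane_tree_equiv_def using is_plane_tree_plane_graph_of by blast
qed

text \<open>
  Rooting at any directed edge; two vertices are needed for an edge to exist.
\<close>

lemma forget_root_surj: "usize U \<ge> 2 \<Longrightarrow> \<exists>t. forget_root t = U"
proof transfer
  fix G :: "nat list rot_graph"
  assume "plane_tree_equiv G G" and n: "2 \<le> card (verts G)"
  then have G: "plane_tree G" by (simp add: plane_tree_equiv_def plane_tree_def)
  have "verts G \<noteq> {}" using n by auto
  then obtain a b where ab: "(a, b) \<in> adj G" using plane_tree.edge_exists[OF G n] by blast
  obtain t f where "encoding G t f" using plane_tree.encoding_exists[OF G ab] by blast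
  then have "plane_iso (plane_graph_of t) G f" by (rule encoding_imp_iso[OF G])
  then show "\<exists>t. plane_tree_equiv (plane_graph_of t) G"
    using G is_plane_tree_plane_graph_of by (auto simp: plane_tree_equiv_def plane_tree_def)
qed

lemma uweight_forget_root:
  assumes "ts \<noteq> []"
  shows "uweight w (forget_root (Node ts)) = w (length ts - 1) * prod_list (map (pweight w) ts)"
proof -
  have nb: "card (nbhd (plane_graph_of t) q) = length (nbr_list t q)" if "q \<in> nodes t" for t q
    using enumerates_nbr_list[OF that] by (metis distinct_card enumerates_nbhd_def)
  have "uweight w (forget_root (Node ts)) = (\<Prod>q\<in>nodes (Node ts). w (length (nbr_list (Node ts) q) - 1))"
    by transfer (auto simp: nb intro!: prod.cong)
  also have "\<dots> = w (length ts - 1) * (\<Prod>q\<in>(\<Union>i<length ts. (#) i ` nodes (ts ! i)). w (length (nbr_list (Node ts) q) - 1))"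
    unfolding nodes_Node by (subst prod.insert) (auto simp: finite_nodes nbr_list_def outdeg_Nil)
  also have "(\<Prod>q\<in>(\<Union>i<length ts. (#) i ` nodes (ts ! i)). w (length (nbr_list (Node ts) q) - 1))
      = (\<Prod>i<length ts. \<Prod>q\<in>(#) i ` nodes (ts ! i). w (length (nbr_list (Node ts) q) - 1))"
    by (rule prod.UNION_disjoint) (auto simp: finite_nodes)
  also have "\<dots> = (\<Prod>i<length ts. pweight w (ts ! i))"
    by (simp add: pweight_def prod.reindex nbr_list_def outdeg_Cons)
  also have "\<dots> = prod_list (map (pweight w) ts)"
    by (simp add: prod.list_conv_set_nth atLeast0LessThan)
  finally show ?thesis .
qed

lemma card_adj_plane_graph_of: "finite (adj (plane_graph_of t))" "card (adj (plane_graph_of t)) = 2 * (psize t - 1)"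
proof -
  let ?N = "nodes t - {[]}"
  have adj: "adj (plane_graph_of t) = (\<lambda>p. (p, butlast p)) ` ?N \<union> (\<lambda>p. (butlast p, p)) ` ?N"
  proof (rule set_eqI)
    fix e show "e \<in> adj (plane_graph_of t) \<longleftrightarrow> e \<in> (\<lambda>p. (p, butlast p)) ` ?N \<union> (\<lambda>p. (butlast p, p)) ` ?N"
    proof (cases e)
      case (Pair p q)
      have parent: "butlast r \<in> nodes t" if "r \<in> nodes t" "r \<noteq> []" for r
        using that by (metis append_butlast_last_id snoc_in_nodes)
      have "e \<in> (\<lambda>p. (p, butlast p)) ` ?N \<longleftrightarrow> p \<in> nodes t \<and> p \<noteq> [] \<and> q = butlast p"
        "e \<in> (\<lambda>p. (butlast p, p)) ` ?N \<longleftrightarrow> q \<in> nodes t \<and> q \<noteq> [] \<and> p = butlast q" using Pair by auto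
      moreover have "p \<noteq> [] \<and> q = butlast p \<longleftrightarrow> (\<exists>i. p = q @ [i])" for p q :: "nat list"
        by (metis append_butlast_last_id butlast_snoc snoc_eq_iff_butlast)
      ultimately show ?thesis using Pair parent by (auto simp: adj_plane_graph_of snoc_in_nodes)
    qed
  qed
  show "finite (adj (plane_graph_of t))" unfolding adj by (simp add: finite_nodes)
  have disj: "(\<lambda>p. (p, butlast p)) ` ?N \<inter> (\<lambda>p. (butlast p, p)) ` ?N = {}"
  proof -
    have False if "p \<noteq> []" "p = butlast q" "q = butlast p" for p q :: "nat list"
    proof -
      have "length p = length q - 1" "length q = length p - 1"
        using that(2,3) by (metis length_butlast)+
      then have "length p = 0" by linarith
      then show False using that(1) by simp
    qed
    then show ?thesis by fastforce
  qed
  have "card (adj (plane_graph_of t)) = card ((\<lambda>p. (p, butlast p)) ` ?N) + card ((\<lambda>p. (butlast p, p)) ` ?N)"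
    unfolding adj by (rule card_Un_disjoint) (use disj in \<open>auto simp: finite_nodes\<close>)
  also have "\<dots> = card ?N + card ?N" by (intro arg_cong2[of _ _ _ _ "(+)"] card_image) (auto simp: inj_on_def)
  also have "card ?N = psize t - 1" by (simp add: psize_def card_Diff_singleton)
  finally show "card (adj (plane_graph_of t)) = 2 * (psize t - 1)" by simp
qed

lemma join_trees_commute: "join_trees T V = join_trees V T"
proof -
  obtain us vs where [simp]: "T = Node us" "V = Node vs" by (cases T; cases V)
  have "\<exists>f. encoding (plane_graph_of (Node (V # us))) (Node (T # vs)) f"
    using encoding_flip[OF encoding_id, of vs us] by auto
  then have "forget_root (Node (T # vs)) = forget_root (Node (V # us))" by (simp only: forget_root_eq_iff)
  then show ?thesis by (simp add: join_trees_def)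
qed

text \<open>
  Sending a directed edge to the planted tree obtained by rooting there maps the \<open>2 * (n - 1)\<close> directed
  edges onto the rootings of \<open>U\<close>. If two directed edges give the same planted tree, the two encodings
  of this tree differ by an automorphism \<open>\<sigma>\<close> which fixes no directed edge. If \<open>\<sigma>\<close> fixes a vertex, it
  rotates the branches around it, so their sequence is periodic; if it flips an edge, the two trees on
  its sides are equal.
\<close>

theorem rootings:
  assumes n: "usize U \<ge> 2"
  shows "finite {t. forget_root t = U}" "{t. forget_root t = U} \<noteq> {}"
    and "card {t. forget_root t = U} \<le> 2 * (usize U - 1)"
    and "card {t. forget_root t = U} \<noteq> 2 * (usize U - 1) \<Longrightarrow>
       (\<exists>V. U = join_trees V V) \<or>
       (\<exists>xs j. U = forget_root (Node xs) \<and> 0 < j \<and> j < length xs \<and> rotate j xs = xs)"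
proof -
  obtain t0 where t0: "forget_root t0 = U" using forget_root_surj[OF n] by blast
  then show "{t. forget_root t = U} \<noteq> {}" by auto
  have size: "usize U = psize t0" using t0 usize_forget_root by metis
  define G where "G = plane_graph_of t0"
  have G: "plane_tree G" unfolding G_def by (rule plane_tree_plane_graph_of)
  interpret plane_tree G by (rule G)
  have nG: "card (verts G) \<ge> 2" using n size by (simp add: G_def psize_def)
  have fib: "forget_root t = U \<longleftrightarrow> (\<exists>f. encoding G t f)" for t
    unfolding t0[symmetric] G_def by (rule forget_root_eq_iff)
  have ne: "children t \<noteq> []" if "encoding G t f" for t f
  proof
    assume "children t = []"
    then have "psize t = 1" by (cases t) (simp add: psize_Node)
    moreover have "psize t = psize t0" using that fib[of t] t0 usize_forget_root by metis
    ultimately show False using n size by simp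
  qed
  have edge: "(f [], f [0]) \<in> adj G" if "encoding G t f" for t f
  proof -
    have "[0] \<in> nodes t" using ne[OF that] by (cases t) (auto simp: nodes_def)
    then have "([], [0]) \<in> adj (plane_graph_of t)" by (simp add: adj_plane_graph_of)
    then show ?thesis using encoding_imp_iso[OF G that] \<open>[0] \<in> nodes t\<close> by (auto simp: plane_iso_def)
  qed
  define te where "te = (\<lambda>e. SOME t. \<exists>f. encoding G t f \<and> f [] = fst e \<and> f [0] = snd e)"
  have te: "\<exists>f. encoding G (te e) f \<and> f [] = fst e \<and> f [0] = snd e" if "e \<in> adj G" for e
  proof -
    have "\<exists>t f. encoding G t f \<and> f [] = fst e \<and> f [0] = snd e"
      using encoding_exists[of "fst e" "snd e"] that by auto
    then show ?thesis unfolding te_def by (rule someI_ex)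
  qed
  have te_eq: "te (f [], f [0]) = t" if enc: "encoding G t f" for t f
  proof -
    obtain g where "encoding G (te (f [], f [0])) g" "g [] = f []" "g [0] = f [0]"
      using te[OF edge[OF enc]] by auto
    then show ?thesis using encoding_unique(1)[of G _ g t f] enc by simp
  qed
  have img: "{t. forget_root t = U} = te ` adj G"
  proof (intro set_eqI iffI)
    fix t assume "t \<in> {t. forget_root t = U}"
    then obtain f where "encoding G t f" using fib by blast
    then show "t \<in> te ` adj G" using te_eq edge by (metis image_eqI)
  next
    fix t assume "t \<in> te ` adj G"
    then show "t \<in> {t. forget_root t = U}" using te fib by blast
  qed
  have cardG: "card (adj G) = 2 * (usize U - 1)" and finG: "finite (adj G)"
    using card_adj_plane_graph_of[of t0] size by (auto simp: G_def)
  show "finite {t. forget_root t = U}" unfolding img using finG by simp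
  show "card {t. forget_root t = U} \<le> 2 * (usize U - 1)"
    unfolding img cardG[symmetric] by (rule card_image_le[OF finG])
  assume "card {t. forget_root t = U} \<noteq> 2 * (usize U - 1)"
  then have "\<not> inj_on te (adj G)" unfolding img cardG[symmetric] using card_image by blast
  then obtain e e' where e: "e \<in> adj G" "e' \<in> adj G" "e \<noteq> e'" "te e = te e'" by (auto simp: inj_on_def)
  define t where "t = te e"
  obtain f where f: "encoding G t f" "f [] = fst e" "f [0] = snd e" using te[OF e(1)] by (auto simp: t_def)
  obtain g where g: "encoding G t g" "g [] = fst e'" "g [0] = snd e'" using te[OF e(2)] e(4) by (auto simp: t_def)
  have bf: "bij_betw f (nodes t) (verts G)" and bg: "bij_betw g (nodes t) (verts G)"
    using f g by (auto simp: encoding_def)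
  let ?H = "plane_graph_of t"
  have H: "plane_tree ?H" by (rule plane_tree_plane_graph_of)
  define f' where "f' = inv_into (nodes t) f"
  have bf': "bij_betw f' (verts G) (nodes t)" unfolding f'_def by (rule bij_betw_inv_into[OF bf])
  have ff': "f (f' x) = x" if "x \<in> verts G" for x
    unfolding f'_def by (rule bij_betw_inv_into_right[OF bf that])
  have f'v: "f' x \<in> nodes t" if "x \<in> verts G" for x using bf' that by (auto simp: bij_betw_def)
  define \<sigma> where "\<sigma> = g \<circ> f'"
  have \<sigma>: "bij_betw \<sigma> (verts G) (verts G)" unfolding \<sigma>_def by (rule bij_betw_trans[OF bf' bg])
  have adj_f: "(x, y) \<in> adj G \<longleftrightarrow> (f' x, f' y) \<in> adj ?H" if "x \<in> verts G" "y \<in> verts G" for x y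
    using encoding_imp_iso[OF G f(1)] f'v[OF that(1)] f'v[OF that(2)] ff'[OF that(1)] ff'[OF that(2)]
    by (auto simp: plane_iso_def)
  have adj_\<sigma>: "(x, y) \<in> adj G \<longleftrightarrow> (\<sigma> x, \<sigma> y) \<in> adj G" if "x \<in> verts G" "y \<in> verts G" for x y
    unfolding adj_f[OF that] using encoding_imp_iso[OF G g(1)] f'v[OF that(1)] f'v[OF that(2)]
    by (auto simp: plane_iso_def \<sigma>_def)
  \<comment> \<open>Both \<open>f\<close> and \<open>g\<close> can be re-rooted simultaneously at any directed edge.\<close>
  have reroot: "\<exists>s fh gh. encoding G s fh \<and> encoding G s gh \<and> fh [] = x \<and> fh [0] = y \<and> gh [] = \<sigma> x \<and> gh [0] = \<sigma> y
      \<and> (\<forall>z\<in>verts G. \<exists>q\<in>nodes s. fh q = z \<and> gh q = \<sigma> z)" if xy: "(x, y) \<in> adj G" for x y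
  proof -
    have v: "x \<in> verts G" "y \<in> verts G" using xy adj_verts by auto
    obtain s h where h: "encoding ?H s h" "h [] = f' x" "h [0] = f' y"
      using plane_tree.encoding_exists[OF H] adj_f[OF v] xy by metis
    have "\<exists>q\<in>nodes s. f (h q) = z \<and> g (h q) = \<sigma> z" if z: "z \<in> verts G" for z
    proof -
      have "f' z \<in> h ` nodes s" using h(1) f'v[OF z] by (simp add: encoding_def bij_betw_def)
      then obtain q where "q \<in> nodes s" "h q = f' z" by auto
      then show ?thesis using ff'[OF z] by (intro bexI[of _ q]) (auto simp: \<sigma>_def)
    qed
    then show ?thesis
      using encoding_comp[OF G f(1) h(1)] encoding_comp[OF G g(1) h(1)] h ff'[OF v(1)] ff'[OF v(2)]
      by (intro exI[of _ s] exI[of _ "f \<circ> h"] exI[of _ "g \<circ> h"]) (auto simp: \<sigma>_def)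
  qed
  have moved: "\<not> (\<sigma> x = x \<and> \<sigma> y = y)" if xy: "(x, y) \<in> adj G" for x y
  proof
    assume fixed: "\<sigma> x = x \<and> \<sigma> y = y"
    obtain s fh gh where h: "encoding G s fh" "encoding G s gh" "fh [] = x" "fh [0] = y" "gh [] = \<sigma> x" "gh [0] = \<sigma> y"
      and all: "\<forall>z\<in>verts G. \<exists>q\<in>nodes s. fh q = z \<and> gh q = \<sigma> z"
      using reroot[OF xy] by blast
    have same: "fh q = gh q" if "q \<in> nodes s" for q
      by (rule encoding_unique(2)[OF h(1,2) _ _ that]) (use h fixed in auto)
    have \<sigma>_id: "\<sigma> z = z" if z: "z \<in> verts G" for z
    proof -
      obtain q where "q \<in> nodes s" "fh q = z" "gh q = \<sigma> z" using all z by blast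
      then show ?thesis using same[of q] by simp
    qed
    have "g q = f q" if "q \<in> nodes t" for q
    proof -
      have "f q \<in> verts G" using bf that by (auto simp: bij_betw_def)
      then have "g (f' (f q)) = f q" using \<sigma>_id[of "f q"] by (simp add: \<sigma>_def)
      then show ?thesis using bij_betw_inv_into_left[OF bf that] by (simp add: f'_def)
    qed
    moreover have "[0] \<in> nodes t" using ne[OF f(1)] by (cases t) (auto simp: nodes_def)
    ultimately have "e = e'" using f g by (auto simp: prod_eq_iff)
    then show False using e by simp
  qed
  have "(\<exists>y\<in>verts G. \<sigma> y = y) \<or> (\<exists>x y. (x, y) \<in> adj G \<and> \<sigma> x = y \<and> \<sigma> y = x)"
  proof (rule automorphism_fixes_vertex_or_flips_edge[OF nG \<sigma>])
    fix u v assume uv: "(u, v) \<in> adj G"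
    then have "u \<in> verts G" "v \<in> verts G" using adj_verts by auto
    then show "(\<sigma> u, \<sigma> v) \<in> adj G" using adj_\<sigma>[of u v] uv by simp
  next
    fix u v assume "u \<in> verts G" "v \<in> verts G" "(\<sigma> u, \<sigma> v) \<in> adj G"
    then show "(u, v) \<in> adj G" using adj_\<sigma>[of u v] by simp
  qed
  then show "(\<exists>V. U = join_trees V V) \<or>
       (\<exists>xs j. U = forget_root (Node xs) \<and> 0 < j \<and> j < length xs \<and> rotate j xs = xs)"
  proof (elim disjE bexE exE conjE)
    fix y assume y: "y \<in> verts G" "\<sigma> y = y"
    obtain x where yx: "(y, x) \<in> adj G" using edge_exists[OF nG y(1)] by blast
    obtain s fh gh where h: "encoding G s fh" "encoding G s gh" "fh [] = y" "fh [0] = x" "gh [] = \<sigma> y" "gh [0] = \<sigma> x"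
      using reroot[OF yx] by blast
    obtain xs where s: "s = Node xs" by (cases s)
    have xs: "xs \<noteq> []" using ne[OF h(1)] s by simp
    have "(y, \<sigma> x) \<in> adj G" using edge[OF h(2)] h y by simp
    moreover have "enumerates_nbhd G (fh []) (map fh (nbr_list s []))"
      using h(1) nodes_Nil unfolding encoding_def by blast
    ultimately have "\<sigma> x \<in> set (map fh (nbr_list s []))"
      unfolding h(3) enumerates_nbhd_def by (simp only: nbhd_def mem_Collect_eq)
    then obtain j where j: "j < length xs" "\<sigma> x = fh [j]" by (auto simp: nbr_list_def s outdeg_Nil)
    have "\<sigma> x \<noteq> x" using moved[OF yx] y by blast
    then have "j \<noteq> 0" using j h(4) by (cases j) auto
    obtain k where k: "encoding G (Node (rotate j xs)) k" "k [] = y" "k [0] = \<sigma> x"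
      using encoding_rotate[of G xs fh j] h(1,3) xs j by (auto simp: s)
    \<comment> \<open>The tree rooted at \<open>y\<close> with first child \<open>x\<close> is the same as the one with first child \<open>\<sigma> x\<close>.\<close>
    have eq: "Node xs = Node (rotate j xs)"
      unfolding s[symmetric] by (rule encoding_unique(1)[OF h(2) k(1)]) (use h k y in auto)
    have "rotate j xs = xs" by (rule ptree.inject[THEN iffD1, OF eq[symmetric]])
    moreover have "U = forget_root (Node xs)" using fib[of s] h(1) s by blast
    moreover have "0 < j" using \<open>j \<noteq> 0\<close> by simp
    ultimately have "U = forget_root (Node xs) \<and> 0 < j \<and> j < length xs \<and> rotate j xs = xs"
      using j(1) by (intro conjI)
    then show ?thesis by blast
  next
    fix x y assume xy: "(x, y) \<in> adj G" "\<sigma> x = y" "\<sigma> y = x"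
    obtain s fh gh where h: "encoding G s fh" "encoding G s gh" "fh [] = x" "fh [0] = y" "gh [] = \<sigma> x" "gh [0] = \<sigma> y"
      using reroot[OF xy(1)] by blast
    obtain V us where Vus: "children s = V # us" using ne[OF h(1)] by (cases "children s") auto
    obtain vs where "V = Node vs" by (cases V)
    with Vus have s: "s = Node (Node vs # us)" by (cases s) simp
    obtain k where k: "encoding G (Node (Node us # vs)) k" "k [] = y" "k [0] = x"
      using encoding_flip[of G vs us fh] h by (auto simp: s)
    have "s = Node (Node us # vs)"
      by (rule encoding_unique(1)[OF h(2) k(1)]) (use h k xy in auto)
    then have "us = vs" using s by (metis ptree.inject list.inject)
    moreover have "forget_root s = U" using fib h(1) by blast
    ultimately have "U = join_trees (Node vs) (Node vs)" using s by (simp add: join_trees_def)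
    then show ?thesis by blast
  qed
qed

section \<open>Weights of unrooted trees and of pairs of planted trees\<close>

definition pairs :: "nat \<Rightarrow> (ptree \<times> ptree) set" where
  "pairs n = {(T, V). psize T + psize V = n}"

definition pair_total :: "(nat \<Rightarrow> real) \<Rightarrow> nat \<Rightarrow> real" where
  "pair_total w n = (\<Sum>(T, V)\<in>pairs n. pweight w T * pweight w V)"

lemma finite_pairs: "finite (pairs n)"
  by (rule finite_subset[of _ "{t. psize t \<le> n} \<times> {t. psize t \<le> n}"]) (auto simp: pairs_def finite_psize_le)

lemma pairs_sum:
  "(\<Sum>(T, V)\<in>pairs n. h T V) = (\<Sum>V | psize V \<le> n. \<Sum>T | psize T = n - psize V. (h T V :: real))"
proof -
  have "(\<Sum>V | psize V \<le> n. \<Sum>T | psize T = n - psize V. h T V)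
      = (\<Sum>(V, T)\<in>(SIGMA V:{V. psize V \<le> n}. {T. psize T = n - psize V}). h T V)"
    by (rule sum.Sigma) (auto simp: finite_psize_le finite_psize_eq)
  also have "\<dots> = (\<Sum>(T, V)\<in>pairs n. h T V)"
    by (rule sum.reindex_bij_witness[of _ prod.swap prod.swap]) (auto simp: pairs_def)
  finally show ?thesis by simp
qed

lemma pair_total_fps: "pair_total w n = fps_nth (planted_fps w ^ 2) n"
proof -
  have "pair_total w n = (\<Sum>V | psize V \<le> n. pweight w V * planted_total w (n - psize V))"
    unfolding pair_total_def by (subst pairs_sum) (simp add: planted_total_def sum_distrib_left mult.commute)
  also have "\<dots> = (\<Sum>i\<in>{0..n}. \<Sum>V | V \<in> {V. psize V \<le> n} \<and> psize V = i. pweight w V * planted_total w (n - psize V))"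
    by (rule sum.group[symmetric]) (auto simp: finite_psize_le)
  also have "\<dots> = (\<Sum>i=0..n. planted_total w i * planted_total w (n - i))"
    unfolding planted_total_def[of w] sum_distrib_right
    by (intro sum.cong refl) (auto simp: planted_total_def)
  finally show ?thesis by (simp add: power2_eq_square fps_mult_nth fps_nth_planted_fps)
qed

lemma pairs_swap_sum: "(\<Sum>(T, V)\<in>pairs n. h T V) = (\<Sum>(T, V)\<in>pairs n. (h V T :: real))"
  by (rule sum.reindex_bij_witness[of _ prod.swap prod.swap]) (auto simp: pairs_def)

lemma psize_join: "psize (Node (V # children T)) = psize T + psize V"
  by (cases T) (simp add: psize_Node)

lemma usize_join_trees: "usize (join_trees T V) = psize T + psize V"
  by (simp add: join_trees_def usize_forget_root psize_join)

lemma uweight_join_trees: "uweight w (join_trees T V) = pweight w T * pweight w V"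
  by (cases T) (simp add: join_trees_def uweight_forget_root pweight_Node)

text \<open>
  A rooting \<open>Node (V # us)\<close> is the same as the pair \<open>(Node us, V)\<close>, so this is also the number of ways to
  obtain \<open>U\<close> by joining two planted trees.
\<close>

definition rooting_count :: "uptree \<Rightarrow> nat" where
  "rooting_count U = card {t. forget_root t = U}"

lemma pairs_join_bij:
  assumes "usize U \<ge> 2"
  shows "bij_betw (\<lambda>(T, V). Node (V # children T)) {(T, V). join_trees T V = U} {t. forget_root t = U}"
proof (rule bij_betw_byWitness[where f' = "\<lambda>t. (Node (tl (children t)), hd (children t))"])
  have ne: "children t \<noteq> []" if "forget_root t = U" for t
  proof
    assume "children t = []"
    then have "psize t = 1" by (cases t) (simp add: psize_Node)
    then show False using that assms usize_forget_root[of t] by simp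
  qed
  show "\<forall>t\<in>{t. forget_root t = U}. (\<lambda>(T, V). Node (V # children T)) (Node (tl (children t)), hd (children t)) = t"
    using ne by auto
  show "(\<lambda>t. (Node (tl (children t)), hd (children t))) ` {t. forget_root t = U} \<subseteq> {(T, V). join_trees T V = U}"
    using ne by (auto simp: join_trees_def)
qed (auto simp: join_trees_def)

lemma rooting_count_pairs: "usize U \<ge> 2 \<Longrightarrow> card {(T, V). join_trees T V = U} = rooting_count U"
  unfolding rooting_count_def by (rule bij_betw_same_card[OF pairs_join_bij])

lemma usize_image: "n \<ge> 2 \<Longrightarrow> {U. usize U = n} = (\<lambda>(T, V). join_trees T V) ` pairs n"
proof (intro set_eqI iffI)
  fix U assume n: "n \<ge> 2" and "U \<in> {U. usize U = n}"
  then have U: "usize U = n" by simp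
  then have "{t. forget_root t = U} \<noteq> {}" using rootings(2) n by blast
  then have "{(T, V). join_trees T V = U} \<noteq> {}"
    using bij_betw_imp_surj_on[OF pairs_join_bij[of U]] U n by (metis image_empty)
  then show "U \<in> (\<lambda>(T, V). join_trees T V) ` pairs n"
    using U usize_join_trees by (force simp: pairs_def)
qed (auto simp: pairs_def usize_join_trees)

lemma finite_usize: "n \<ge> 2 \<Longrightarrow> finite {U. usize U = n}"
  by (simp add: usize_image finite_pairs)

lemma pairs_group_sum:
  assumes n: "n \<ge> 2"
  shows "(\<Sum>(T, V)\<in>pairs n. h T V) = (\<Sum>U | usize U = n. \<Sum>(T, V) | join_trees T V = U. (h T V :: real))"
proof -
  have "(\<Sum>(T, V)\<in>pairs n. h T V)
     = (\<Sum>U\<in>{U. usize U = n}. \<Sum>x | x \<in> pairs n \<and> (\<lambda>(T, V). join_trees T V) x = U. (\<lambda>(T, V). h T V) x)"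
    by (rule sum.group[OF finite_pairs finite_usize[OF n], symmetric]) (auto simp: pairs_def usize_join_trees)
  also have "\<dots> = (\<Sum>U | usize U = n. \<Sum>(T, V) | join_trees T V = U. h T V)"
    by (intro sum.cong refl) (auto simp: pairs_def usize_join_trees)
  finally show ?thesis .
qed

text \<open>
  The weight of a pair only depends on the joined tree, so each unrooted tree is counted as often as
  it has rootings.
\<close>

lemma pair_total_unrooted:
  assumes n: "n \<ge> 2"
  shows "pair_total w n = (\<Sum>U | usize U = n. uweight w U * real (rooting_count U))"
proof -
  have "(\<Sum>(T, V) | join_trees T V = U. pweight w T * pweight w V) = uweight w U * real (rooting_count U)"
    if "usize U = n" for U
  proof -
    have "(\<Sum>(T, V) | join_trees T V = U. pweight w T * pweight w V) = (\<Sum>(T, V) | join_trees T V = U. uweight w U)"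
      by (intro sum.cong refl) (auto simp: uweight_join_trees)
    then show ?thesis using rooting_count_pairs[of U] that n by (simp add: case_prod_unfold)
  qed
  then show ?thesis unfolding pair_total_def by (simp add: pairs_group_sum[OF n])
qed

lemma uweight_nonneg:
  assumes "\<And>k. w k \<ge> (0::real)" shows "uweight w U \<ge> 0"
  using assms by transfer (auto intro: prod_nonneg)

lemma rooting_count_bounds:
  assumes "usize U \<ge> 2" shows "0 < rooting_count U" "rooting_count U \<le> 2 * (usize U - 1)"
  using rootings[OF assms] by (auto simp: rooting_count_def card_gt_0_iff)

text \<open>
  This factor selects the pairs whose second component is the smaller one. Pairs of equal size count
  one half, so that exactly half of the total weight is selected.
\<close>

definition smaller_half :: "nat \<Rightarrow> ptree \<Rightarrow> real" where
  "smaller_half n V = (if 2 * psize V < n then 1 else if 2 * psize V = n then 1 / 2 else 0)"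

lemma smaller_half_sum: "psize T + psize V = n \<Longrightarrow> smaller_half n T + smaller_half n V = 1"
  by (auto simp: smaller_half_def)

lemma smaller_half_pairs: "(\<Sum>(T, V)\<in>pairs n. pweight w T * pweight w V * smaller_half n V) = pair_total w n / 2"
proof -
  let ?S = "\<Sum>(T, V)\<in>pairs n. pweight w T * pweight w V * smaller_half n V"
  have "?S = (\<Sum>(T, V)\<in>pairs n. pweight w V * pweight w T * smaller_half n T)" by (rule pairs_swap_sum)
  then have "?S + ?S = (\<Sum>(T, V)\<in>pairs n. pweight w V * pweight w T * smaller_half n T)
      + (\<Sum>(T, V)\<in>pairs n. pweight w T * pweight w V * smaller_half n V)" by simp
  also have "\<dots> = (\<Sum>x\<in>pairs n. (case x of (T, V) \<Rightarrow> pweight w T * pweight w V * (smaller_half n T + smaller_half n V)))"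
    by (simp add: sum.distrib[symmetric] case_prod_unfold algebra_simps)
  also have "\<dots> = pair_total w n"
    unfolding pair_total_def by (intro sum.cong refl) (auto simp: pairs_def smaller_half_sum)
  finally show ?thesis by simp
qed

lemma smaller_half_fibre:
  assumes U: "usize U = n" "n \<ge> 2"
  shows "(\<Sum>(T, V) | join_trees T V = U. pweight w T * pweight w V * smaller_half n V)
     = uweight w U * real (rooting_count U) / 2"
proof -
  let ?F = "{(T, V). join_trees T V = U}"
  have F: "(\<Sum>(T, V)\<in>?F. pweight w T * pweight w V * smaller_half n V) = uweight w U * (\<Sum>(T, V)\<in>?F. smaller_half n V)"
    unfolding sum_distrib_left by (intro sum.cong refl) (auto simp: uweight_join_trees)
  have "(\<Sum>(T, V)\<in>?F. smaller_half n V) = (\<Sum>(T, V)\<in>?F. smaller_half n T)"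
    by (rule sum.reindex_bij_witness[of _ prod.swap prod.swap]) (auto simp: join_trees_commute)
  then have "2 * (\<Sum>(T, V)\<in>?F. smaller_half n V) = (\<Sum>(T, V)\<in>?F. smaller_half n T) + (\<Sum>(T, V)\<in>?F. smaller_half n V)" by simp
  also have "\<dots> = (\<Sum>x\<in>?F. (case x of (T, V) \<Rightarrow> smaller_half n T + smaller_half n V))"
    by (simp add: sum.distrib[symmetric] case_prod_unfold)
  also have "\<dots> = (\<Sum>x\<in>?F. 1)"
    by (intro sum.cong refl) (use U usize_join_trees in \<open>auto intro!: smaller_half_sum\<close>)
  finally have "2 * (\<Sum>(T, V)\<in>?F. smaller_half n V) = real (rooting_count U)"
    using rooting_count_pairs[of U] U by simp
  then show ?thesis unfolding F by simp
qed

section \<open>Symmetric trees\<close>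

lemma rotate_period_nth:
  assumes "rotate j xs = xs" "j \<le> i" "i < length xs" shows "xs ! i = xs ! (i - j)"
proof -
  have "xs ! (i - j) = rotate j xs ! (i - j)" using assms by simp
  also have "\<dots> = xs ! ((j + (i - j)) mod length xs)" using assms by (intro nth_rotate) simp
  finally show ?thesis using assms by simp
qed

lemma rotate_period_unique:
  assumes "rotate j xs = xs" "rotate j ys = ys" "length xs = length ys" "take j xs = take j ys" "j > 0"
  shows "xs = ys"
proof (rule nth_equalityI)
  show "xs ! i = ys ! i" if "i < length xs" for i
    using that
  proof (induction i rule: less_induct)
    case (less i)
    show ?case
    proof (cases "i < j")
      case True
      then show ?thesis using assms(4) by (metis nth_take)
    next
      case False
      then show ?thesis
        using rotate_period_nth[OF assms(1), of i] rotate_period_nth[OF assms(2), of i] less assms(3,5) by simp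
    qed
  qed
qed (fact assms)

lemma rotate_period_take_drop:
  assumes "rotate j xs = xs" "2 * j \<le> length xs" shows "take j (drop j xs) = take j xs"
proof (cases "j = 0")
  case False
  then have "j < length xs" using assms by simp
  then have "drop j xs @ take j xs = xs" using assms(1) by (simp add: rotate_drop_take)
  then have "take j (drop j xs @ take j xs) = take j xs" by simp
  then show ?thesis using assms by simp
qed simp

definition periodic_forests :: "nat \<Rightarrow> nat \<Rightarrow> nat \<Rightarrow> ptree list set" where
  "periodic_forests j l n = {xs \<in> forests l n. rotate j xs = xs}"

text \<open>
  A rotation by \<open>j > l / 2\<close> is replaced by the inverse rotation by \<open>l - j\<close>, so that the period can be taken
  to be at most half of the length.
\<close>

lemma symmetric_cases:
  assumes n: "n \<ge> 2" "usize U = n" and s: "rooting_count U \<noteq> 2 * (n - 1)"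
  shows "U \<in> (\<lambda>V. join_trees V V) ` {V. 2 * psize V = n} \<or>
     (\<exists>j\<in>{1..n}. \<exists>l\<in>{2*j..n}. U \<in> (\<lambda>xs. forget_root (Node xs)) ` periodic_forests j l (n - 1))"
proof -
  consider V where "U = join_trees V V"
    | xs j where "U = forget_root (Node xs)" "0 < j" "j < length xs" "rotate j xs = xs"
    using rootings(4)[of U] n s unfolding rooting_count_def by blast
  then show ?thesis
  proof cases
    case 1
    then show ?thesis using n(2) usize_join_trees[of V V] by auto
  next
    case 2
    have size: "sum_list (map psize xs) = n - 1" using 2(1) n(2) by (simp add: usize_forget_root psize_Node)
    have main: "\<exists>j\<in>{1..n}. \<exists>l\<in>{2*j..n}. U \<in> (\<lambda>xs. forget_root (Node xs)) ` periodic_forests j l (n - 1)"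
      if "0 < j" "2 * j \<le> length xs" "rotate j xs = xs" for j
    proof -
      have "length xs \<le> n" using length_le_sum_psize[of xs] size by simp
      moreover have "xs \<in> periodic_forests j (length xs) (n - 1)" using that size by (simp add: periodic_forests_def forests_def)
      ultimately show ?thesis using that 2(1) by (intro bexI[of _ j] bexI[of _ "length xs"]) auto
    qed
    show ?thesis
    proof (cases "2 * j \<le> length xs")
      case True then show ?thesis using main 2 by blast
    next
      case False
      have "rotate (length xs - j) xs = rotate (length xs - j) (rotate j xs)" using 2 by simp
      also have "\<dots> = rotate (length xs) xs" using 2(3) by (simp only: rotate_rotate) simp
      finally have "rotate (length xs - j) xs = xs" by simp
      then show ?thesis using main[of "length xs - j"] 2 False by auto
    qed
  qed
qed

lemma sum_image_bound:
  fixes f :: "'b \<Rightarrow> real"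
  assumes "finite Z" "X \<subseteq> g ` Z" "\<And>y. f y \<ge> 0" shows "sum f X \<le> (\<Sum>z\<in>Z. f (g z))"
proof -
  have "sum f X \<le> sum f (g ` Z)" by (rule sum_mono2) (use assms in auto)
  also have "\<dots> \<le> sum (f \<circ> g) Z" by (rule sum_image_le[OF assms(1)]) (simp add: assms)
  finally show ?thesis by simp
qed

context offspring
begin

definition symmetric_total :: "nat \<Rightarrow> real" where
  "symmetric_total n = (\<Sum>U | usize U = n \<and> rooting_count U \<noteq> 2 * (n - 1). uweight p U)"

lemma p_le_lt_1: "\<exists>q. 0 < q \<and> q < 1 \<and> (\<forall>k. p k \<le> q)"
proof -
  obtain k where k: "k \<ge> 2" "p k > 0" using branching by auto
  let ?q = "max (1 - p 0) (1 - p k)"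
  have "p i \<le> ?q" for i
  proof (cases "i = 0")
    case True
    then show ?thesis using p_partial_sum_le[of "{0, k}"] k by simp
  next
    case False
    then show ?thesis using p_partial_sum_le[of "{0, i}"] by simp
  qed
  moreover from this[of 0] have "0 < ?q" using p0 by (rule less_le_trans[rotated])
  moreover have "?q < 1" using k p0 by simp
  ultimately show ?thesis by blast
qed

lemma pweight_le:
  assumes "\<forall>k. p k \<le> q" shows "pweight p V \<le> q ^ psize V"
proof -
  have "pweight p V \<le> (\<Prod>v\<in>nodes V. q)"
    unfolding pweight_def by (rule prod_mono) (use assms nonneg in auto)
  then show ?thesis by (simp add: psize_def)
qed

lemma forest_weight_le:
  assumes "\<forall>k. p k \<le> q" shows "prod_list (map (pweight p) ts) \<le> q ^ sum_list (map psize ts)"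
proof (induction ts)
  case (Cons V ts)
  have "0 \<le> q" using nonneg[of 0] assms order_trans by blast
  then have "pweight p V * prod_list (map (pweight p) ts) \<le> q ^ psize V * q ^ sum_list (map psize ts)"
    by (intro mult_mono pweight_le[OF assms] Cons.IH)
       (auto intro!: prod_list_nonneg pweight_nonneg nonneg)
  then show ?case by (simp add: power_add)
qed simp

lemma forests_weight_le_1: "(\<Sum>m\<le>n. \<Sum>ts\<in>forests j m. prod_list (map (pweight p) ts)) \<le> 1"
proof -
  have "(\<Sum>m\<le>n. fps_nth (planted_fps p ^ j) m) \<le> 1 ^ j"
    by (rule fps_power_partial_sum_le) (auto simp: fps_nth_planted_fps t_nonneg t_partial_sum_le)
  then show ?thesis by (simp add: forests_total)
qed

lemma forest_weight_nonneg: "0 \<le> prod_list (map (pweight p) ts)"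
  by (auto intro!: prod_list_nonneg pweight_nonneg nonneg)

text \<open>
  A periodic forest is determined by its first \<open>j\<close> trees. The other trees contain at least half of the
  \<open>n\<close> vertices, as they begin with a copy of the first \<open>j\<close>; their weight is at most \<open>(q\<^sup>2) ^ (n / 2) = q ^ n\<close>.
  The sum over the first \<open>j\<close> trees is a probability.
\<close>

lemma periodic_forests_weight:
  assumes q: "0 \<le> q" "q \<le> 1" "\<forall>k. p k \<le> q\<^sup>2" and j: "j > 0" "2 * j \<le> l"
  shows "(\<Sum>xs\<in>periodic_forests j l n. prod_list (map (pweight p) xs)) \<le> q ^ n"
proof -
  let ?w = "\<lambda>xs. prod_list (map (pweight p) xs)"
  have fin: "finite (periodic_forests j l n)"
    unfolding periodic_forests_def using finite_forests by simp
  have bound: "?w xs \<le> q ^ n * ?w (take j xs)" if xs: "xs \<in> periodic_forests j l n" for xs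
  proof -
    have len: "length xs = l" and size: "sum_list (map psize xs) = n" and per: "rotate j xs = xs"
      using xs by (auto simp: periodic_forests_def forests_def)
    let ?A = "sum_list (map psize (take j xs))" and ?B = "sum_list (map psize (drop j xs))"
    have "n = ?A + ?B" unfolding size[symmetric] by (metis append_take_drop_id map_append sum_list_append)
    moreover have "?A \<le> ?B"
    proof -
      have "?B = sum_list (map psize (take j (drop j xs))) + sum_list (map psize (drop j (drop j xs)))"
        by (metis append_take_drop_id map_append sum_list_append)
      then show ?thesis using rotate_period_take_drop[OF per] j len by simp
    qed
    ultimately have n: "n \<le> 2 * ?B" by simp
    have "?w xs = ?w (take j xs) * ?w (drop j xs)"
      by (metis append_take_drop_id map_append prod_list.append)
    also have "\<dots> \<le> ?w (take j xs) * (q\<^sup>2) ^ ?B"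
      by (intro mult_left_mono forest_weight_le q forest_weight_nonneg)
    also have "(q\<^sup>2) ^ ?B = q ^ (2 * ?B)" by (simp add: power_mult)
    also have "?w (take j xs) * q ^ (2 * ?B) \<le> ?w (take j xs) * q ^ n"
      by (intro mult_left_mono power_decreasing n q forest_weight_nonneg)
    finally show ?thesis by (simp add: mult.commute)
  qed
  have "(\<Sum>xs\<in>periodic_forests j l n. ?w xs) \<le> (\<Sum>xs\<in>periodic_forests j l n. q ^ n * ?w (take j xs))"
    by (rule sum_mono) (rule bound)
  also have "\<dots> = q ^ n * (\<Sum>ys\<in>take j ` periodic_forests j l n. ?w ys)"
  proof -
    have "inj_on (take j) (periodic_forests j l n)"
      by (rule inj_onI, rule rotate_period_unique[where j = j])
         (use j in \<open>auto simp: periodic_forests_def forests_def\<close>)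
    then show ?thesis by (simp add: sum.reindex sum_distrib_left)
  qed
  also have "\<dots> \<le> q ^ n * (\<Sum>ys\<in>(\<Union>m\<le>n. forests j m). ?w ys)"
  proof (intro mult_left_mono sum_mono2)
    show "finite (\<Union>m\<le>n. forests j m)" by (simp add: finite_forests)
    show "take j ` periodic_forests j l n \<subseteq> (\<Union>m\<le>n. forests j m)"
    proof
      fix ys assume "ys \<in> take j ` periodic_forests j l n"
      then obtain xs where xs: "xs \<in> forests l n" "ys = take j xs" by (auto simp: periodic_forests_def)
      have "sum_list (map psize xs) = sum_list (map psize ys) + sum_list (map psize (drop j xs))"
        unfolding xs(2) by (metis append_take_drop_id map_append sum_list_append)
      then show "ys \<in> (\<Union>m\<le>n. forests j m)" using xs j by (auto simp: forests_def)
    qed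
  qed (use q forest_weight_nonneg in auto)
  also have "(\<Sum>ys\<in>(\<Union>m\<le>n. forests j m). ?w ys) = (\<Sum>m\<le>n. \<Sum>ys\<in>forests j m. ?w ys)"
    by (rule sum.UNION_disjoint) (auto simp: finite_forests, auto simp: forests_def)
  also have "q ^ n * \<dots> \<le> q ^ n * 1" by (intro mult_left_mono forests_weight_le_1) (use q in simp)
  finally show ?thesis by simp
qed

text \<open>
  The two summands come from the trees with two equal halves and from those with a periodic sequence of
  branches at some vertex; for the latter there are at most \<open>n\<^sup>2\<close> choices of the period and of the degree.
\<close>

lemma symmetric_total_le:
  assumes q: "0 \<le> q" "q \<le> 1" "\<forall>k. p k \<le> q\<^sup>2" and n: "n \<ge> 2"
  shows "symmetric_total n \<le> (1 + (real n)\<^sup>2) * q ^ (n - 1)"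
proof -
  let ?X = "{U. usize U = n \<and> rooting_count U \<noteq> 2 * (n - 1)}"
  let ?A = "(\<lambda>V. join_trees V V) ` {V. 2 * psize V = n}"
  let ?I = "SIGMA j:{1..n}. {2*j..n}"
  let ?Z = "SIGMA (j, l):?I. periodic_forests j l (n - 1)"
  have fX: "finite ?X" using finite_usize[OF n] by simp
  have finV: "finite {V. 2 * psize V = n}"
    by (rule finite_subset[OF _ finite_psize_le[of n]]) auto
  have uw: "uweight p U \<ge> 0" for U by (rule uweight_nonneg) (rule nonneg)
  have "(\<Sum>U\<in>?X \<inter> ?A. uweight p U) \<le> (\<Sum>V | 2 * psize V = n. uweight p (join_trees V V))"
    by (rule sum_image_bound) (use uw finV in auto)
  also have "\<dots> \<le> (\<Sum>V | 2 * psize V = n. q ^ n * pweight p V)"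
  proof (rule sum_mono)
    fix V assume "V \<in> {V. 2 * psize V = n}"
    then have V: "2 * psize V = n" by simp
    have "pweight p V \<le> (q\<^sup>2) ^ psize V" by (rule pweight_le[OF q(3)])
    also have "\<dots> = q ^ n" unfolding V[symmetric] by (simp add: power_mult)
    finally show "uweight p (join_trees V V) \<le> q ^ n * pweight p V"
      unfolding uweight_join_trees by (intro mult_right_mono pweight_nonneg nonneg)
  qed
  also have "\<dots> \<le> q ^ n * 1"
    unfolding sum_distrib_left[symmetric]
  proof (rule mult_left_mono)
    have "(\<Sum>V | 2 * psize V = n. pweight p V) \<le> t (n div 2)"
      unfolding planted_total_def
      by (rule sum_mono2) (auto simp: finite_psize_eq intro!: pweight_nonneg nonneg)
    also have "\<dots> \<le> (\<Sum>i\<le>n. t i)" by (rule member_le_sum) (auto simp: t_nonneg)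
    also have "\<dots> \<le> 1" by (rule t_partial_sum_le)
    finally show "(\<Sum>V | 2 * psize V = n. pweight p V) \<le> 1" .
  qed (use q in simp)
  also have "q ^ n * 1 \<le> q ^ (n - 1)" using q by (simp add: power_decreasing)
  finally have 1: "(\<Sum>U\<in>?X \<inter> ?A. uweight p U) \<le> q ^ (n - 1)" .
  have "(\<Sum>U\<in>?X - ?A. uweight p U) \<le> (\<Sum>z\<in>?Z. uweight p (forget_root (Node (snd z))))"
  proof (rule sum_image_bound)
    show "finite ?Z" by (intro finite_SigmaI) (auto simp: periodic_forests_def finite_forests)
    show "?X - ?A \<subseteq> (\<lambda>z. forget_root (Node (snd z))) ` ?Z"
    proof
      fix U assume U: "U \<in> ?X - ?A"
      then obtain j l xs where "j \<in> {1..n}" "l \<in> {2*j..n}" "xs \<in> periodic_forests j l (n - 1)" "U = forget_root (Node xs)"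
        using symmetric_cases[OF n, of U] by blast
      then show "U \<in> (\<lambda>z. forget_root (Node (snd z))) ` ?Z"
        by (intro image_eqI[of _ _ "((j, l), xs)"]) auto
    qed
  qed (rule uw)
  also have "\<dots> = (\<Sum>x\<in>?I. \<Sum>xs\<in>(case x of (j, l) \<Rightarrow> periodic_forests j l (n - 1)). uweight p (forget_root (Node xs)))"
    by (subst sum.Sigma) (auto simp: periodic_forests_def finite_forests case_prod_unfold)
  also have "\<dots> = (\<Sum>(j, l)\<in>?I. \<Sum>xs\<in>periodic_forests j l (n - 1). uweight p (forget_root (Node xs)))"
    by (simp add: case_prod_unfold)
  also have "\<dots> \<le> (\<Sum>(j, l)\<in>?I. q ^ (n - 1))"
  proof (rule sum_mono, clarify)
    fix j l assume jl: "j \<in> {1..n}" "l \<in> {2*j..n}"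
    have "(\<Sum>xs\<in>periodic_forests j l (n - 1). uweight p (forget_root (Node xs)))
        \<le> (\<Sum>xs\<in>periodic_forests j l (n - 1). prod_list (map (pweight p) xs))"
    proof (rule sum_mono)
      fix xs assume "xs \<in> periodic_forests j l (n - 1)"
      then have "xs \<noteq> []" using jl by (auto simp: periodic_forests_def forests_def)
      moreover have "p (length xs - 1) \<le> 1" using p_partial_sum_le[of "{length xs - 1}"] by simp
      ultimately show "uweight p (forget_root (Node xs)) \<le> prod_list (map (pweight p) xs)"
        using mult_right_mono[OF _ forest_weight_nonneg] by (fastforce simp: uweight_forget_root)
    qed
    also have "\<dots> \<le> q ^ (n - 1)" by (rule periodic_forests_weight) (use q jl in auto)
    finally show "(\<Sum>xs\<in>periodic_forests j l (n - 1). uweight p (forget_root (Node xs))) \<le> q ^ (n - 1)" .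
  qed
  also have "\<dots> = real (card ?I) * q ^ (n - 1)" by (simp add: case_prod_unfold)
  also have "\<dots> \<le> (real n)\<^sup>2 * q ^ (n - 1)"
  proof (rule mult_right_mono)
    have "card ?I \<le> card ({1..n} \<times> {1..n})" by (rule card_mono) auto
    then have "card ?I \<le> n\<^sup>2" by (simp add: power2_eq_square)
    then show "real (card ?I) \<le> (real n)\<^sup>2" by (metis of_nat_le_iff of_nat_power)
  qed (use q in simp)
  finally have 2: "(\<Sum>U\<in>?X - ?A. uweight p U) \<le> (real n)\<^sup>2 * q ^ (n - 1)" .
  have "symmetric_total n = (\<Sum>U\<in>?X \<inter> ?A. uweight p U) + (\<Sum>U\<in>?X - ?A. uweight p U)"
    unfolding symmetric_total_def by (rule sum.Int_Diff[OF fX])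
  with 1 2 show ?thesis by (simp add: algebra_simps)
qed

end

section \<open>Discrete laws\<close>

lemma weighted_pmf_scale:
  assumes "c \<noteq> 0" "\<And>x. x \<in> A \<Longrightarrow> f x = c * g x"
  shows "weighted_pmf A f = weighted_pmf A g"
proof -
  have "(\<Sum>y\<in>A. f y) = c * (\<Sum>y\<in>A. g y)" using assms(2) by (simp add: sum_distrib_left)
  then have "(\<lambda>x. if x \<in> A then f x / (\<Sum>y\<in>A. f y) else 0) = (\<lambda>x. if x \<in> A then g x / (\<Sum>y\<in>A. g y) else 0)"
    using assms by auto
  then show ?thesis by (simp add: weighted_pmf_def)
qed

lemma pmf_weighted_pmf:
  assumes A: "finite A" and f: "\<And>x. x \<in> A \<Longrightarrow> f x \<ge> 0" and pos: "(\<Sum>y\<in>A. f y) > 0"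
  shows "pmf (weighted_pmf A f) x = (if x \<in> A then f x / (\<Sum>y\<in>A. f y) else 0)"
  unfolding weighted_pmf_def
proof (rule pmf_embed_pmf)
  let ?g = "\<lambda>x. if x \<in> A then f x / (\<Sum>y\<in>A. f y) else 0"
  show "0 \<le> ?g x" for x using f pos by simp
  have "(\<integral>\<^sup>+x. ennreal (?g x) \<partial>count_space UNIV) = (\<Sum>x\<in>A. ennreal (?g x))"
    by (rule nn_integral_count_space'[OF A]) auto
  also have "\<dots> = ennreal (\<Sum>x\<in>A. ?g x)" by (rule sum_ennreal) (use f pos in simp)
  also have "(\<Sum>x\<in>A. ?g x) = 1" using pos by (simp add: sum_divide_distrib[symmetric])
  finally show "(\<integral>\<^sup>+x. ennreal (?g x) \<partial>count_space UNIV) = 1" by simp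
qed

lemma measure_pmf_finite_support:
  assumes "finite S" "set_pmf P \<subseteq> S" shows "measure_pmf.prob P E = (\<Sum>x\<in>S. if x \<in> E then pmf P x else 0)"
proof -
  have "measure_pmf.prob P E = measure_pmf.prob P (E \<inter> S)"
    using assms(2) measure_Int_set_pmf[of P E] measure_Int_set_pmf[of P "E \<inter> S"]
    by (metis inf.absorb2 inf_assoc)
  also have "\<dots> = (\<Sum>x\<in>E \<inter> S. pmf P x)" using assms(1) by (intro measure_measure_pmf_finite) simp
  also have "\<dots> = (\<Sum>x\<in>S. if x \<in> E then pmf P x else 0)"
    using assms(1) by (intro sum.mono_neutral_cong_left) auto
  finally show ?thesis .
qed

lemma pmf_replicate_pmf:
  "pmf (replicate_pmf n P) xs = (if length xs = n then prod_list (map (pmf P) xs) else 0)"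
proof (induction n arbitrary: xs)
  case 0 then show ?case by (auto simp: indicator_def)
next
  case (Suc n)
  have eq: "replicate_pmf (Suc n) P = map_pmf (\<lambda>(x, xs). x # xs) (pair_pmf P (replicate_pmf n P))"
    by (simp add: map_pmf_def pair_pmf_def bind_assoc_pmf bind_return_pmf)
  show ?case
  proof (cases xs)
    case Nil
    have "[] \<notin> set_pmf (replicate_pmf (Suc n) P)" by (auto simp: set_replicate_pmf simp del: replicate_pmf.simps)
    then show ?thesis using Nil by (simp add: set_pmf_iff del: replicate_pmf.simps)
  next
    case (Cons y ys)
    have "inj (\<lambda>(x, xs). x # xs :: 'a list)" by (auto simp: inj_def)
    then have "pmf (replicate_pmf (Suc n) P) ((\<lambda>(x, xs). x # xs) (y, ys)) = pmf (pair_pmf P (replicate_pmf n P)) (y, ys)"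
      unfolding eq by (rule pmf_map_inj')
    then show ?thesis using Cons Suc.IH[of ys] by (simp add: pmf_pair del: replicate_pmf.simps)
  qed
qed

context offspring
begin

section \<open>The Galton--Watson tree\<close>

definition offspring_pmf :: "nat pmf" where "offspring_pmf = embed_pmf p"

lemma pmf_offspring: "pmf offspring_pmf k = p k"
  unfolding offspring_pmf_def
proof (rule pmf_embed_pmf)
  have "(\<integral>\<^sup>+k. ennreal (p k) \<partial>count_space UNIV) = (\<Sum>k. ennreal (p k))"
    by (rule nn_integral_count_space_nat)
  also have "\<dots> = ennreal 1"
    using sums_1 nonneg by (metis suminf_ennreal_eq)
  finally show "(\<integral>\<^sup>+k. ennreal (p k) \<partial>count_space UNIV) = 1" by simp
qed (rule nonneg)

definition gw_pmf :: "ptree pmf" where "gw_pmf = embed_pmf (pweight p)"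

lemma pmf_gw: "pmf gw_pmf V = pweight p V"
  unfolding gw_pmf_def
proof (rule pmf_embed_pmf)
  show nn: "0 \<le> pweight p V" for V by (rule pweight_nonneg) (rule nonneg)
  have "(\<integral>\<^sup>+V. ennreal (pweight p V) \<partial>count_space UNIV)
      = (\<integral>\<^sup>+V. (\<Sum>n. ennreal (if psize V = n then pweight p V else 0)) \<partial>count_space UNIV)"
  proof (rule nn_integral_cong)
    fix V
    have "(\<Sum>n. ennreal (if psize V = n then pweight p V else 0))
        = (\<Sum>n\<in>{psize V}. ennreal (if psize V = n then pweight p V else 0))"
      by (rule suminf_finite) auto
    then show "ennreal (pweight p V) = (\<Sum>n. ennreal (if psize V = n then pweight p V else 0))" by simp
  qed
  also have "\<dots> = (\<Sum>n. \<integral>\<^sup>+V. ennreal (if psize V = n then pweight p V else 0) \<partial>count_space UNIV)"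
    by (rule nn_integral_suminf) simp
  also have "(\<lambda>n. \<integral>\<^sup>+V. ennreal (if psize V = n then pweight p V else 0) \<partial>count_space UNIV) = (\<lambda>n. ennreal (t n))"
  proof
    fix n
    have "(\<integral>\<^sup>+V. ennreal (if psize V = n then pweight p V else 0) \<partial>count_space UNIV)
        = (\<Sum>V | psize V = n. ennreal (if psize V = n then pweight p V else 0))"
      by (rule nn_integral_count_space'[OF finite_psize_eq]) auto
    also have "\<dots> = ennreal (\<Sum>V | psize V = n. if psize V = n then pweight p V else 0)"
      by (rule sum_ennreal) (use nn in auto)
    finally show "(\<integral>\<^sup>+V. ennreal (if psize V = n then pweight p V else 0) \<partial>count_space UNIV) = ennreal (t n)"
      by (simp add: planted_total_def)
  qed
  also have "(\<Sum>n. ennreal (t n)) = ennreal 1"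
    using t_sums_1 t_nonneg by (metis suminf_ennreal_eq)
  finally show "(\<integral>\<^sup>+V. ennreal (pweight p V) \<partial>count_space UNIV) = 1" by simp
qed

text \<open>
  The weight of \<open>Node ts\<close> is \<open>p (length ts)\<close> times the product of the weights of \<open>ts\<close>, and this is the
  branching property.
\<close>

theorem galton_watson: "galton_watson_law offspring_pmf gw_pmf"
  unfolding galton_watson_law_def
proof (rule pmf_eqI)
  fix V
  obtain ts where V: "V = Node ts" by (cases V)
  have inj: "inj Node" by (auto simp: inj_def)
  have kernel: "pmf (map_pmf Node (replicate_pmf k gw_pmf)) V
      = (if k = length ts then prod_list (map (pweight p) ts) else 0)" for k
    unfolding V pmf_map_inj'[OF inj] pmf_replicate_pmf by (auto simp: pmf_gw cong: map_cong)
  have "pmf (bind_pmf offspring_pmf (\<lambda>k. map_pmf Node (replicate_pmf k gw_pmf))) V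
      = (\<integral>k. (if k = length ts then prod_list (map (pweight p) ts) else 0) \<partial>measure_pmf offspring_pmf)"
    unfolding pmf_bind kernel ..
  also have "\<dots> = (\<Sum>k\<in>{length ts}. (if k = length ts then prod_list (map (pweight p) ts) else 0) * pmf offspring_pmf k)"
    by (rule integral_measure_pmf_real) (auto split: if_splits)
  also have "\<dots> = pweight p V" by (simp add: V pweight_Node pmf_offspring mult.commute)
  finally show "pmf gw_pmf V = pmf (bind_pmf offspring_pmf (\<lambda>k. map_pmf Node (replicate_pmf k gw_pmf))) V"
    by (simp add: pmf_gw)
qed

lemma sub_or_critical_offspring: "sub_or_critical offspring_pmf"
proof -
  have dens: "measure_pmf offspring_pmf = density (count_space UNIV) (\<lambda>k. ennreal (p k))"
    by (simp add: measure_pmf_eq_density pmf_offspring)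
  have int: "integrable (count_space UNIV) (\<lambda>k::nat. p k * real k)"
    unfolding integrable_count_space_nat_iff using mean_summable by (simp add: abs_mult nonneg mult.commute)
  have "integrable (measure_pmf offspring_pmf) real"
    unfolding dens by (subst integrable_density) (use int nonneg in \<open>auto simp: real_scaleR_def\<close>)
  moreover have "measure_pmf.expectation offspring_pmf real = (\<Sum>k. p k * real k)"
    unfolding dens by (subst integral_density) (use int nonneg integral_count_space_nat in auto)
  ultimately show ?thesis using mean_le_1 by (simp add: sub_or_critical_def mult.commute)
qed

section \<open>Asymptotics of the total weights\<close>

lemma pair_total_walk:
  assumes "n \<ge> 2" shows "real n * pair_total p n = 2 * walk n (n - 2)"
  using planted_fps_power_nth[of n 2 p] assms by (simp add: pair_total_fps walk_def)

lemma pair_total_nonneg: "pair_total p n \<ge> 0"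
  unfolding pair_total_def by (rule sum_nonneg) (auto intro!: mult_nonneg_nonneg pweight_nonneg nonneg)

lemma pair_total_pos_dvd:
  assumes "n \<ge> 2" "pair_total p n > 0" shows "d dvd n - 2"
proof (rule walk_pos_dvd)
  have "0 < real n * pair_total p n" using assms by simp
  then show "walk n (n - 2) > 0" using pair_total_walk[OF assms(1)] by simp
qed

lemma pweight_pos_dvd:
  assumes "pweight p V > 0" shows "d dvd psize V - 1"
proof (rule walk_pos_dvd)
  have "pweight p V \<le> t (psize V)"
    unfolding planted_total_def
    by (rule member_le_sum) (auto simp: finite_psize_eq intro!: pweight_nonneg nonneg)
  then have "0 < real (psize V) * t (psize V)" using assms psize_pos[of V] by simp
  then show "walk (psize V) (psize V - 1) > 0" using t_walk[OF psize_pos] by simp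
qed

lemma shift_limit:
  "(\<lambda>i. walk (nat (int (d * i) + a)) (nat (int (d * i) + int d * b)) / walk (d * i) (d * i)) \<longlonglongrightarrow> 1"
  using shifts_lattice[of a b] by (simp add: shifts_def)

lemma real_lattice_at_top: "filterlim (\<lambda>i. real (d * i)) at_top sequentially"
  using weight_span_pos
  by (intro filterlim_compose[OF filterlim_real_sequentially] filterlim_at_top_mono[OF filterlim_ident]) auto

lemma ratio_shift_1:
  fixes x :: "nat \<Rightarrow> real"
  assumes "filterlim x at_top sequentially" shows "(\<lambda>i. x i / (x i + c)) \<longlonglongrightarrow> 1"
proof -
  have "(\<lambda>i. c / x i) \<longlonglongrightarrow> 0"
    by (rule tendsto_divide_0[OF tendsto_const]) (rule filterlim_at_top_imp_at_infinity[OF assms])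
  then have lim: "(\<lambda>i. inverse (1 + c / x i)) \<longlonglongrightarrow> inverse (1 + 0)"
    by (intro tendsto_intros) auto
  have ev: "eventually (\<lambda>i. x i > 0) sequentially"
    using assms by (auto simp: filterlim_at_top_dense)
  have "(\<lambda>i. x i / (x i + c)) \<longlonglongrightarrow> inverse (1 + 0)"
    by (rule Lim_transform_eventually[OF lim], use ev in eventually_elim) (simp add: field_simps)
  then show ?thesis by simp
qed

lemma divide_cancel_common:
  fixes N :: real
  assumes "W = N * X" "N > 0" shows "W / u * (y / N) = X * y / u"
  using assms by simp

lemma t_asymptotics:
  "(\<lambda>i. t (1 + d * i - d * j) * real (d * i) / walk (d * i) (d * i)) \<longlonglongrightarrow> 1"
proof -
  let ?c = "1 - real (d * j)"
  have lim: "(\<lambda>i. (walk (nat (int (d * i) + (1 - int (d * j)))) (nat (int (d * i) + int d * (- int j))) / walk (d * i) (d * i))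
      * (real (d * i) / (real (d * i) + ?c))) \<longlonglongrightarrow> 1 * 1"
    by (intro tendsto_mult shift_limit ratio_shift_1 real_lattice_at_top)
  have "eventually (\<lambda>i. (walk (nat (int (d * i) + (1 - int (d * j)))) (nat (int (d * i) + int d * (- int j))) / walk (d * i) (d * i))
      * (real (d * i) / (real (d * i) + ?c)) = t (1 + d * i - d * j) * real (d * i) / walk (d * i) (d * i)) sequentially"
    using eventually_ge_at_top[of j]
  proof eventually_elim
    case (elim i)
    then have le: "d * j \<le> d * i" by simp
    let ?n = "1 + d * i - d * j"
    have n: "nat (int (d * i) + (1 - int (d * j))) = ?n" "nat (int (d * i) + int d * (- int j)) = ?n - 1"
      using le by (auto simp: nat_diff_distrib simp flip: of_nat_mult)
    have "real ?n = real (1 + d * i) - real (d * j)" by (rule of_nat_diff) (use le in linarith)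
    then have rn: "real (d * i) + ?c = real ?n" by simp
    have n0: "?n > 0" using le by linarith
    then have "walk ?n (?n - 1) = real ?n * t ?n" by (rule t_walk[symmetric])
    then show ?case unfolding n rn by (rule divide_cancel_common) (simp only: of_nat_0_less_iff n0)
  qed
  from Lim_transform_eventually[OF lim this] show ?thesis by (simp only: mult_1_right)
qed

lemma pair_total_asymptotics:
  "(\<lambda>i. pair_total p (2 + d * i) / 2 * real (d * i) / walk (d * i) (d * i)) \<longlonglongrightarrow> 1"
proof -
  have lim: "(\<lambda>i. (walk (nat (int (d * i) + 2)) (nat (int (d * i) + int d * 0)) / walk (d * i) (d * i))
      * (real (d * i) / (real (d * i) + 2))) \<longlonglongrightarrow> 1 * 1"
    by (intro tendsto_mult shift_limit ratio_shift_1 real_lattice_at_top)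
  have "eventually (\<lambda>i. (walk (nat (int (d * i) + 2)) (nat (int (d * i) + int d * 0)) / walk (d * i) (d * i))
      * (real (d * i) / (real (d * i) + 2)) = pair_total p (2 + d * i) / 2 * real (d * i) / walk (d * i) (d * i)) sequentially"
  proof (rule always_eventually, rule allI)
    fix i
    let ?n = "2 + d * i"
    have n: "nat (int (d * i) + 2) = ?n" "nat (int (d * i) + int d * 0) = ?n - 2" by (simp_all flip: of_nat_mult)
    have rn: "real (d * i) + 2 = real ?n" by simp
    have "walk ?n (?n - 2) = real ?n * (pair_total p ?n / 2)" using pair_total_walk[of ?n] by simp
    moreover have "real ?n > 0" by (simp only: of_nat_0_less_iff)
    ultimately show "(walk (nat (int (d * i) + 2)) (nat (int (d * i) + int d * 0)) / walk (d * i) (d * i))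
      * (real (d * i) / (real (d * i) + 2)) = pair_total p (2 + d * i) / 2 * real (d * i) / walk (d * i) (d * i)"
      unfolding n rn by (rule divide_cancel_common)
  qed
  from Lim_transform_eventually[OF lim this] show ?thesis by (simp only: mult_1_right)
qed

lemma walk_diagonal_eventually: "eventually (\<lambda>i. real (d * i) > 0 \<and> walk (d * i) (d * i) > 0) sequentially"
  using subexponential_eventually_pos[OF subexponential_diagonal] eventually_gt_at_top[of 0]
  by eventually_elim (use weight_span_pos in simp)

lemma pair_total_eventually_pos: "eventually (\<lambda>i. pair_total p (2 + d * i) > 0) sequentially"
proof -
  have "eventually (\<lambda>i. pair_total p (2 + d * i) / 2 * real (d * i) / walk (d * i) (d * i) > 0) sequentially"
    by (rule order_tendstoD(1)[OF pair_total_asymptotics]) simp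
  then show ?thesis
  proof eventually_elim
    case (elim i)
    then have "pair_total p (2 + d * i) \<noteq> 0" by auto
    then show ?case using pair_total_nonneg[of "2 + d * i"] by linarith
  qed
qed

text \<open>
  Both quantities are asymptotic to \<open>walk (d * i) (d * i) / (d * i)\<close>. The limit contains the
  subexponentiality of the sizes: a random pair consists of one large tree and one of bounded size.
\<close>

theorem size_ratio_limit:
  "(\<lambda>i. t (1 + d * i - d * j) / (pair_total p (2 + d * i) / 2)) \<longlonglongrightarrow> 1"
proof -
  have lim: "(\<lambda>i. (t (1 + d * i - d * j) * real (d * i) / walk (d * i) (d * i))
      / (pair_total p (2 + d * i) / 2 * real (d * i) / walk (d * i) (d * i))) \<longlonglongrightarrow> 1 / 1"
    by (intro tendsto_divide t_asymptotics pair_total_asymptotics) simp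
  have "eventually (\<lambda>i. (t (1 + d * i - d * j) * real (d * i) / walk (d * i) (d * i))
      / (pair_total p (2 + d * i) / 2 * real (d * i) / walk (d * i) (d * i))
      = t (1 + d * i - d * j) / (pair_total p (2 + d * i) / 2)) sequentially"
    using walk_diagonal_eventually pair_total_eventually_pos
  proof eventually_elim
    case (elim i)
    have cancel: "(a * y / u) / (b * y / u) = a / b" if "y > 0" "u > 0" for a b y u :: real
      using that by simp
    show ?case by (rule cancel) (use elim in blast)+
  qed
  from Lim_transform_eventually[OF lim this] show ?thesis by simp
qed

lemma pair_total_lower_bound:
  assumes c: "c > 0"
  shows "eventually (\<lambda>i. pair_total p (2 + d * i) \<ge> exp (- c * real (2 + d * i))) sequentially"
proof -
  have "(2, int d * 0) \<in> shifts" by (rule shifts_lattice)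
  then have "subexponential (\<lambda>i. nat (int (d * i) + 2)) (\<lambda>i. nat (int (d * i) + int d * 0))"
    by (simp add: shifts_def)
  then have "subexponential (\<lambda>i. 2 + d * i) (\<lambda>i. d * i)"
    by (simp add: nat_add_distrib add.commute flip: of_nat_mult)
  then have low: "eventually (\<lambda>i. walk (2 + d * i) (d * i) \<ge> exp (- (c / 2) * real (2 + d * i))) sequentially"
    using half_gt_zero[OF c] unfolding subexponential_def by blast
  have "eventually (\<lambda>i. real (d * i) \<ge> 4 / c\<^sup>2) sequentially"
    using real_lattice_at_top unfolding filterlim_at_top by blast
  with low show ?thesis
  proof eventually_elim
    case (elim i)
    define x where "x = real (2 + d * i)"
    have x: "x > 0" "x \<ge> 4 / c\<^sup>2" using elim unfolding x_def by linarith+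
    have "x \<le> 2 * exp (c / 2 * x)"
    proof -
      have "4 \<le> c\<^sup>2 * x" using x c by (simp add: field_simps)
      then have "4 * x \<le> c\<^sup>2 * x * x" using x by simp
      then have "x / 2 \<le> (c / 2 * x)\<^sup>2 / 2" by (simp add: power2_eq_square field_simps)
      also have "\<dots> \<le> exp (c / 2 * x)" 
      proof -
        have "0 \<le> c / 2 * x" using x c by simp
        then show ?thesis using exp_lower_Taylor_quadratic[of "c / 2 * x"] by linarith
      qed
      finally show ?thesis by simp
    qed
    then have "x * exp (- (c / 2) * x) \<le> 2 * (exp (c / 2 * x) * exp (- (c / 2) * x))"
      using mult_right_mono[of x "2 * exp (c / 2 * x)" "exp (- (c / 2) * x)"] by simp
    also have "exp (c / 2 * x) * exp (- (c / 2) * x) = 1" by (simp flip: exp_add)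
    finally have "x * exp (- (c / 2) * x) \<le> 2" by simp
    then have "x * exp (- (c / 2) * x) * exp (- (c / 2) * x) \<le> 2 * exp (- (c / 2) * x)"
      by (rule mult_right_mono) simp
    also have "\<dots> \<le> 2 * walk (2 + d * i) (d * i)" using elim by (simp add: x_def)
    also have "\<dots> = x * pair_total p (2 + d * i)" using pair_total_walk[of "2 + d * i"] by (simp add: x_def)
    finally have "x * (exp (- (c / 2) * x) * exp (- (c / 2) * x)) \<le> x * pair_total p (2 + d * i)" by (simp only: mult.assoc)
    then have "exp (- (c / 2) * x) * exp (- (c / 2) * x) \<le> pair_total p (2 + d * i)" using x by simp
    also have "exp (- (c / 2) * x) * exp (- (c / 2) * x) = exp (- c * x)" by (simp flip: exp_add)
    finally show ?case by (simp only: x_def)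
  qed
qed

text \<open>
  The weight of the symmetric trees is exponentially small by \<open>symmetric_total_le\<close>, while the total weight of
  the pairs decays slower than any exponential. The minimum with 1 takes care of the finitely many sizes below
  which the lower bound for the latter is not available.
\<close>

theorem symmetric_total_negligible:
  "\<exists>C>0. \<exists>c>0. \<forall>n\<ge>2. pair_total p n > 0 \<longrightarrow>
     min 1 (4 * real (n - 1) * symmetric_total n / pair_total p n) \<le> C * exp (- c * real n)"
proof -
  obtain q0 where q0: "0 < q0" "q0 < 1" "\<forall>k. p k \<le> q0" using p_le_lt_1 by blast
  \<comment> \<open>A square root, since only half of the vertices of a symmetric tree are repetitions.\<close>
  define q where "q = sqrt q0"
  have q: "0 < q" "q < 1" "\<forall>k. p k \<le> q\<^sup>2" using q0 by (auto simp: q_def)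
  define c where "c = - ln q / 4"
  have c: "c > 0" using q by (simp add: c_def)
  have q_exp: "q = exp (- 4 * c)" using q by (simp add: c_def)
  obtain I where I: "\<And>i. i \<ge> I \<Longrightarrow> pair_total p (2 + d * i) \<ge> exp (- c * real (2 + d * i))"
    using pair_total_lower_bound[OF c] unfolding eventually_sequentially by blast
  define n0 where "n0 = 2 + d * I"
  define K where "K = 8 * (3 / c) ^ 3 * exp (4 * c)"
  have large: "4 * real (n - 1) * symmetric_total n / pair_total p n \<le> K * exp (- 2 * c * real n)"
    if n: "n \<ge> 2" "pair_total p n > 0" "n \<ge> n0" for n
  proof -
    obtain i where i: "n - 2 = d * i" using pair_total_pos_dvd[OF n(1,2)] by (auto simp: dvd_def)
    then have ni: "n = 2 + d * i" using n by simp
    have "i \<ge> I" using n(3) weight_span_pos unfolding n0_def ni by simp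
    then have low: "pair_total p n \<ge> exp (- c * real n)" using I ni by blast
    have sym: "symmetric_total n \<le> (1 + (real n)\<^sup>2) * q ^ (n - 1)"
      by (rule symmetric_total_le) (use q n in auto)
    have poly: "4 * real (n - 1) * (1 + (real n)\<^sup>2) \<le> 8 * (3 / c) ^ 3 * exp (c * real n)"
    proof -
      have "1 \<le> (real n)\<^sup>2" using n by (intro one_le_power) simp
      then have "4 * real (n - 1) * (1 + (real n)\<^sup>2) \<le> 4 * real n * (2 * (real n)\<^sup>2)"
        by (intro mult_mono) auto
      also have "\<dots> = 8 * (3 / c) ^ 3 * (c * real n / 3) ^ 3" using c by (simp add: field_simps power2_eq_square power3_eq_cube)
      also have "\<dots> \<le> 8 * (3 / c) ^ 3 * (exp (c * real n / 3)) ^ 3"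
      proof (intro mult_left_mono power_mono)
        show "c * real n / 3 \<le> exp (c * real n / 3)" using exp_ge_add_one_self[of "c * real n / 3"] by linarith
      qed (use c in auto)
      also have "(exp (c * real n / 3)) ^ 3 = exp (c * real n)" by (simp flip: exp_of_nat_mult)
      finally show ?thesis .
    qed
    have "4 * real (n - 1) * symmetric_total n \<le> 4 * real (n - 1) * ((1 + (real n)\<^sup>2) * q ^ (n - 1))"
      by (intro mult_left_mono sym) simp
    also have "\<dots> = (4 * real (n - 1) * (1 + (real n)\<^sup>2)) * q ^ (n - 1)" by simp
    also have "\<dots> \<le> (8 * (3 / c) ^ 3 * exp (c * real n)) * q ^ (n - 1)"
      by (rule mult_right_mono[OF poly]) (use q in simp)
    also have "q ^ (n - 1) = exp (4 * c) * exp (- 4 * c * real n)"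
      using n by (simp add: q_exp of_nat_diff algebra_simps flip: exp_of_nat_mult exp_add)
    finally have up: "4 * real (n - 1) * symmetric_total n \<le> K * (exp (c * real n) * exp (- 4 * c * real n))"
      by (simp add: K_def mult_ac)
    have "4 * real (n - 1) * symmetric_total n / pair_total p n
        \<le> K * (exp (c * real n) * exp (- 4 * c * real n)) / exp (- c * real n)"
      by (rule frac_le[OF _ up _ low]) (use c in \<open>auto simp: K_def\<close>)
    also have "exp (c * real n) * exp (- 4 * c * real n) = exp (- 2 * c * real n) * exp (- c * real n)"
      by (simp flip: exp_add)
    also have "K * (exp (- 2 * c * real n) * exp (- c * real n)) / exp (- c * real n) = K * exp (- 2 * c * real n)"
      by simp
    finally show ?thesis .
  qed
  define C where "C = max K (exp (2 * c * real n0))"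
  have "min 1 (4 * real (n - 1) * symmetric_total n / pair_total p n) \<le> C * exp (- (2 * c) * real n)"
    if n: "n \<ge> 2" "pair_total p n > 0" for n
  proof (cases "n \<ge> n0")
    case True
    have le: "K * exp (- 2 * c * real n) \<le> C * exp (- 2 * c * real n)" by (intro mult_right_mono) (auto simp: C_def)
    show ?thesis using order_trans[OF large[OF n True] le] by (simp add: min.coboundedI2)
  next
    case False
    have "1 = exp (2 * c * real n) * exp (- 2 * c * real n)" by (simp flip: exp_add)
    also have "\<dots> \<le> C * exp (- 2 * c * real n)"
    proof (rule mult_right_mono)
      have "exp (2 * c * real n) \<le> exp (2 * c * real n0)" using False c by simp
      then show "exp (2 * c * real n) \<le> C" unfolding C_def by (rule max.coboundedI2)
    qed simp
    finally show ?thesis by simp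
  qed
  moreover have "C > 0" by (simp add: C_def less_max_iff_disj)
  ultimately show ?thesis using c by (intro exI[of _ C] conjI exI[of _ "2 * c"]) auto
qed

end

section \<open>Limits of laws of planted trees\<close>

text \<open>
  Scheffe's lemma for laws of trees: no mass escapes because the limit has total mass 1 and all but a
  small part of it lies on the finitely many trees with at most \<open>N\<close> vertices.
\<close>

lemma pmf_limit_expectation:
  fixes P :: "nat \<Rightarrow> ptree pmf"
  assumes lim: "\<And>V. (\<lambda>i. pmf (P i) V) \<longlonglongrightarrow> pmf Q V" and f: "bounded (range (f :: ptree \<Rightarrow> real))"
  shows "(\<lambda>i. measure_pmf.expectation (P i) f) \<longlonglongrightarrow> measure_pmf.expectation Q f"
proof (rule tendstoI)
  fix e :: real assume e: "e > 0"
  obtain B where B: "B > 0" "\<And>x. \<bar>f x\<bar> \<le> B" using f by (auto simp: bounded_pos)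
  let ?S = "\<lambda>N. {V. psize V \<le> N}"
  have "(\<lambda>N. measure_pmf.prob Q (?S N)) \<longlonglongrightarrow> measure_pmf.prob Q (\<Union>N. ?S N)"
    by (rule measure_pmf.finite_Lim_measure_incseq) (auto simp: incseq_def)
  moreover have "(\<Union>N. ?S N) = UNIV" by auto
  ultimately have "(\<lambda>N. measure_pmf.prob Q (?S N)) \<longlonglongrightarrow> 1" by simp
  then have "eventually (\<lambda>N. measure_pmf.prob Q (?S N) > 1 - e / (8 * B)) sequentially"
    by (rule order_tendstoD) (use e B in simp)
  then obtain N where N: "measure_pmf.prob Q (?S N) > 1 - e / (8 * B)" by (auto simp: eventually_sequentially)
  define S where "S = ?S N"
  have S: "finite S" unfolding S_def by (rule finite_psize_le)
  have split: "\<bar>measure_pmf.expectation R f - (\<Sum>x\<in>S. f x * pmf R x)\<bar> \<le> B * (1 - measure_pmf.prob R S)" for R :: "ptree pmf"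
  proof -
    have int: "integrable (measure_pmf R) g" if "\<And>x. \<bar>g x\<bar> \<le> B" for g :: "ptree \<Rightarrow> real"
      by (rule measure_pmf.integrable_const_bound[of _ B]) (use that in auto)
    have "(\<Sum>x\<in>S. f x * pmf R x) = (\<Sum>x\<in>S. (indicator S x * f x) * pmf R x)"
      by (intro sum.cong) auto
    also have "\<dots> = measure_pmf.expectation R (\<lambda>x. indicator S x * f x)"
      by (rule integral_measure_pmf_real[symmetric, OF S]) (auto simp: indicator_def split: if_splits)
    finally have "measure_pmf.expectation R f - (\<Sum>x\<in>S. f x * pmf R x)
        = measure_pmf.expectation R f - measure_pmf.expectation R (\<lambda>x. indicator S x * f x)" by simp
    also have "\<dots> = measure_pmf.expectation R (\<lambda>x. f x - indicator S x * f x)"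
      by (rule Bochner_Integration.integral_diff[symmetric])
         (use B in \<open>auto intro!: int simp: indicator_def less_imp_le\<close>)
    also have "\<bar>\<dots>\<bar> \<le> measure_pmf.expectation R (\<lambda>x. B * indicator (- S) x)"
    proof (rule order_trans[OF integral_abs_bound integral_mono])
      show "integrable (measure_pmf R) (\<lambda>x. \<bar>f x - indicator S x * f x\<bar>)"
        by (rule int) (use B in \<open>auto simp: indicator_def less_imp_le\<close>)
      show "integrable (measure_pmf R) (\<lambda>x. B * indicator (- S) x)"
        by (rule int) (use B in \<open>auto simp: indicator_def\<close>)
      show "\<bar>f x - indicator S x * f x\<bar> \<le> B * indicator (- S) x" for x
        using B(2)[of x] by (auto simp: indicator_def)
    qed
    also have "\<dots> = B * measure_pmf.prob R (- S)" by simp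
    also have "measure_pmf.prob R (- S) = 1 - measure_pmf.prob R S"
      using measure_pmf.prob_compl[of S R] by (simp add: Compl_eq_Diff_UNIV)
    finally show ?thesis .
  qed
  have prob: "measure_pmf.prob R S = (\<Sum>x\<in>S. pmf R x)" for R by (rule measure_measure_pmf_finite[OF S])
  have "(\<lambda>i. \<Sum>x\<in>S. f x * pmf (P i) x) \<longlonglongrightarrow> (\<Sum>x\<in>S. f x * pmf Q x)"
    by (intro tendsto_intros lim)
  then have 1: "eventually (\<lambda>i. dist (\<Sum>x\<in>S. f x * pmf (P i) x) (\<Sum>x\<in>S. f x * pmf Q x) < e / 2) sequentially"
    using half_gt_zero[OF e] by (rule tendstoD)
  have "(\<lambda>i. measure_pmf.prob (P i) S) \<longlonglongrightarrow> measure_pmf.prob Q S"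
    unfolding prob by (intro tendsto_intros lim)
  then have 2: "eventually (\<lambda>i. measure_pmf.prob (P i) S > 1 - e / (8 * B)) sequentially"
    by (rule order_tendstoD) (use N in \<open>simp add: S_def\<close>)
  from 1 2 show "eventually (\<lambda>i. dist (measure_pmf.expectation (P i) f) (measure_pmf.expectation Q f) < e) sequentially"
  proof eventually_elim
    case (elim i)
    have small: "B * (1 - measure_pmf.prob R S) \<le> e / 8" if "measure_pmf.prob R S > 1 - e / (8 * B)" for R
    proof -
      have "B * (1 - measure_pmf.prob R S) \<le> B * (e / (8 * B))"
        by (rule mult_left_mono) (use that B in auto)
      then show ?thesis using B by simp
    qed
    have "\<bar>measure_pmf.expectation (P i) f - (\<Sum>x\<in>S. f x * pmf (P i) x)\<bar> \<le> e / 8"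
      by (rule order_trans[OF split small]) (use elim in simp)
    moreover have "\<bar>measure_pmf.expectation Q f - (\<Sum>x\<in>S. f x * pmf Q x)\<bar> \<le> e / 8"
      by (rule order_trans[OF split small]) (use N in \<open>simp add: S_def\<close>)
    ultimately show ?case using elim(1) e unfolding dist_real_def by linarith
  qed
qed

lemma lattice_filter_le:
  fixes S :: "nat set"
  assumes "d > 0" "\<And>n. n \<in> S \<Longrightarrow> n \<ge> 2 \<Longrightarrow> d dvd n - 2"
  shows "inf sequentially (principal S) \<le> filtermap (\<lambda>i. 2 + d * i) sequentially"
proof (rule filter_leI)
  fix P assume "eventually P (filtermap (\<lambda>i. 2 + d * i) sequentially)"
  then obtain I where I: "\<And>i. i \<ge> I \<Longrightarrow> P (2 + d * i)"
    by (auto simp: eventually_filtermap eventually_sequentially)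
  have "P n" if n: "n \<ge> 2 + d * I" "n \<in> S" for n
  proof -
    obtain i where "n - 2 = d * i" using assms(2)[OF n(2)] n(1) by (auto simp: dvd_def)
    then have i: "n = 2 + d * i" using n by simp
    then show ?thesis using I[of i] n assms(1) by simp
  qed
  then show "eventually P (inf sequentially (principal S))"
    unfolding eventually_inf_principal eventually_sequentially by blast
qed

context offspring
begin

section \<open>The smaller tree of the pair\<close>

text \<open>
  The law of the tree \<open>V n\<close>: the smaller component of a random pair, which is either one with equal
  probability if the sizes agree.
\<close>

definition smaller_law :: "nat \<Rightarrow> ptree pmf" where
  "smaller_law n = weighted_pmf {V. psize V \<le> n} (\<lambda>V. pweight p V * t (n - psize V) * smaller_half n V)"

lemma smaller_half_nonneg: "smaller_half n V \<ge> 0" by (simp add: smaller_half_def)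

lemma smaller_law_sum:
  "(\<Sum>V | psize V \<le> n. pweight p V * t (n - psize V) * smaller_half n V) = pair_total p n / 2"
proof -
  have "(\<Sum>V | psize V \<le> n. pweight p V * t (n - psize V) * smaller_half n V)
      = (\<Sum>V | psize V \<le> n. \<Sum>T | psize T = n - psize V. pweight p T * pweight p V * smaller_half n V)"
    unfolding planted_total_def sum_distrib_left sum_distrib_right by (intro sum.cong refl) simp
  also have "\<dots> = (\<Sum>(T, V)\<in>pairs n. pweight p T * pweight p V * smaller_half n V)" by (rule pairs_sum[symmetric])
  finally show ?thesis by (simp only: smaller_half_pairs)
qed

lemma pmf_smaller_law:
  assumes "pair_total p n > 0"
  shows "pmf (smaller_law n) V =
    (if psize V \<le> n then pweight p V * t (n - psize V) * smaller_half n V / (pair_total p n / 2) else 0)"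
  unfolding smaller_law_def
  by (subst pmf_weighted_pmf)
     (use assms in \<open>auto simp: smaller_law_sum finite_psize_le intro!: mult_nonneg_nonneg pweight_nonneg nonneg t_nonneg smaller_half_nonneg\<close>)

lemma smaller_law_support:
  assumes "pair_total p n > 0" "V \<in> set_pmf (smaller_law n)"
  shows "psize V < n" "t (n - psize V) > 0"
proof -
  have *: "psize V \<le> n \<and> t (n - psize V) \<noteq> 0"
    using assms pmf_smaller_law[OF assms(1), of V] by (auto simp: set_pmf_iff split: if_splits)
  then show pos: "t (n - psize V) > 0" using t_nonneg[of "n - psize V"] by simp
  show "psize V < n" using * by (cases "psize V = n") (auto simp: planted_total_0)
qed

text \<open>
  Only trees of positive weight matter, and these have \<open>1 + d * j\<close> vertices for some \<open>j\<close>.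
\<close>

theorem smaller_law_limit: "(\<lambda>i. pmf (smaller_law (2 + d * i)) V) \<longlonglongrightarrow> pmf gw_pmf V"
proof (cases "pweight p V > 0")
  case True
  obtain j where "psize V - 1 = d * j" using pweight_pos_dvd[OF True] by (auto simp: dvd_def)
  then have j: "psize V = 1 + d * j" using psize_pos[of V] by simp
  have lim: "(\<lambda>i. pweight p V * (t (1 + d * i - d * j) / (pair_total p (2 + d * i) / 2))) \<longlonglongrightarrow> pweight p V * 1"
    by (intro tendsto_intros size_ratio_limit)
  have "eventually (\<lambda>i. 2 * psize V < 2 + d * i) sequentially"
    using eventually_gt_at_top[of "2 * psize V"]
  proof eventually_elim
    case (elim i)
    have "i \<le> d * i" using weight_span_pos by simp
    then show ?case using elim by linarith
  qed
  with pair_total_eventually_pos have "eventually (\<lambda>i. pweight p V * (t (1 + d * i - d * j) / (pair_total p (2 + d * i) / 2))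
      = pmf (smaller_law (2 + d * i)) V) sequentially"
  proof eventually_elim
    case (elim i)
    have "2 + d * i - psize V = 1 + d * i - d * j" using j by simp
    moreover have "psize V \<le> 2 + d * i" using elim by linarith
    ultimately show ?case using elim by (simp add: pmf_smaller_law smaller_half_def)
  qed
  from Lim_transform_eventually[OF lim this] show ?thesis by (simp add: pmf_gw)
next
  case False
  then have 0: "pweight p V = 0" using pweight_nonneg[of p V] nonneg by (auto simp: less_le)
  have "eventually (\<lambda>i. 0 = pmf (smaller_law (2 + d * i)) V) sequentially"
    using pair_total_eventually_pos by eventually_elim (simp add: pmf_smaller_law 0)
  from Lim_transform_eventually[OF tendsto_const this] show ?thesis by (simp add: pmf_gw 0)
qed

section \<open>The law of a random rooting\<close>

text \<open>
  The law of the unrooted tree obtained by joining the components of a random pair.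
\<close>

definition join_law :: "nat \<Rightarrow> uptree pmf" where
  "join_law n = weighted_pmf {U. usize U = n} (\<lambda>U. uweight p U * real (rooting_count U))"

lemma uw_nonneg: "uweight p U \<ge> 0" by (rule uweight_nonneg) (rule nonneg)

lemma pmf_join_law:
  assumes "n \<ge> 2" "pair_total p n > 0"
  shows "pmf (join_law n) U = (if usize U = n then uweight p U * real (rooting_count U) / pair_total p n else 0)"
  unfolding join_law_def
  by (subst pmf_weighted_pmf)
     (use assms in \<open>auto simp: pair_total_unrooted[symmetric] finite_usize intro!: mult_nonneg_nonneg uw_nonneg\<close>)

lemma unrooted_total_pos:
  assumes n: "n \<ge> 2" and pos: "pair_total p n > 0" shows "(\<Sum>U | usize U = n. uweight p U) > 0"
proof (rule ccontr)
  assume "\<not> ?thesis"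
  moreover have "(\<Sum>U | usize U = n. uweight p U) \<ge> 0" by (rule sum_nonneg) (rule uw_nonneg)
  ultimately have "(\<Sum>U | usize U = n. uweight p U) = 0" by simp
  then have "\<forall>U\<in>{U. usize U = n}. uweight p U = 0"
    using sum_nonneg_eq_0_iff[OF finite_usize[OF n]] uw_nonneg by metis
  then have "pair_total p n = 0" by (simp add: pair_total_unrooted[OF n])
  then show False using pos by simp
qed

lemma pmf_unrooted_law:
  assumes "n \<ge> 2" "pair_total p n > 0"
  shows "pmf (unrooted_law p n) U = (if usize U = n then uweight p U / (\<Sum>U | usize U = n. uweight p U) else 0)"
  unfolding unrooted_law_def
  by (subst pmf_weighted_pmf) (use assms unrooted_total_pos in \<open>auto simp: finite_usize uw_nonneg\<close>)

lemma pmf_planted_law: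
  assumes "t m > 0"
  shows "pmf (planted_law p m) V = (if psize V = m then pweight p V / t m else 0)"
  unfolding planted_law_def
  by (subst pmf_weighted_pmf)
     (use assms in \<open>auto simp: finite_psize_eq planted_total_def intro!: pweight_nonneg nonneg\<close>)

text \<open>
  The joined tree can be sampled by first choosing the smaller component and then an independent simply
  generated planted tree of the remaining size. Restricting to the smaller component as the second one is
  harmless, since joining is symmetric.
\<close>

lemma join_law_measure:
  assumes n: "n \<ge> 2" and pos: "pair_total p n > 0"
  shows "measure_pmf.prob (join_law n) E
    = (\<Sum>V | psize V \<le> n. pmf (smaller_law n) V * measure_pmf.prob (planted_law p (n - psize V)) {T. join_trees T V \<in> E})"
proof -
  let ?P = "pair_total p n"
  have "measure_pmf.prob (join_law n) E = (\<Sum>U | usize U = n. if U \<in> E then pmf (join_law n) U else 0)"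
    by (rule measure_pmf_finite_support[OF finite_usize[OF n]])
       (auto simp: set_pmf_iff pmf_join_law[OF n pos] split: if_splits)
  also have "\<dots> = (\<Sum>U | usize U = n. \<Sum>(T, V) | join_trees T V = U.
      if join_trees T V \<in> E then pweight p T * pweight p V * smaller_half n V / (?P / 2) else 0)"
  proof (rule sum.cong[OF refl])
    fix U assume "U \<in> {U. usize U = n}"
    then have U: "usize U = n" by simp
    have "(\<Sum>(T, V) | join_trees T V = U. if join_trees T V \<in> E then pweight p T * pweight p V * smaller_half n V / (?P / 2) else 0)
        = (if U \<in> E then (\<Sum>(T, V) | join_trees T V = U. pweight p T * pweight p V * smaller_half n V) / (?P / 2) else 0)"
    proof (cases "U \<in> E")
      case True
      have "(\<Sum>(T, V) | join_trees T V = U. if join_trees T V \<in> E then pweight p T * pweight p V * smaller_half n V / (?P / 2) else 0)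
          = (\<Sum>(T, V) | join_trees T V = U. pweight p T * pweight p V * smaller_half n V / (?P / 2))"
        by (intro sum.cong refl) (use True in auto)
      then show ?thesis using True by (simp only: sum_divide_distrib case_prod_unfold if_True)
    next
      case False
      have "(\<Sum>(T, V) | join_trees T V = U. if join_trees T V \<in> E then pweight p T * pweight p V * smaller_half n V / (?P / 2) else 0) = 0"
      proof (rule sum.neutral, rule ballI)
        fix x assume x: "x \<in> {(T, V). join_trees T V = U}"
        obtain T V where TV: "x = (T, V)" by (cases x)
        then have "join_trees T V \<notin> E" using x False by simp
        then show "(case x of (T, V) \<Rightarrow> if join_trees T V \<in> E then pweight p T * pweight p V * smaller_half n V / (?P / 2) else 0) = 0"
          by (simp add: TV)
      qed
      then show ?thesis using False by (simp only: if_False)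
    qed
    then show "(if U \<in> E then pmf (join_law n) U else 0) = (\<Sum>(T, V) | join_trees T V = U.
      if join_trees T V \<in> E then pweight p T * pweight p V * smaller_half n V / (?P / 2) else 0)"
      by (simp add: smaller_half_fibre[OF U n] pmf_join_law[OF n pos] U)
  qed
  also have "\<dots> = (\<Sum>(T, V)\<in>pairs n.
      if join_trees T V \<in> E then pweight p T * pweight p V * smaller_half n V / (?P / 2) else 0)"
    by (rule pairs_group_sum[OF n, symmetric])
  also have "\<dots> = (\<Sum>V | psize V \<le> n. \<Sum>T | psize T = n - psize V.
      if join_trees T V \<in> E then pweight p T * pweight p V * smaller_half n V / (?P / 2) else 0)"
    by (rule pairs_sum)
  also have "\<dots> = (\<Sum>V | psize V \<le> n. pmf (smaller_law n) V * measure_pmf.prob (planted_law p (n - psize V)) {T. join_trees T V \<in> E})"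
  proof (rule sum.cong[OF refl])
    fix V assume "V \<in> {V. psize V \<le> n}"
    then have V: "psize V \<le> n" by simp
    let ?m = "n - psize V"
    show "(\<Sum>T | psize T = ?m. if join_trees T V \<in> E then pweight p T * pweight p V * smaller_half n V / (?P / 2) else 0)
       = pmf (smaller_law n) V * measure_pmf.prob (planted_law p ?m) {T. join_trees T V \<in> E}"
    proof (cases "t ?m > 0")
      case True
      have "measure_pmf.prob (planted_law p ?m) {T. join_trees T V \<in> E}
          = (\<Sum>T | psize T = ?m. if T \<in> {T. join_trees T V \<in> E} then pmf (planted_law p ?m) T else 0)"
        by (rule measure_pmf_finite_support[OF finite_psize_eq])
           (auto simp: set_pmf_iff pmf_planted_law[OF True] split: if_splits)
      also have "\<dots> = (\<Sum>T | psize T = ?m. if join_trees T V \<in> E then pweight p T / t ?m else 0)"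
        by (intro sum.cong refl) (simp add: pmf_planted_law[OF True])
      finally have eq: "measure_pmf.prob (planted_law p ?m) {T. join_trees T V \<in> E}
          = (\<Sum>T | psize T = ?m. if join_trees T V \<in> E then pweight p T / t ?m else 0)" .
      show ?thesis
        unfolding pmf_smaller_law[OF pos] eq sum_distrib_left
        by (intro sum.cong refl) (use True V in simp)
    next
      case False
      then have 0: "t ?m = 0" using t_nonneg[of ?m] by simp
      then have "pweight p T = 0" if "psize T = ?m" for T
        using that sum_nonneg_eq_0_iff[OF finite_psize_eq, of ?m "pweight p"] pweight_nonneg[of p] nonneg
        unfolding planted_total_def by auto
      then have "(\<Sum>T | psize T = ?m. if join_trees T V \<in> E then pweight p T * pweight p V * smaller_half n V / (?P / 2) else 0) = 0"
        by (intro sum.neutral) simp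
      then show ?thesis using 0 V by (simp add: pmf_smaller_law[OF pos])
    qed
  qed
  finally show ?thesis .
qed

text \<open>
  Both laws are proportional to \<open>uweight\<close> up to the factor \<open>rooting_count U\<close>, which equals its maximal
  value \<open>2 * (n - 1)\<close> unless \<open>U\<close> is symmetric.
\<close>

theorem unrooted_join_distance:
  assumes n: "n \<ge> 2" and pos: "pair_total p n > 0"
  shows "\<bar>measure_pmf.prob (unrooted_law p n) E - measure_pmf.prob (join_law n) E\<bar>
    \<le> min 1 (4 * real (n - 1) * symmetric_total n / pair_total p n)"
proof -
  let ?X = "{U. usize U = n}" and ?P = "pair_total p n" and ?N = "2 * real (n - 1)"
  define W where "W = (\<Sum>U | usize U = n. uweight p U)"
  have W: "W > 0" unfolding W_def by (rule unrooted_total_pos[OF n pos])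
  let ?r = "\<lambda>U. real (rooting_count U)"
  have r: "?r U \<le> ?N" if "U \<in> ?X" for U
  proof -
    have "rooting_count U \<le> 2 * (n - 1)" using rooting_count_bounds(2)[of U] that n by simp
    then have "real (rooting_count U) \<le> real (2 * (n - 1))" by (simp only: of_nat_le_iff)
    then show ?thesis by simp
  qed
  define Df where "Df = (\<Sum>U\<in>?X. uweight p U * (?N - ?r U))"
  have Df: "Df = ?N * W - ?P"
    unfolding Df_def W_def pair_total_unrooted[OF n] by (simp add: algebra_simps sum_subtractf sum_distrib_left)
  have Df_nonneg: "Df \<ge> 0" unfolding Df_def by (intro sum_nonneg mult_nonneg_nonneg uw_nonneg) (use r in simp)
  have Df_le: "Df \<le> ?N * symmetric_total n"
  proof -
    have "Df = (\<Sum>U | usize U = n \<and> rooting_count U \<noteq> 2 * (n - 1). uweight p U * (?N - ?r U))"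
      unfolding Df_def by (rule sum.mono_neutral_right) (use finite_usize[OF n] in auto)
    also have "\<dots> \<le> (\<Sum>U | usize U = n \<and> rooting_count U \<noteq> 2 * (n - 1). uweight p U * ?N)"
      by (intro sum_mono mult_left_mono uw_nonneg) simp
    finally show ?thesis by (simp add: symmetric_total_def sum_distrib_left mult.commute)
  qed
  have diff: "\<bar>pmf (unrooted_law p n) U - pmf (join_law n) U\<bar>
      \<le> uweight p U * (Df / (W * ?P)) + uweight p U * (?N - ?r U) / ?P" if U: "U \<in> ?X" for U
  proof -
    have E: "Df / (W * ?P) = ?N / ?P - 1 / W" unfolding Df using W pos by (simp add: diff_divide_distrib)
    have "pmf (unrooted_law p n) U - pmf (join_law n) U = uweight p U / W - uweight p U * ?r U / ?P"
      using U by (simp add: pmf_unrooted_law[OF n pos] pmf_join_law[OF n pos] W_def)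
    also have "\<dots> = uweight p U * (?N - ?r U) / ?P - uweight p U * (Df / (W * ?P))"
      unfolding E by (simp add: right_diff_distrib diff_divide_distrib)
    finally have "pmf (unrooted_law p n) U - pmf (join_law n) U
        = uweight p U * (?N - ?r U) / ?P - uweight p U * (Df / (W * ?P))" .
    moreover have "0 \<le> uweight p U * (?N - ?r U) / ?P" "0 \<le> uweight p U * (Df / (W * ?P))"
      using r[OF U] uw_nonneg[of U] W pos Df_nonneg by simp_all
    ultimately show ?thesis by linarith
  qed
  have supp: "set_pmf (unrooted_law p n) \<subseteq> ?X" "set_pmf (join_law n) \<subseteq> ?X"
    by (auto simp: set_pmf_iff pmf_unrooted_law[OF n pos] pmf_join_law[OF n pos] split: if_splits)
  have "measure_pmf.prob (unrooted_law p n) E - measure_pmf.prob (join_law n) E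
      = (\<Sum>U\<in>?X. if U \<in> E then pmf (unrooted_law p n) U - pmf (join_law n) U else 0)"
    unfolding measure_pmf_finite_support[OF finite_usize[OF n] supp(1)] measure_pmf_finite_support[OF finite_usize[OF n] supp(2)]
      sum_subtractf[symmetric] by (intro sum.cong refl) simp
  then have "\<bar>measure_pmf.prob (unrooted_law p n) E - measure_pmf.prob (join_law n) E\<bar>
      \<le> (\<Sum>U\<in>?X. \<bar>if U \<in> E then pmf (unrooted_law p n) U - pmf (join_law n) U else 0\<bar>)"
    using sum_abs by simp
  also have "\<dots> \<le> (\<Sum>U\<in>?X. uweight p U * (Df / (W * ?P)) + uweight p U * (?N - ?r U) / ?P)"
    by (rule sum_mono, rule order_trans[OF _ diff]) auto
  also have "\<dots> = W * (Df / (W * ?P)) + Df / ?P"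
    by (simp add: sum.distrib sum_distrib_right sum_divide_distrib W_def Df_def)
  also have "\<dots> = 2 * Df / ?P" using W by simp
  also have "\<dots> \<le> 2 * (?N * symmetric_total n) / ?P"
    by (intro divide_right_mono mult_left_mono Df_le) (use pos in auto)
  finally have "\<bar>measure_pmf.prob (unrooted_law p n) E - measure_pmf.prob (join_law n) E\<bar>
      \<le> 4 * real (n - 1) * symmetric_total n / ?P" by (simp add: mult_ac)
  moreover have "\<bar>measure_pmf.prob (unrooted_law p n) E - measure_pmf.prob (join_law n) E\<bar> \<le> 1"
    using measure_pmf.prob_le_1[of "unrooted_law p n" E] measure_pmf.prob_le_1[of "join_law n" E]
      measure_nonneg[of "measure_pmf (unrooted_law p n)" E] measure_nonneg[of "measure_pmf (join_law n)" E] by linarith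
  ultimately show ?thesis by simp
qed

lemma admissible_unrooted_iff: "admissible_unrooted p n \<longleftrightarrow> n \<ge> 2 \<and> pair_total p n > 0"
proof -
  have "(\<exists>U. usize U = n \<and> uweight p U > 0) \<longleftrightarrow> pair_total p n > 0" if n: "n \<ge> 2"
  proof
    assume "\<exists>U. usize U = n \<and> uweight p U > 0"
    then obtain U where U: "usize U = n" "uweight p U > 0" by blast
    have "0 < uweight p U * real (rooting_count U)" using U rooting_count_bounds(1)[of U] n by simp
    also have "\<dots> \<le> pair_total p n" unfolding pair_total_unrooted[OF n]
      by (rule member_le_sum) (use U finite_usize[OF n] in \<open>auto intro!: mult_nonneg_nonneg uw_nonneg\<close>)
    finally show "pair_total p n > 0" .
  next
    assume "pair_total p n > 0"
    then have "(\<Sum>U | usize U = n. uweight p U) > 0" by (rule unrooted_total_pos[OF n])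
    then have "(\<Sum>U | usize U = n. uweight p U) \<noteq> 0" by simp
    then obtain U where "U \<in> {U. usize U = n}" "uweight p U \<noteq> 0" by (rule sum.not_neutral_contains_not_neutral)
    then show "\<exists>U. usize U = n \<and> uweight p U > 0" using uw_nonneg[of U] by force
  qed
  then show ?thesis unfolding admissible_unrooted_def by blast
qed

lemma admissible_planted_iff: "admissible_planted p m \<longleftrightarrow> t m > 0"
proof
  assume "admissible_planted p m"
  then obtain V where V: "psize V = m" "pweight p V > 0" by (auto simp: admissible_planted_def)
  have "pweight p V \<le> t m" unfolding planted_total_def
    by (rule member_le_sum) (use V in \<open>auto simp: finite_psize_eq intro!: pweight_nonneg nonneg\<close>)
  then show "t m > 0" using V by simp
next
  assume "t m > 0"
  then have "(\<Sum>V | psize V = m. pweight p V) \<noteq> 0" by (simp add: planted_total_def)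
  then obtain V where "V \<in> {V. psize V = m}" "pweight p V \<noteq> 0" by (rule sum.not_neutral_contains_not_neutral)
  then show "admissible_planted p m"
    using pweight_nonneg[of p V] nonneg by (force simp: admissible_planted_def)
qed

end

section \<open>The canonical tilt\<close>

locale weight_sequence =
  fixes w :: "nat \<Rightarrow> real"
  assumes w_nonneg: "w k \<ge> 0" and w0: "w 0 > 0" and w_branching: "\<exists>k\<ge>2. w k > 0"
    and radius_pos: "conv_radius w > 0"
begin

text \<open>
  Divided by \<open>Phi w t\<close> this is the mean of the distribution with weights \<open>w k * t ^ k\<close>. It avoids the index
  shift of \<open>diffs\<close>.
\<close>

definition tilted_mean :: "real \<Rightarrow> real" where
  "tilted_mean t = (\<Sum>k. real k * w k * t ^ k)"

lemma diffs_eq: "diffs w k * t ^ k * t = real (Suc k) * w (Suc k) * t ^ Suc k"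
  by (simp add: diffs_def)

lemma summable_diffs_iff:
  assumes "t > 0"
  shows "summable (\<lambda>k. diffs w k * t ^ k) \<longleftrightarrow> summable (\<lambda>k. real k * w k * t ^ k)"
proof -
  have "summable (\<lambda>k. diffs w k * t ^ k) \<longleftrightarrow> summable (\<lambda>k. diffs w k * t ^ k * t)"
    using assms by (simp add: summable_cmult_iff mult.commute[of _ t])
  also have "\<dots> \<longleftrightarrow> summable (\<lambda>k. real k * w k * t ^ k)"
    unfolding diffs_eq by (rule summable_Suc_iff)
  finally show ?thesis .
qed

lemma Psi_eq:
  assumes "summable (\<lambda>k. real k * w k * t ^ k)" "t > 0"
  shows "Psi w t = tilted_mean t / Phi w t"
proof -
  have s: "summable (\<lambda>k. diffs w k * t ^ k)" using assms summable_diffs_iff by blast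
  have "Phi' w t * t = (\<Sum>k. diffs w k * t ^ k * t)"
    unfolding Phi'_def by (rule suminf_mult2[OF s])
  also have "\<dots> = tilted_mean t"
    unfolding diffs_eq tilted_mean_def using suminf_split_head[OF assms(1)] by simp
  finally show ?thesis by (simp add: Psi_def mult.commute)
qed

lemma summable_w:
  assumes "summable (\<lambda>k. real k * w k * t ^ k)" "t \<ge> 0" shows "summable (\<lambda>k. w k * t ^ k)"
proof (rule summable_comparison_test'[OF assms(1), where N = 1])
  fix k :: nat assume k: "k \<ge> 1"
  have "1 * (w k * t ^ k) \<le> real k * (w k * t ^ k)"
    by (rule mult_right_mono) (use k w_nonneg assms in auto)
  then show "norm (w k * t ^ k) \<le> real k * w k * t ^ k" using w_nonneg[of k] assms by simp
qed

lemma summable_smaller: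
  assumes "summable (\<lambda>k. real k * w k * t ^ k)" "0 \<le> s" "s \<le> t" shows "summable (\<lambda>k. real k * w k * s ^ k)"
  by (rule summable_comparison_test'[OF assms(1)])
     (use assms w_nonneg in \<open>auto intro!: mult_left_mono power_mono\<close>)

lemma summable_inside:
  assumes "t > 0" "ereal t < conv_radius w" shows "summable (\<lambda>k. real k * w k * t ^ k)"
proof -
  have "summable (\<lambda>k. diffs w k * t ^ k)"
  proof -
    obtain K where K: "ereal t < ereal K" "ereal K < conv_radius w" using ereal_dense2[OF assms(2)] by blast
    show ?thesis
    proof (rule termdiff_converges[where K = K])
      show "norm t < K" using assms K by simp
      fix x :: real assume "norm x < K"
      then have "ereal (norm x) < ereal K" by simp
      then have "ereal (norm x) < conv_radius w" using K(2) by (rule less_trans)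
      then show "summable (\<lambda>k. w k * x ^ k)" by (rule summable_in_conv_radius)
    qed
  qed
  then show ?thesis using summable_diffs_iff assms by blast
qed

lemma Phi_pos:
  assumes "summable (\<lambda>k. real k * w k * t ^ k)" "t \<ge> 0" shows "Phi w t > 0"
  unfolding Phi_def by (rule suminf_pos2[OF summable_w[OF assms], where i = 0]) (use w_nonneg w0 assms in auto)

lemma tilted_mean_pos:
  assumes "summable (\<lambda>k. real k * w k * t ^ k)" "t > 0" shows "tilted_mean t > 0"
proof -
  obtain k where "k \<ge> 2" "w k > 0" using w_branching by auto
  then show ?thesis unfolding tilted_mean_def
    by (intro suminf_pos2[OF assms(1), where i = k]) (use w_nonneg assms in auto)
qed

text \<open>
  With \<open>m = Psi w s\<close> and \<open>x = t / s > 1\<close>, every term of \<open>\<Sum> (k - m) w k t^k\<close> is at least \<open>x powr m\<close> times the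
  corresponding term at \<open>s\<close>, and the terms at \<open>s\<close> sum to zero.
\<close>

lemma Psi_strict_mono:
  assumes st: "0 < s" "s < t" and sum: "summable (\<lambda>k. real k * w k * t ^ k)"
  shows "Psi w s < Psi w t"
proof -
  have sum_s: "summable (\<lambda>k. real k * w k * s ^ k)" by (rule summable_smaller[OF sum]) (use st in auto)
  define m where "m = tilted_mean s / Phi w s"
  have P: "Phi w s > 0" "Phi w t > 0" using Phi_pos sum sum_s st by auto
  have m: "m > 0" unfolding m_def using tilted_mean_pos[OF sum_s st(1)] P by simp
  define x where "x = t / s"
  have x: "x > 1" using st by (simp add: x_def)
  define c where "c = x powr m"
  have c: "c > 1" unfolding c_def using x m by simp
  have lin: "(\<lambda>k. (real k - m) * w k * r ^ k) sums (tilted_mean r - m * Phi w r)"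
    if "summable (\<lambda>k. real k * w k * r ^ k)" "r \<ge> 0" for r
  proof -
    have "(\<lambda>k. real k * w k * r ^ k - m * (w k * r ^ k)) sums (tilted_mean r - m * Phi w r)"
      unfolding tilted_mean_def Phi_def by (intro sums_diff sums_mult summable_sums that summable_w)
    then show ?thesis by (simp add: algebra_simps)
  qed
  have "(\<lambda>k. (real k - m) * w k * t ^ k - c * ((real k - m) * w k * s ^ k))
      sums (tilted_mean t - m * Phi w t - c * (tilted_mean s - m * Phi w s))"
    by (intro sums_diff sums_mult lin sum sum_s) (use st in auto)
  moreover have "tilted_mean s - m * Phi w s = 0" unfolding m_def using P by simp
  ultimately have sums: "(\<lambda>k. (real k - m) * w k * t ^ k - c * ((real k - m) * w k * s ^ k))
      sums (tilted_mean t - m * Phi w t)" by simp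
  have "0 < (\<Sum>k. (real k - m) * w k * t ^ k - c * ((real k - m) * w k * s ^ k))"
  proof (rule suminf_pos2[where i = 0])
    show "summable (\<lambda>k. (real k - m) * w k * t ^ k - c * ((real k - m) * w k * s ^ k))"
      using sums by (rule sums_summable)
    show "0 < (real 0 - m) * w 0 * t ^ 0 - c * ((real 0 - m) * w 0 * s ^ 0)"
    proof -
      have "0 < (c - 1) * (m * w 0)" using c m w0 by simp
      then show ?thesis by (simp add: algebra_simps)
    qed
    fix k
    have "t ^ k = x ^ k * s ^ k" using st by (simp add: x_def power_divide)
    then have eq: "(real k - m) * w k * t ^ k - c * ((real k - m) * w k * s ^ k)
        = ((real k - m) * (x ^ k - c)) * (w k * s ^ k)" by (simp add: algebra_simps)
    have xk: "x ^ k = x powr real k" using x by (simp add: powr_realpow)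
    have "0 \<le> (real k - m) * (x ^ k - c)"
    proof (cases "real k \<ge> m")
      case True
      then have "x ^ k \<ge> c" unfolding xk c_def using x by (intro powr_mono) auto
      then show ?thesis using True by simp
    next
      case False
      then have "x ^ k \<le> c" unfolding xk c_def using x by (intro powr_mono) auto
      then show ?thesis using False by (intro mult_nonpos_nonpos) auto
    qed
    then show "0 \<le> (real k - m) * w k * t ^ k - c * ((real k - m) * w k * s ^ k)"
      unfolding eq by (rule mult_nonneg_nonneg) (use w_nonneg st in auto)
  qed
  then have "m * Phi w t < tilted_mean t" using sums by (simp add: sums_iff)
  then have "m < tilted_mean t / Phi w t" using P by (simp add: field_simps)
  then show ?thesis using Psi_eq[OF sum_s st(1)] Psi_eq[OF sum] st by (simp add: m_def)
qed

text \<open>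
  The limit exists because \<open>Psi w\<close> is increasing.
\<close>

lemma nu_eq: "nu w = (SUP t\<in>{t. 0 < t \<and> ereal t < conv_radius w}. ereal (Psi w t))"
proof -
  let ?R = "conv_radius w" and ?F = "filtercomap ereal (at_left (conv_radius w))"
  let ?I = "{t. 0 < t \<and> ereal t < conv_radius w}"
  let ?S = "SUP t\<in>?I. ereal (Psi w t)"
  have ev: "eventually (\<lambda>t. a < ereal t \<and> ereal t < ?R) ?F" if "a < ?R" for a
  proof -
    have "eventually (\<lambda>y. a < y \<and> y < ?R) (at_left ?R)"
      using eventually_at_left[OF that] that by blast
    then show ?thesis unfolding eventually_filtercomap by blast
  qed
  have "((\<lambda>t. ereal (Psi w t)) \<longlongrightarrow> ?S) ?F"
  proof (rule order_tendstoI)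
    fix a assume "a < ?S"
    then obtain s where s: "0 < s" "ereal s < ?R" "a < ereal (Psi w s)" by (auto simp: less_SUP_iff)
    from ev[OF s(2)] show "eventually (\<lambda>t. a < ereal (Psi w t)) ?F"
    proof eventually_elim
      case (elim t)
      then have "Psi w s < Psi w t" using s by (intro Psi_strict_mono summable_inside) auto
      then show ?case using s(3) by (meson ereal_less_eq(3) less_imp_le less_le_trans)
    qed
  next
    fix a assume a: "?S < a"
    have "0 < ?R" by (rule radius_pos)
    from ev[OF this] show "eventually (\<lambda>t. ereal (Psi w t) < a) ?F"
    proof eventually_elim
      case (elim t)
      then have "ereal (Psi w t) \<le> ?S" by (intro SUP_upper) auto
      then show ?case using a by simp
    qed
  qed
  moreover have "?F \<noteq> bot"
  proof (rule filtercomap_neq_bot)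
    fix P assume "eventually P (at_left ?R)"
    then obtain b where b: "b < ?R" "\<And>y. b < y \<Longrightarrow> y < ?R \<Longrightarrow> P y"
      unfolding eventually_at_left[OF radius_pos] by blast
    obtain z where "b < ereal z" "ereal z < ?R" using ereal_dense2[OF b(1)] by blast
    then show "\<exists>x. P (ereal x)" using b(2) by blast
  qed
  ultimately show ?thesis unfolding nu_def by (rule tendsto_Lim[rotated])
qed

text \<open>\<open>Psi w t \<le> 1\<close> says that \<open>\<Sum> (k - 1) w k t^k \<le> 0\<close>, where only the term for \<open>k = 0\<close> is negative.\<close>

lemma Psi_balance:
  assumes "summable (\<lambda>k. real k * w k * t ^ k)" "t > 0"
  shows "(\<lambda>k. (real k - 1) * w k * t ^ k) sums ((Psi w t - 1) * Phi w t)"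
proof -
  have "(\<lambda>k. real k * w k * t ^ k - w k * t ^ k) sums (tilted_mean t - Phi w t)"
    unfolding tilted_mean_def Phi_def using assms by (intro sums_diff summable_sums summable_w) auto
  moreover have "tilted_mean t - Phi w t = (Psi w t - 1) * Phi w t"
    using Psi_eq[OF assms] Phi_pos[OF assms(1)] assms(2) by (simp add: field_simps)
  ultimately show ?thesis by (simp add: algebra_simps)
qed

lemma Psi_1_unique:
  assumes "0 < s" "summable (\<lambda>k. diffs w k * s ^ k)" "Psi w s = 1"
    and "0 < t" "summable (\<lambda>k. diffs w k * t ^ k)" "Psi w t = 1"
  shows "s = t"
proof (rule ccontr)
  assume "s \<noteq> t"
  then consider "s < t" | "t < s" by linarith
  then show False
    using assms Psi_strict_mono[of s t] Psi_strict_mono[of t s] summable_diffs_iff by cases auto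
qed

text \<open>
  If \<open>Psi w\<close> reaches 1 inside the interval of convergence, then \<open>tau w\<close> is the point where it does so.
  Otherwise all partial sums of \<open>\<Sum> (k - 1) * w k * t ^ k\<close> from the first on are at most 0 up to the radius of
  convergence. This forces the radius to be finite and carries over to the boundary, where the series
  therefore converges with \<open>Psi w \<le> 1\<close>; then \<open>tau w\<close> is the radius of convergence, also if \<open>Psi w\<close> equals 1
  there.
\<close>

theorem tau_properties:
  shows "tau w > 0" "summable (\<lambda>k. real k * w k * tau w ^ k)" "Psi w (tau w) \<le> 1"
    and "Psi w (tau w) = 1 \<or> ereal (tau w) = conv_radius w"
proof -
  let ?R = "conv_radius w"
  have "\<exists>t>0. tau w = t \<and> summable (\<lambda>k. real k * w k * t ^ k) \<and> Psi w t \<le> 1 \<and> (Psi w t = 1 \<or> ereal t = ?R)"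
  proof (cases "\<exists>t>0. ereal t < ?R \<and> Psi w t \<ge> 1")
    case True
    then obtain t1 where t1: "t1 > 0" "ereal t1 < ?R" "Psi w t1 \<ge> 1" by blast
    define c where "c = (\<lambda>k. (real k - 1) * w k)"
    define h where "h = (\<lambda>t. \<Sum>k. c k * t ^ k)"
    have h: "h t = (Psi w t - 1) * Phi w t" if "t > 0" "ereal t < ?R" for t
      using Psi_balance[OF summable_inside[OF that] that(1)] by (simp add: h_def c_def sums_iff)
    obtain K where K: "ereal t1 < ereal K" "ereal K < ?R" using ereal_dense2[OF t1(2)] by blast
    then have "K > 0" using t1 by simp
    have "isCont h t" if "t \<in> {0..t1}" for t
      unfolding h_def
    proof (rule isCont_powser)
      show "summable (\<lambda>k. c k * K ^ k)"
        using Psi_balance[OF summable_inside[OF \<open>K > 0\<close> K(2)] \<open>K > 0\<close>] by (simp add: c_def sums_iff)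
      show "norm t < norm K" using that K \<open>K > 0\<close> by auto
    qed
    then have "continuous_on {0..t1} h" by (simp add: continuous_at_imp_continuous_on)
    moreover have "h 0 \<le> 0" using w0 by (simp add: h_def c_def powser_zero)
    moreover have "h t1 \<ge> 0" using h[OF t1(1,2)] t1 Phi_pos[OF summable_inside[OF t1(1,2)]] by simp
    ultimately obtain t0 where t0: "0 \<le> t0" "t0 \<le> t1" "h t0 = 0" using IVT'[of h 0 0 t1] t1 by auto
    have "t0 \<noteq> 0" using t0 w0 by (auto simp: h_def c_def powser_zero)
    then have t0_pos: "t0 > 0" using t0 by simp
    have "ereal t0 \<le> ereal t1" using t0 by simp
    then have t0_R: "ereal t0 < ?R" using t1(2) by (rule le_less_trans)
    note sum0 = summable_inside[OF t0_pos t0_R]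
    have Psi0: "Psi w t0 = 1" using h[OF t0_pos t0_R] t0 Phi_pos[OF sum0] t0_pos by simp
    have "ereal (Psi w t1) \<le> nu w" unfolding nu_eq by (rule SUP_upper) (use t1 in simp)
    moreover have "1 \<le> ereal (Psi w t1)" using t1(3) by simp
    ultimately have "nu w \<ge> 1" by (rule order_trans[rotated])
    then have "tau w = (THE t. 0 < t \<and> ereal t \<le> ?R \<and> summable (\<lambda>k. diffs w k * t ^ k) \<and> Psi w t = 1)"
      by (simp add: tau_def)
    also have "\<dots> = t0"
    proof (rule the_equality)
      have "summable (\<lambda>k. diffs w k * t0 ^ k)" using sum0 summable_diffs_iff[OF t0_pos] by blast
      with t0_pos t0_R Psi0 show ex: "0 < t0 \<and> ereal t0 \<le> ?R \<and> summable (\<lambda>k. diffs w k * t0 ^ k) \<and> Psi w t0 = 1"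
        by (intro conjI less_imp_le)
      show "t = t0" if "0 < t \<and> ereal t \<le> ?R \<and> summable (\<lambda>k. diffs w k * t ^ k) \<and> Psi w t = 1" for t
        by (rule Psi_1_unique) (use that ex in blast)+
    qed
    finally show ?thesis using t0_pos sum0 Psi0 by auto
  next
    case False
    then have less: "Psi w t < 1" if "t > 0" "ereal t < ?R" for t using that by force
    have partial: "(\<Sum>k<n. (real k - 1) * w k * t ^ k) \<le> 0" if "n \<ge> 1" "t > 0" "ereal t < ?R" for n t
    proof -
      note s = Psi_balance[OF summable_inside[OF that(2,3)] that(2)]
      have "(\<Sum>k<n. (real k - 1) * w k * t ^ k) \<le> (\<Sum>k. (real k - 1) * w k * t ^ k)"
      proof (rule sum_le_suminf)
        show "summable (\<lambda>k. (real k - 1) * w k * t ^ k)" using s by (rule sums_summable)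
        fix k assume "k \<in> - {..<n}"
        then have "k \<ge> 1" using that(1) by auto
        then show "0 \<le> (real k - 1) * w k * t ^ k" using w_nonneg that by simp
      qed simp
      also have "\<dots> = (Psi w t - 1) * Phi w t" using s by (simp add: sums_iff)
      also have "\<dots> \<le> 0" using less[OF that(2,3)] Phi_pos[OF summable_inside[OF that(2,3)]] that
        by (intro mult_nonpos_nonneg) auto
      finally show ?thesis .
    qed
    have fin: "?R \<noteq> \<infinity>"
    proof
      assume R: "?R = \<infinity>"
      obtain k where k: "k \<ge> 2" "w k > 0" using w_branching by auto
      \<comment> \<open>At this point the single term for \<open>k\<close> already exceeds \<open>w 0\<close>.\<close>
      define t where "t = 1 + w 0 / w k"
      have t: "t > 1" using w0 k by (simp add: t_def)
      have "(\<Sum>i\<in>{0, k}. (real i - 1) * w i * t ^ i) \<le> (\<Sum>i<Suc k. (real i - 1) * w i * t ^ i)"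
      proof (rule sum_mono2)
        fix i assume "i \<in> {..<Suc k} - {0, k}"
        then have "i \<ge> 1" by auto
        then show "0 \<le> (real i - 1) * w i * t ^ i" using w_nonneg t by simp
      qed auto
      also have "\<dots> \<le> 0" using partial[of "Suc k" t] t R by simp
      finally have "(real k - 1) * w k * t ^ k \<le> w 0" using k by simp
      moreover have "w k * t \<le> (real k - 1) * w k * t ^ k"
      proof -
        have "1 * (w k * t) \<le> (real k - 1) * (w k * t ^ k)"
        proof (rule mult_mono)
          have "t ^ 1 \<le> t ^ k" using t k by (intro power_increasing) auto
          then show "w k * t \<le> w k * t ^ k" using k by simp
        qed (use k t in auto)
        then show ?thesis by simp
      qed
      moreover have "w k * t = w k + w 0" using k by (simp add: t_def field_simps)
      ultimately show False using k by simp
    qed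
    obtain r where r: "?R = ereal r" using fin radius_pos by (cases ?R) auto
    have r0: "r > 0" using radius_pos r by simp
    have partial_r: "(\<Sum>k<n. (real k - 1) * w k * r ^ k) \<le> 0" if n: "n \<ge> 1" for n
    proof (rule tendsto_upperbound)
      show "((\<lambda>t. \<Sum>k<n. (real k - 1) * w k * t ^ k) \<longlongrightarrow> (\<Sum>k<n. (real k - 1) * w k * r ^ k)) (at_left r)"
        by (intro tendsto_intros)
      have "eventually (\<lambda>t. t \<in> {0<..<r}) (at_left r)" by (rule eventually_at_left_real[OF r0])
      then show "eventually (\<lambda>t. (\<Sum>k<n. (real k - 1) * w k * t ^ k) \<le> 0) (at_left r)"
        by eventually_elim (use partial n r in auto)
    qed simp
    define c where "c = (\<lambda>k. (real (Suc k) - 1) * w (Suc k) * r ^ Suc k)"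
    have shift: "(\<Sum>k<Suc n. (real k - 1) * w k * r ^ k) = - w 0 + (\<Sum>k<n. c k)" for n
      unfolding c_def by (subst sum.lessThan_Suc_shift) simp
    have c_nonneg: "c k \<ge> 0" for k using w_nonneg r0 by (simp add: c_def)
    have c_sum: "(\<Sum>k<n. c k) \<le> w 0" for n using partial_r[of "Suc n"] shift[of n] by simp
    have c_summable: "summable c"
    proof (rule bounded_imp_summable[where B = "w 0"])
      show "(\<Sum>k\<le>n. c k) \<le> w 0" for n using c_sum[of "Suc n"] by (simp add: lessThan_Suc_atMost)
    qed (rule c_nonneg)
    have sum_r: "summable (\<lambda>k. real k * w k * r ^ k)"
    proof (subst summable_Suc_iff[symmetric], rule summable_comparison_test'[where N = 1])
      show "summable (\<lambda>k. 2 * c k)" using c_summable by (rule summable_mult)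
      fix k :: nat assume "k \<ge> 1"
      then have "real (Suc k) * (w (Suc k) * r ^ Suc k) \<le> (2 * real k) * (w (Suc k) * r ^ Suc k)"
        by (intro mult_right_mono) (use w_nonneg r0 in auto)
      then show "norm (real (Suc k) * w (Suc k) * r ^ Suc k) \<le> 2 * c k"
        using w_nonneg[of "Suc k"] r0 by (simp add: c_def mult_ac)
    qed
    have Psi_r: "Psi w r \<le> 1"
    proof -
      note s = Psi_balance[OF sum_r r0]
      have "(\<Sum>k. (real k - 1) * w k * r ^ k) \<le> 0"
      proof (rule LIMSEQ_le_const2)
        show "(\<lambda>n. \<Sum>k<n. (real k - 1) * w k * r ^ k) \<longlonglongrightarrow> (\<Sum>k. (real k - 1) * w k * r ^ k)"
          by (rule summable_LIMSEQ) (rule sums_summable[OF s])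
        show "\<exists>N. \<forall>n\<ge>N. (\<Sum>k<n. (real k - 1) * w k * r ^ k) \<le> 0" using partial_r by blast
      qed
      then have "(Psi w r - 1) * Phi w r \<le> 0" using s by (simp add: sums_iff)
      then show ?thesis using Phi_pos[OF sum_r] r0 by (simp add: mult_le_0_iff)
    qed
    have "tau w = r"
    proof (cases "nu w \<ge> 1")
      case True
      have "nu w \<le> ereal (Psi w r)" unfolding nu_eq
      proof (rule SUP_least)
        fix t assume "t \<in> {t. 0 < t \<and> ereal t < ?R}"
        then show "ereal (Psi w t) \<le> ereal (Psi w r)" using Psi_strict_mono[of t r] sum_r r by simp
      qed
      with True have "1 \<le> ereal (Psi w r)" by (rule order_trans)
      then have "Psi w r = 1" using Psi_r by simp
      have "(THE t. 0 < t \<and> ereal t \<le> ?R \<and> summable (\<lambda>k. diffs w k * t ^ k) \<and> Psi w t = 1) = r"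
      proof (rule the_equality)
        have "summable (\<lambda>k. diffs w k * r ^ k)" using sum_r summable_diffs_iff[OF r0] by blast
        with r0 r \<open>Psi w r = 1\<close> show ex: "0 < r \<and> ereal r \<le> ?R \<and> summable (\<lambda>k. diffs w k * r ^ k) \<and> Psi w r = 1"
          by simp
        show "t = r" if "0 < t \<and> ereal t \<le> ?R \<and> summable (\<lambda>k. diffs w k * t ^ k) \<and> Psi w t = 1" for t
          by (rule Psi_1_unique) (use that ex in blast)+
      qed
      with True show ?thesis by (simp add: tau_def)
    next
      case False then show ?thesis by (simp add: tau_def r)
    qed
    then show ?thesis using r0 sum_r Psi_r r by auto
  qed
  then show "tau w > 0" "summable (\<lambda>k. real k * w k * tau w ^ k)" "Psi w (tau w) \<le> 1"
    "Psi w (tau w) = 1 \<or> ereal (tau w) = ?R" by auto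
qed

definition tilt :: "nat \<Rightarrow> real" where
  "tilt k = w k * tau w ^ k / Phi w (tau w)"

end

section \<open>The coupling\<close>

text \<open>
  The auxiliary randomness is an independent sequence of planted trees with the laws \<open>smaller_law n\<close>. Given
  \<open>V n = v\<close>, the tree \<open>T (n - |v|)\<close> is still a simply generated planted tree by independence, so the joined
  tree has the law \<open>join_law n\<close>, which is exponentially close to \<open>unrooted_law p n\<close>.
\<close>

theorem (in offspring) coupling:
  fixes M :: "'a measure" and T :: "nat \<Rightarrow> 'a \<Rightarrow> ptree"
  assumes M: "prob_space M"
    and Tm: "\<And>m. admissible_planted p m \<Longrightarrow> T m \<in> M \<rightarrow>\<^sub>M count_space UNIV"
    and Td: "\<And>m. admissible_planted p m \<Longrightarrow>
           distr M (count_space UNIV) (T m) = measure_pmf (planted_law p m)"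
  shows "\<exists>C>0. \<exists>c>0. \<exists>(N :: ('a \<times> (nat \<Rightarrow> ptree)) measure) V.
    prob_space N \<and> fst \<in> N \<rightarrow>\<^sub>M M \<and> distr N M fst = M \<and>
    (\<forall>n. admissible_unrooted p n \<longrightarrow>
       indep_rvs N
         (count_space UNIV) (V n)
         (\<Pi>\<^sub>M m\<in>{m. admissible_planted p m}. count_space UNIV)
         (\<lambda>\<omega>. \<lambda>m\<in>{m. admissible_planted p m}. T m (fst \<omega>)) \<and>
       (\<forall>\<omega>\<in>space N. psize (V n \<omega>) < n \<and> admissible_planted p (n - psize (V n \<omega>))) \<and>
       tv_dist (measure_pmf (unrooted_law p n))
         (distr N (count_space UNIV)
            (\<lambda>\<omega>. join_trees (T (n - psize (V n \<omega>)) (fst \<omega>)) (V n \<omega>)))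
       \<le> C * exp (- c * real n)) \<and>
    stoch_bounded (inf sequentially (principal {n. admissible_unrooted p n})) N
      (\<lambda>n \<omega>. real (psize (V n \<omega>))) \<and>
    conv_in_distr_discrete
      (inf sequentially (principal {n. [n = 2] (mod weight_span p)})) N V gw_pmf"
proof -
  interpret M: prob_space M by (rule M)
  let ?L = "\<lambda>n. measure_pmf (smaller_law n)"
  define Q where "Q = (\<Pi>\<^sub>M n\<in>UNIV. ?L n)"
  have L: "prob_space (?L n)" for n by (rule measure_pmf.prob_space_axioms)
  interpret Q: prob_space Q unfolding Q_def by (rule prob_space_PiM[OF L])
  define N where "N = M \<Otimes>\<^sub>M Q"
  interpret MQ: pair_prob_space M Q ..
  interpret N: prob_space N unfolding N_def by (rule MQ.prob_space_axioms)
  have space_Q: "space Q = UNIV" by (simp add: Q_def space_PiM PiE_UNIV_domain)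
  have space_N: "space N = space M \<times> UNIV" by (simp add: N_def space_pair_measure space_Q)
  \<comment> \<open>Values outside the support have probability zero; they are replaced to get all properties surely.\<close>
  define g where "g = (\<lambda>n V. if V \<in> set_pmf (smaller_law n) then V else SOME V. V \<in> set_pmf (smaller_law n))"
  define V where "V = (\<lambda>n (\<omega> :: 'a \<times> (nat \<Rightarrow> ptree)). g n (snd \<omega> n))"
  have V_supp: "V n \<omega> \<in> set_pmf (smaller_law n)" for n \<omega>
    using set_pmf_not_empty[of "smaller_law n"] by (auto simp: V_def g_def intro: someI)
  have comp: "(\<lambda>f. f n) \<in> Q \<rightarrow>\<^sub>M count_space UNIV" for n
  proof -
    have "(\<lambda>f. f n) \<in> Q \<rightarrow>\<^sub>M ?L n" unfolding Q_def by (rule measurable_component_singleton) simp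
    then show ?thesis by (simp only: measurable_cong_sets[OF refl sets_measure_pmf_count_space])
  qed
  have comp_law: "distr Q (count_space UNIV) (\<lambda>f. f n) = ?L n" for n
  proof -
    have "distr Q (?L n) (\<lambda>f. f n) = ?L n" unfolding Q_def by (rule distr_PiM_component[OF L]) simp
    then show ?thesis by (metis distr_cong sets_measure_pmf_count_space)
  qed
  have event_Q: "{f. g n (f n) \<in> B} \<in> sets Q" for n B
    using measurable_sets[OF comp, of "{V. g n V \<in> B}" n] by (simp add: space_Q vimage_def)
  have prob_Q: "measure Q {f. g n (f n) \<in> B} = measure_pmf.prob (smaller_law n) B" for n B
  proof -
    have "measure Q {f. g n (f n) \<in> B} = measure (distr Q (count_space UNIV) (\<lambda>f. f n)) {V. g n V \<in> B}"
      by (subst measure_distr[OF comp]) (auto simp: space_Q vimage_def)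
    also have "\<dots> = measure_pmf.prob (smaller_law n) ({V. g n V \<in> B} \<inter> set_pmf (smaller_law n))"
      by (simp add: comp_law measure_Int_set_pmf)
    also have "{V. g n V \<in> B} \<inter> set_pmf (smaller_law n) = B \<inter> set_pmf (smaller_law n)" by (auto simp: g_def)
    finally show ?thesis by (simp add: measure_Int_set_pmf)
  qed
  have rect: "A \<times> {f. g n (f n) \<in> B} \<in> sets N"
    "measure N (A \<times> {f. g n (f n) \<in> B}) = measure M A * measure_pmf.prob (smaller_law n) B" if "A \<in> sets M" for A n B
  proof -
    show "A \<times> {f. g n (f n) \<in> B} \<in> sets N" unfolding N_def using that event_Q by (rule pair_measureI)
    have "emeasure N (A \<times> {f. g n (f n) \<in> B}) = emeasure M A * emeasure Q {f. g n (f n) \<in> B}"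
      unfolding N_def by (rule Q.emeasure_pair_measure_Times[OF that event_Q])
    then show "measure N (A \<times> {f. g n (f n) \<in> B}) = measure M A * measure_pmf.prob (smaller_law n) B"
      unfolding prob_Q[symmetric] by (simp add: measure_def enn2real_mult)
  qed
  have event: "{\<omega> \<in> space N. fst \<omega> \<in> A \<and> V n \<omega> \<in> B} = A \<times> {f. g n (f n) \<in> B}" if "A \<in> sets M" for A n B
    using sets.sets_into_space[OF that] by (auto simp: space_N V_def)
  have V_event: "{\<omega> \<in> space N. V n \<omega> \<in> B} = space M \<times> {f. g n (f n) \<in> B}" for n B
    by (auto simp: space_N V_def)
  have V_meas: "V n \<in> N \<rightarrow>\<^sub>M count_space UNIV" for n
  proof (rule measurableI)
    fix B :: "ptree set"
    have "V n -` B \<inter> space N = {\<omega> \<in> space N. V n \<omega> \<in> B}" by auto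
    then show "V n -` B \<inter> space N \<in> sets N" unfolding V_event by (simp only: rect(1)[OF sets.top])
  qed simp
  have V_prob: "measure N {\<omega> \<in> space N. V n \<omega> \<in> B} = measure_pmf.prob (smaller_law n) B" for n B
    unfolding V_event rect(2)[OF sets.top] by (simp add: M.prob_space)
  have V_distr: "distr N (count_space UNIV) (V n) = ?L n" for n
  proof (rule measure_eqI)
    fix B assume "B \<in> sets (distr N (count_space UNIV) (V n))"
    have "V n -` B \<inter> space N = {\<omega> \<in> space N. V n \<omega> \<in> B}" by auto
    then have "emeasure (distr N (count_space UNIV) (V n)) B = emeasure N {\<omega> \<in> space N. V n \<omega> \<in> B}"
      by (subst emeasure_distr[OF V_meas]) auto
    then show "emeasure (distr N (count_space UNIV) (V n)) B = emeasure (?L n) B"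
      by (simp add: N.emeasure_eq_measure V_prob measure_pmf.emeasure_eq_measure)
  qed simp
  have fst_meas: "fst \<in> N \<rightarrow>\<^sub>M M" unfolding N_def by simp
  have fst_distr: "distr N M fst = M" unfolding N_def by (rule Q.distr_pair_fst)
  have support: "psize (V n \<omega>) < n" "admissible_planted p (n - psize (V n \<omega>))"
    if "admissible_unrooted p n" for n \<omega>
    using smaller_law_support[OF _ V_supp[of n \<omega>]] that by (auto simp: admissible_unrooted_iff admissible_planted_iff)
  have indep: "indep_rvs N (count_space UNIV) (V n)
      (\<Pi>\<^sub>M m\<in>{m. admissible_planted p m}. count_space UNIV) (\<lambda>\<omega>. \<lambda>m\<in>{m. admissible_planted p m}. T m (fst \<omega>))" for n
  proof -
    let ?A = "{m. admissible_planted p m}"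
    let ?S = "\<Pi>\<^sub>M m\<in>?A. count_space (UNIV :: ptree set)"
    let ?Z = "\<lambda>x. \<lambda>m\<in>?A. T m x"
    let ?Y = "\<lambda>\<omega> :: 'a \<times> (nat \<Rightarrow> ptree). \<lambda>m\<in>?A. T m (fst \<omega>)"
    have Y0: "?Z \<in> M \<rightarrow>\<^sub>M ?S" by (rule measurable_restrict) (simp add: Tm)
    have Y: "?Y \<in> N \<rightarrow>\<^sub>M ?S" using measurable_compose[OF fst_meas Y0] by simp
    have "N.indep_set {V n -` A \<inter> space N | A. A \<in> sets (count_space UNIV)} {?Y -` B \<inter> space N | B. B \<in> sets ?S}"
    proof (rule N.indep_setI)
      show "{V n -` A \<inter> space N | A. A \<in> sets (count_space UNIV)} \<subseteq> N.events"
        using measurable_sets[OF V_meas] by auto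
      show "{?Y -` B \<inter> space N | B. B \<in> sets ?S} \<subseteq> N.events" using measurable_sets[OF Y] by auto
      fix a b assume "a \<in> {V n -` A \<inter> space N | A. A \<in> sets (count_space UNIV)}" "b \<in> {?Y -` B \<inter> space N | B. B \<in> sets ?S}"
      then obtain A B where a: "a = V n -` A \<inter> space N" and b: "b = ?Y -` B \<inter> space N" and B: "B \<in> sets ?S" by blast
      define C where "C = ?Z -` B \<inter> space M"
      have C: "C \<in> sets M" unfolding C_def by (rule measurable_sets[OF Y0 B])
      have a': "a = {\<omega> \<in> space N. V n \<omega> \<in> A}" by (auto simp: a)
      have b': "b = C \<times> {f. g n (f n) \<in> UNIV}" by (auto simp: b C_def space_N)
      have ab: "a \<inter> b = C \<times> {f. g n (f n) \<in> A}" by (auto simp: a b C_def space_N V_def)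
      show "N.prob (a \<inter> b) = N.prob a * N.prob b"
        unfolding ab unfolding a' b' rect(2)[OF C] V_prob by simp
    qed
    then show ?thesis unfolding indep_rvs_def using V_meas Y by blast
  qed
  have join: "measure (distr N (count_space UNIV) (\<lambda>\<omega>. join_trees (T (n - psize (V n \<omega>)) (fst \<omega>)) (V n \<omega>))) E
      = measure_pmf.prob (join_law n) E" if adm: "admissible_unrooted p n" for n E
  proof -
    let ?J = "\<lambda>\<omega>. join_trees (T (n - psize (V n \<omega>)) (fst \<omega>)) (V n \<omega>)"
    let ?S = "set_pmf (smaller_law n)"
    have n: "n \<ge> 2" "pair_total p n > 0" using adm by (auto simp: admissible_unrooted_iff)
    have S: "?S \<subseteq> {v. psize v \<le> n}" using smaller_law_support(1)[OF n(2)] by (auto simp: less_imp_le)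
    then have fin: "finite ?S" by (rule finite_subset) (rule finite_psize_le)
    have admS: "admissible_planted p (n - psize v)" if "v \<in> ?S" for v
      using smaller_law_support(2)[OF n(2) that] by (simp add: admissible_planted_iff)
    define A where "A = (\<lambda>E v. T (n - psize v) -` {t. join_trees t v \<in> E} \<inter> space M)"
    have A: "A E v \<in> sets M" if "v \<in> ?S" for v E
      unfolding A_def by (rule measurable_sets[OF Tm[OF admS[OF that]]]) simp
    have pre: "?J -` E \<inter> space N = (\<Union>v\<in>?S. A E v \<times> {f. g n (f n) \<in> {v}})" for E
    proof (intro set_eqI iffI)
      fix \<omega> assume w: "\<omega> \<in> ?J -` E \<inter> space N"
      then have "fst \<omega> \<in> A E (V n \<omega>)" by (auto simp: A_def space_N)
      then have "\<omega> \<in> A E (V n \<omega>) \<times> {f. g n (f n) \<in> {V n \<omega>}}" by (cases \<omega>) (simp add: V_def)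
      then show "\<omega> \<in> (\<Union>v\<in>?S. A E v \<times> {f. g n (f n) \<in> {v}})" using V_supp by blast
    next
      fix \<omega> assume "\<omega> \<in> (\<Union>v\<in>?S. A E v \<times> {f. g n (f n) \<in> {v}})"
      then show "\<omega> \<in> ?J -` E \<inter> space N" by (auto simp: A_def space_N V_def)
    qed
    have J: "?J \<in> N \<rightarrow>\<^sub>M count_space UNIV"
    proof (rule measurableI)
      fix E
      show "?J -` E \<inter> space N \<in> sets N"
        unfolding pre by (rule sets.finite_UN[OF fin]) (rule rect(1)[OF A])
    qed simp
    have "measure (distr N (count_space UNIV) ?J) E = measure N (\<Union>v\<in>?S. A E v \<times> {f. g n (f n) \<in> {v}})"
      by (subst measure_distr[OF J]) (simp_all only: pre sets_count_space Pow_UNIV UNIV_I)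
    also have "\<dots> = (\<Sum>v\<in>?S. measure N (A E v \<times> {f. g n (f n) \<in> {v}}))"
    proof (rule N.finite_measure_finite_Union[OF fin])
      show "(\<lambda>v. A E v \<times> {f. g n (f n) \<in> {v}}) ` ?S \<subseteq> sets N" by (intro image_subsetI rect(1)[OF A])
      show "disjoint_family_on (\<lambda>v. A E v \<times> {f. g n (f n) \<in> {v}}) ?S" by (auto simp: disjoint_family_on_def)
    qed
    also have "\<dots> = (\<Sum>v\<in>?S. pmf (smaller_law n) v * measure_pmf.prob (planted_law p (n - psize v)) {t. join_trees t v \<in> E})"
    proof (rule sum.cong[OF refl])
      fix v assume v: "v \<in> ?S"
      have "measure M (A E v) = measure (distr M (count_space UNIV) (T (n - psize v))) {t. join_trees t v \<in> E}"
        unfolding A_def by (rule measure_distr[symmetric, OF Tm[OF admS[OF v]]]) simp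
      then show "measure N (A E v \<times> {f. g n (f n) \<in> {v}})
          = pmf (smaller_law n) v * measure_pmf.prob (planted_law p (n - psize v)) {t. join_trees t v \<in> E}"
        unfolding rect(2)[OF A[OF v]] Td[OF admS[OF v]] by (simp add: measure_pmf_single)
    qed
    also have "\<dots> = (\<Sum>v | psize v \<le> n. pmf (smaller_law n) v * measure_pmf.prob (planted_law p (n - psize v)) {t. join_trees t v \<in> E})"
      by (rule sum.mono_neutral_left[OF finite_psize_le S]) (auto simp: set_pmf_iff)
    also have "\<dots> = measure_pmf.prob (join_law n) E" by (rule join_law_measure[OF n, symmetric])
    finally show ?thesis .
  qed
  obtain C c where Cc: "C > 0" "c > 0" "\<And>n. n \<ge> 2 \<Longrightarrow> pair_total p n > 0 \<Longrightarrow>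
     min 1 (4 * real (n - 1) * symmetric_total n / pair_total p n) \<le> C * exp (- c * real n)"
    using symmetric_total_negligible by blast
  have tv: "tv_dist (measure_pmf (unrooted_law p n))
      (distr N (count_space UNIV) (\<lambda>\<omega>. join_trees (T (n - psize (V n \<omega>)) (fst \<omega>)) (V n \<omega>))) \<le> C * exp (- c * real n)"
    if adm: "admissible_unrooted p n" for n
    unfolding tv_dist_def
  proof (rule cSUP_least)
    have n: "n \<ge> 2" "pair_total p n > 0" using adm by (auto simp: admissible_unrooted_iff)
    fix E
    show "\<bar>measure (measure_pmf (unrooted_law p n)) E -
       measure (distr N (count_space UNIV) (\<lambda>\<omega>. join_trees (T (n - psize (V n \<omega>)) (fst \<omega>)) (V n \<omega>))) E\<bar> \<le> C * exp (- c * real n)"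
      unfolding join[OF adm] using unrooted_join_distance[OF n, of E] Cc(3)[OF n] by linarith
  qed auto
  have expectation_limit: "((\<lambda>n. \<integral>\<omega>. f (V n \<omega>) \<partial>N) \<longlongrightarrow> measure_pmf.expectation gw_pmf f) (inf sequentially (principal S))"
    if f: "bounded (range f)" and S: "\<And>n. n \<in> S \<Longrightarrow> n \<ge> 2 \<Longrightarrow> d dvd n - 2" for f :: "ptree \<Rightarrow> real" and S
  proof -
    have "(\<integral>\<omega>. f (V n \<omega>) \<partial>N) = measure_pmf.expectation (smaller_law n) f" for n
    proof -
      have "measure_pmf.expectation (smaller_law n) f = (\<integral>v. f v \<partial>distr N (count_space UNIV) (V n))" by (simp only: V_distr)
      also have "\<dots> = (\<integral>\<omega>. f (V n \<omega>) \<partial>N)" by (rule integral_distr[OF V_meas]) simp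
      finally show ?thesis by simp
    qed
    moreover have "((\<lambda>n. measure_pmf.expectation (smaller_law n) f) \<longlongrightarrow> measure_pmf.expectation gw_pmf f)
        (filtermap (\<lambda>i. 2 + d * i) sequentially)"
      using pmf_limit_expectation[OF smaller_law_limit f] by (simp add: filterlim_filtermap)
    ultimately show ?thesis
      using tendsto_mono[OF lattice_filter_le[OF weight_span_pos S]] by simp
  qed
  have conv: "conv_in_distr_discrete (inf sequentially (principal {n. [n = 2] (mod weight_span p)})) N V gw_pmf"
    unfolding conv_in_distr_discrete_def
  proof (intro allI impI)
    fix f :: "ptree \<Rightarrow> real" assume f: "bounded (range f)"
    show "((\<lambda>n. \<integral>\<omega>. f (V n \<omega>) \<partial>N) \<longlongrightarrow> measure_pmf.expectation gw_pmf f)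
        (inf sequentially (principal {n. [n = 2] (mod weight_span p)}))"
      by (rule expectation_limit[OF f]) (simp add: cong_def mod_eq_dvd_iff_nat)
  qed
  have bounded: "stoch_bounded (inf sequentially (principal {n. admissible_unrooted p n})) N (\<lambda>n \<omega>. real (psize (V n \<omega>)))"
    unfolding stoch_bounded_def
  proof (intro allI impI)
    fix e :: real assume e: "e > 0"
    let ?F = "inf sequentially (principal {n. admissible_unrooted p n})"
    have "(\<lambda>B. measure_pmf.prob gw_pmf {v. psize v \<le> B}) \<longlonglongrightarrow> measure_pmf.prob gw_pmf (\<Union>B. {v. psize v \<le> B})"
      by (rule measure_pmf.finite_Lim_measure_incseq) (auto simp: incseq_def)
    moreover have "(\<Union>B. {v. psize v \<le> B}) = UNIV" by auto
    ultimately have "(\<lambda>B. measure_pmf.prob gw_pmf {v. psize v \<le> B}) \<longlonglongrightarrow> 1" by simp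
    then have "eventually (\<lambda>B. measure_pmf.prob gw_pmf {v. psize v \<le> B} > 1 - e) sequentially"
      by (rule order_tendstoD) (use e in simp)
    then obtain B where B: "measure_pmf.prob gw_pmf {v. psize v \<le> B} > 1 - e" by (auto simp: eventually_sequentially)
    let ?H = "{v. real (psize v) \<ge> real (Suc B)}"
    let ?h = "indicator ?H :: ptree \<Rightarrow> real"
    have H: "?H = - {v. psize v \<le> B}" by auto
    have "measure_pmf.prob gw_pmf ?H < e"
      unfolding H using B measure_pmf.prob_compl[of "{v. psize v \<le> B}" gw_pmf] by (simp add: Compl_eq_Diff_UNIV)
    moreover have "((\<lambda>n. \<integral>\<omega>. ?h (V n \<omega>) \<partial>N) \<longlongrightarrow> measure_pmf.expectation gw_pmf ?h) ?F"
      by (rule expectation_limit[of ?h])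
         (auto simp: bounded_iff indicator_def admissible_unrooted_iff intro!: exI[of _ 1] pair_total_pos_dvd)
    moreover have "(\<integral>\<omega>. ?h (V n \<omega>) \<partial>N) = measure N {\<omega> \<in> space N. \<bar>real (psize (V n \<omega>))\<bar> \<ge> real (Suc B)}" for n
    proof -
      have "(\<integral>\<omega>. ?h (V n \<omega>) \<partial>N) = (\<integral>v. ?h v \<partial>distr N (count_space UNIV) (V n))"
        by (rule integral_distr[symmetric, OF V_meas]) simp
      also have "\<dots> = measure_pmf.prob (smaller_law n) ?H" by (simp add: V_distr)
      also have "\<dots> = measure N {\<omega> \<in> space N. V n \<omega> \<in> ?H}" by (rule V_prob[symmetric])
      finally show ?thesis by (simp only: mem_Collect_eq abs_of_nat)
    qed
    ultimately have "((\<lambda>n. measure N {\<omega> \<in> space N. \<bar>real (psize (V n \<omega>))\<bar> \<ge> real (Suc B)}) \<longlongrightarrow> measure_pmf.prob gw_pmf ?H) ?F"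
      by simp
    then have "eventually (\<lambda>n. measure N {\<omega> \<in> space N. \<bar>real (psize (V n \<omega>))\<bar> \<ge> real (Suc B)} < e) ?F"
      by (rule order_tendstoD) fact
    then have "eventually (\<lambda>n. ereal (measure N {\<omega> \<in> space N. \<bar>real (psize (V n \<omega>))\<bar> \<ge> real (Suc B)}) \<le> ereal e) ?F"
      by eventually_elim simp
    then have "Limsup ?F (\<lambda>n. ereal (measure N {\<omega> \<in> space N. \<bar>real (psize (V n \<omega>))\<bar> \<ge> real (Suc B)})) \<le> ereal e"
      by (rule Limsup_bounded)
    then show "\<exists>B>0. Limsup ?F (\<lambda>n. ereal (measure N {\<omega> \<in> space N. \<bar>real (psize (V n \<omega>))\<bar> \<ge> B})) \<le> ereal e"
      by (intro exI[of _ "real (Suc B)"]) simp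
  qed
  show ?thesis
    by (rule exI[of _ C], rule conjI[OF Cc(1)], rule exI[of _ c], rule conjI[OF Cc(2)], rule exI[of _ N], rule exI[of _ V],
        intro conjI allI impI ballI)
       (use N.prob_space_axioms fst_meas fst_distr indep support tv conv bounded in auto)
qed

section \<open>From arbitrary weights to the canonical offspring law\<close>

context weight_sequence
begin

lemma Phi_tau_pos: "Phi w (tau w) > 0"
  using Phi_pos tau_properties by (simp add: less_imp_le)

text \<open>
  If \<open>tau w\<close> is the radius of convergence of \<open>w\<close>, then the tilted sequence has radius of convergence 1;
  otherwise its mean \<open>Psi w (tau w)\<close> is 1.
\<close>

theorem offspring_tilt: "offspring tilt"
proof
  note T = tau_properties
  let ?Z = "Phi w (tau w)"
  have sw: "summable (\<lambda>k. w k * tau w ^ k)" by (rule summable_w[OF T(2)]) (use T(1) in simp)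
  show "tilt k \<ge> 0" for k using w_nonneg T(1) Phi_tau_pos by (simp add: tilt_def)
  have "(\<lambda>k. w k * tau w ^ k / ?Z) sums (?Z / ?Z)"
    by (intro sums_divide) (use sw in \<open>simp add: Phi_def summable_sums\<close>)
  then show "tilt sums 1" using Phi_tau_pos by (simp add: tilt_def[abs_def])
  show "tilt 0 > 0" using w0 Phi_tau_pos by (simp add: tilt_def)
  show "\<exists>k\<ge>2. tilt k > 0" using w_branching T(1) Phi_tau_pos by (auto simp: tilt_def)
  have "(\<lambda>k. real k * w k * tau w ^ k / ?Z) sums (tilted_mean (tau w) / ?Z)"
    unfolding tilted_mean_def by (intro sums_divide summable_sums T(2))
  then have mean: "(\<lambda>k. real k * tilt k) sums Psi w (tau w)"
    unfolding Psi_eq[OF T(2,1)] by (simp add: tilt_def mult.assoc)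
  then show "summable (\<lambda>k. real k * tilt k)" by (rule sums_summable)
  show "(\<Sum>k. real k * tilt k) \<le> 1" using mean T(3) by (simp add: sums_iff)
  have "\<not> summable (\<lambda>k. tilt k * s ^ k)" if R: "ereal (tau w) = conv_radius w" and s: "s > 1" for s
  proof
    assume "summable (\<lambda>k. tilt k * s ^ k)"
    then have "summable (\<lambda>k. ?Z * (tilt k * s ^ k))" by (rule summable_mult)
    then have "summable (\<lambda>k. w k * (tau w * s) ^ k)"
      using Phi_tau_pos by (simp add: tilt_def power_mult_distrib mult_ac)
    then have "ereal (norm (tau w * s)) \<le> conv_radius w" by (rule conv_radius_geI)
    then have "tau w * s \<le> tau w" using R[symmetric] T(1) s by simp
    then show False using T(1) s by simp
  qed
  then show "(\<Sum>k. real k * tilt k) = 1 \<or> (\<forall>s>1. \<not> summable (\<lambda>k. tilt k * s ^ k))"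
    using T(4) mean by (auto simp: sums_iff)
qed

text \<open>
  The outdegrees of a tree with \<open>n\<close> vertices sum to \<open>n - 1\<close>, so the tilt multiplies its weight by a factor that
  only depends on \<open>n\<close>.
\<close>

lemma pweight_tilt: "tau w * pweight tilt V = pweight w V * (tau w / Phi w (tau w)) ^ psize V"
proof (induction V)
  case (Node ts)
  let ?\<rho> = "tau w / Phi w (tau w)"
  have "tau w ^ length ts * prod_list (map (pweight tilt) ts) = prod_list (map (pweight w) ts) * ?\<rho> ^ sum_list (map psize ts)"
    using Node
  proof (induction ts)
    case (Cons V ts)
    have "tau w ^ length (V # ts) * prod_list (map (pweight tilt) (V # ts))
        = (tau w * pweight tilt V) * (tau w ^ length ts * prod_list (map (pweight tilt) ts))" by (simp add: mult_ac)
    also have "\<dots> = (pweight w V * ?\<rho> ^ psize V) * (prod_list (map (pweight w) ts) * ?\<rho> ^ sum_list (map psize ts))"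
      using Cons by simp
    finally show ?case by (simp add: power_add mult_ac)
  qed simp
  note forest = this
  have "tilt (length ts) = w (length ts) * tau w ^ length ts / Phi w (tau w)" by (simp add: tilt_def)
  then have "tau w * pweight tilt (Node ts)
      = ?\<rho> * w (length ts) * (tau w ^ length ts * prod_list (map (pweight tilt) ts))" by (simp add: pweight_Node)
  also have "\<dots> = ?\<rho> * w (length ts) * (prod_list (map (pweight w) ts) * ?\<rho> ^ sum_list (map psize ts))"
    by (simp only: forest)
  finally show ?case by (simp add: pweight_Node psize_Node)
qed

lemma uweight_tilt:
  assumes "usize U \<ge> 2" shows "(tau w)\<^sup>2 * uweight tilt U = uweight w U * (tau w / Phi w (tau w)) ^ usize U"
proof -
  have "U \<in> (\<lambda>(T, V). join_trees T V) ` pairs (usize U)" unfolding usize_image[OF assms, symmetric] by simp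
  then obtain T V where U: "U = join_trees T V" by auto
  have "(tau w)\<^sup>2 * uweight tilt U = (tau w * pweight tilt T) * (tau w * pweight tilt V)"
    by (simp add: U uweight_join_trees power2_eq_square)
  then show ?thesis by (simp add: U uweight_join_trees usize_join_trees pweight_tilt power_add)
qed

lemma tilt_factor_pos: "tau w / Phi w (tau w) > 0"
  using tau_properties(1) Phi_tau_pos by simp

lemma planted_law_tilt: "planted_law tilt m = planted_law w m"
  unfolding planted_law_def
proof (rule weighted_pmf_scale)
  have "(tau w / Phi w (tau w)) ^ m / tau w > 0"
    by (intro divide_pos_pos zero_less_power tilt_factor_pos tau_properties(1))
  then show "(tau w / Phi w (tau w)) ^ m / tau w \<noteq> 0" by (rule dual_order.strict_implies_not_eq)
  show "pweight tilt V = (tau w / Phi w (tau w)) ^ m / tau w * pweight w V" if "V \<in> {T. psize T = m}" for V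
  proof -
    have "pweight tilt V = tau w * pweight tilt V / tau w" using tau_properties(1) by simp
    also have "\<dots> = pweight w V * (tau w / Phi w (tau w)) ^ m / tau w"
      using that by (simp only: pweight_tilt mem_Collect_eq)
    finally show ?thesis by (simp add: mult_ac)
  qed
qed

lemma unrooted_law_tilt:
  assumes "n \<ge> 2" shows "unrooted_law tilt n = unrooted_law w n"
  unfolding unrooted_law_def
proof (rule weighted_pmf_scale)
  have "(tau w / Phi w (tau w)) ^ n / (tau w)\<^sup>2 > 0"
    by (intro divide_pos_pos zero_less_power tilt_factor_pos tau_properties(1))
  then show "(tau w / Phi w (tau w)) ^ n / (tau w)\<^sup>2 \<noteq> 0" by (rule dual_order.strict_implies_not_eq)
  show "uweight tilt U = (tau w / Phi w (tau w)) ^ n / (tau w)\<^sup>2 * uweight w U" if "U \<in> {U. usize U = n}" for U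
  proof -
    have U: "usize U = n" using that by simp
    then have "(tau w)\<^sup>2 * uweight tilt U = uweight w U * (tau w / Phi w (tau w)) ^ n"
      using uweight_tilt[of U] assms by simp
    moreover have "(tau w)\<^sup>2 \<noteq> 0" using tau_properties(1) by simp
    ultimately show ?thesis by (simp add: nonzero_eq_divide_eq mult_ac)
  qed
qed

lemma pos_scale_iff: "0 < c \<Longrightarrow> 0 < x * c \<longleftrightarrow> 0 < (x :: real)"
  by (simp add: zero_less_mult_iff)

lemma pweight_tilt_pos: "pweight tilt V > 0 \<longleftrightarrow> pweight w V > 0"
proof -
  have "pweight tilt V > 0 \<longleftrightarrow> tau w * pweight tilt V > 0" using tau_properties(1) by (simp add: zero_less_mult_iff)
  also have "\<dots> \<longleftrightarrow> pweight w V > 0"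
    unfolding pweight_tilt by (rule pos_scale_iff[OF zero_less_power[OF tilt_factor_pos]])
  finally show ?thesis .
qed

lemma uweight_tilt_pos:
  assumes "usize U \<ge> 2" shows "uweight tilt U > 0 \<longleftrightarrow> uweight w U > 0"
proof -
  have "uweight tilt U > 0 \<longleftrightarrow> (tau w)\<^sup>2 * uweight tilt U > 0" using tau_properties(1) by (simp add: zero_less_mult_iff)
  also have "\<dots> \<longleftrightarrow> uweight w U > 0"
    unfolding uweight_tilt[OF assms] by (rule pos_scale_iff[OF zero_less_power[OF tilt_factor_pos]])
  finally show ?thesis .
qed

lemma admissible_planted_tilt: "admissible_planted tilt = admissible_planted w"
  by (auto simp: admissible_planted_def pweight_tilt_pos fun_eq_iff)

lemma admissible_unrooted_tilt: "admissible_unrooted tilt = admissible_unrooted w"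
  by (auto simp: admissible_unrooted_def uweight_tilt_pos fun_eq_iff)

lemma weight_span_tilt: "weight_span tilt = weight_span w"
proof -
  have "tilt i > 0 \<longleftrightarrow> w i > 0" for i
    unfolding tilt_def times_divide_eq_right[symmetric]
    by (rule pos_scale_iff[OF divide_pos_pos[OF zero_less_power[OF tau_properties(1)] Phi_tau_pos]])
  then show ?thesis by (simp add: weight_span_def)
qed

end

theorem theorem2p2:
  fixes w :: "nat \<Rightarrow> real" and M :: "'a measure" and T :: "nat \<Rightarrow> 'a \<Rightarrow> ptree"
  assumes "\<And>i. w i \<ge> 0"
    and "w 0 > 0"
    and "\<exists>k\<ge>2. w k > 0"
    and "conv_radius w > 0"
    and "prob_space M"
    and "\<And>m. admissible_planted w m \<Longrightarrow> T m \<in> M \<rightarrow>\<^sub>M count_space UNIV"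
    and "\<And>m. admissible_planted w m \<Longrightarrow>
           distr M (count_space UNIV) (T m) = measure_pmf (planted_law w m)"
  shows "\<exists>C>0. \<exists>c>0. \<exists>(N :: ('a \<times> (nat \<Rightarrow> ptree)) measure) V.
    prob_space N \<and> fst \<in> N \<rightarrow>\<^sub>M M \<and> distr N M fst = M \<and>
    (\<forall>n. admissible_unrooted w n \<longrightarrow>
       indep_rvs N
         (count_space UNIV) (V n)
         (\<Pi>\<^sub>M m\<in>{m. admissible_planted w m}. count_space UNIV)
         (\<lambda>\<omega>. \<lambda>m\<in>{m. admissible_planted w m}. T m (fst \<omega>)) \<and>
       (\<forall>\<omega>\<in>space N. psize (V n \<omega>) < n \<and> admissible_planted w (n - psize (V n \<omega>))) \<and>
       tv_dist (measure_pmf (unrooted_law w n))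
         (distr N (count_space UNIV)
            (\<lambda>\<omega>. join_trees (T (n - psize (V n \<omega>)) (fst \<omega>)) (V n \<omega>)))
       \<le> C * exp (- c * real n)) \<and>
    stoch_bounded (inf sequentially (principal {n. admissible_unrooted w n})) N
      (\<lambda>n \<omega>. real (psize (V n \<omega>))) \<and>
    (\<exists>G. galton_watson_law (canonical_offspring w) G \<and>
         sub_or_critical (canonical_offspring w) \<and>
         conv_in_distr_discrete
           (inf sequentially (principal {n. [n = 2] (mod weight_span w)})) N V G)"
proof -
  interpret W: weight_sequence w by standard (fact assms)+
  interpret P: offspring W.tilt by (rule W.offspring_tilt)
  have can: "canonical_offspring w = P.offspring_pmf"
    unfolding canonical_offspring_def P.offspring_pmf_def by (rule arg_cong[of _ _ embed_pmf]) (rule ext, simp add: W.tilt_def)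
  have law: "unrooted_law W.tilt n = unrooted_law w n" if "admissible_unrooted w n" for n
    using that by (intro W.unrooted_law_tilt) (simp add: admissible_unrooted_def)
  note * = P.coupling[OF assms(5), of T, unfolded W.admissible_planted_tilt W.admissible_unrooted_tilt
      W.weight_span_tilt W.planted_law_tilt, OF assms(6,7)]
  then obtain C c and N :: "('a \<times> (nat \<Rightarrow> ptree)) measure" and V where
    "C > 0" "c > 0" and main: "prob_space N \<and> fst \<in> N \<rightarrow>\<^sub>M M \<and> distr N M fst = M \<and>
    (\<forall>n. admissible_unrooted w n \<longrightarrow>
       indep_rvs N
         (count_space UNIV) (V n)
         (\<Pi>\<^sub>M m\<in>{m. admissible_planted w m}. count_space UNIV)
         (\<lambda>\<omega>. \<lambda>m\<in>{m. admissible_planted w m}. T m (fst \<omega>)) \<and>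
       (\<forall>\<omega>\<in>space N. psize (V n \<omega>) < n \<and> admissible_planted w (n - psize (V n \<omega>))) \<and>
       tv_dist (measure_pmf (unrooted_law W.tilt n))
         (distr N (count_space UNIV)
            (\<lambda>\<omega>. join_trees (T (n - psize (V n \<omega>)) (fst \<omega>)) (V n \<omega>)))
       \<le> C * exp (- c * real n)) \<and>
    stoch_bounded (inf sequentially (principal {n. admissible_unrooted w n})) N
      (\<lambda>n \<omega>. real (psize (V n \<omega>))) \<and>
    conv_in_distr_discrete
      (inf sequentially (principal {n. [n = 2] (mod weight_span w)})) N V P.gw_pmf" by blast
  have gw: "\<exists>G. galton_watson_law (canonical_offspring w) G \<and> sub_or_critical (canonical_offspring w) \<and>
      conv_in_distr_discrete (inf sequentially (principal {n. [n = 2] (mod weight_span w)})) N V G"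
    unfolding can using P.galton_watson P.sub_or_critical_offspring main by blast
  show ?thesis
    by (rule exI[of _ C], rule conjI[OF \<open>C > 0\<close>], rule exI[of _ c], rule conjI[OF \<open>c > 0\<close>], rule exI[of _ N], rule exI[of _ V])
       (use main law gw in simp)
qed

end
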